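(* Let $A=KQ/I$ be a finite-dimensional algebra over an algebraically closed field $K$ of characteristic zero. Let $\theta\in\mathbb Z^{Q_0}$ be an integral weight and $\mathbf d_1,\dots,\mathbf d_n\in\mathbb Z_{\ge0}^{Q_0}$ dimension vectors with $\theta(\mathbf d_1)=\dots=\theta(\mathbf d_n)=0$. Assume that $\operatorname{SI}(A,\mathbf d_i)_\theta\ne0$ for all $1\le i\le n$. (a) There exists a dimension vector $\widehat{\mathbf c}\in\mathbb Z_{\ge0}^{\widehat Q_0}$ of the double quiver $\widehat Q$ such that $\langle\widehat{\mathbf c},\widehat{\mathbf d}_i\rangle_{\widehat Q}=0$ for all $1\le i\le n$, and $$\operatorname{span}_K\{\operatorname{res}_{A,\mathbf d_i}(c^{\widehat V})\mid\widehat V\in\operatorname{rep}(\widehat Q,\widehat{\mathbf c})\}=\operatorname{SI}(A,\mathbf d_i)_\theta\quad\text{for all }1\le i\le n.$$ (b) Let $C_i\subseteq\operatorname{rep}(A,\mathbf d_i)$ be irreducible $\operatorname{GL}(\mathbf d_i)$-invariant closed subvarieties ($1\le i\le n$) such that $\operatorname{SI}(C_i)_\theta\ne0$ for all $1\le i\le n$. Let $\widehat{\mathbf c}$ be any dimension vector having the two properties in (a). Then there exists a nonempty open subset $\mathcal U\subseteq\operatorname{rep}(\widehat Q,\widehat{\mathbf c})$ such that $$\operatorname{span}_K\{\operatorname{res}_{C_i}(c^{\widehat V})\mid\widehat V\in\mathcal U\}=\operatorname{SI}(C_i)_\theta\quad\text{for all }1\le i\le n,$$ and $\operatorname{res}_{C_i}(c^{\widehat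 V})\neq0$ for all $\widehat V\in\mathcal U$ and all $1\le i\le n$.
   Context: $K$ is algebraically closed of characteristic zero. $A=KQ/I$ with $Q$ a finite quiver (oriented cycles allowed), $I$ an admissible ideal generated by a finite set $\mathcal R$ of relations; $ta,ha$ are the tail and head of an arrow $a$. For a dimension vector $\mathbf d$, $\operatorname{rep}(Q,\mathbf d)=\prod_{a\in Q_1}\operatorname{Mat}_{\mathbf d(ha)\times\mathbf d(ta)}(K)$ and $\operatorname{rep}(A,\mathbf d)\subseteq\operatorname{rep}(Q,\mathbf d)$ is the closed (reduced) subvariety of $M$ with $M(r)=0$ for all $r\in\mathcal R$; $\operatorname{GL}(\mathbf d)=\prod_{x\in Q_0}\operatorname{GL}(\mathbf d(x),K)$ acts by base change. For $\theta\in\mathbb Z^{Q_0}$: $\theta(\mathbf d)=\sum_x\theta(x)\mathbf d(x)$ and $\chi_\theta(g)=\prod_x\det g(x)^{\theta(x)}$. For a $\operatorname{GL}(\mathbf d)$-invariant closed subvariety $C\subseteq\operatorname{rep}(A,\mathbf d)$, $\operatorname{SI}(C)_\theta=\{f\in K[C]\mid g\cdot f=\chi_\theta(g)f\ \forall g\in\operatorname{GL}(\mathbf d)\}$ with $(g\cdot f)(x)=f(g^{-1}x)$; $\operatorname{SI}(A,\mathbf d)_\theta=\operatorname{SI}(\operatorname{rep}(A,\mathbf d))_\theta$. The double quiver $\widehat Q$ of $Q$ has vertices $\widehat Q_0=Q_0\times\{0,1\}$ (written $v_0,v_1$ for $v\in Q_0$) and arrows $c_v\colon v_0\to v_1$ for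 $v\in Q_0$ and $\widehat a\colon(ta)_0\to(ha)_1$ for $a\in Q_1$. For $\mathbf d\in\mathbb Z^{Q_0}$, $\widehat{\mathbf d}(v_0)=\widehat{\mathbf d}(v_1)=\mathbf d(v)$. The closed embedding $\tau_{\mathbf d}\colon\operatorname{rep}(Q,\mathbf d)\to\operatorname{rep}(\widehat Q,\widehat{\mathbf d})$ sends $V$ to $\widehat V$ with $\widehat V(c_v)=\operatorname{Id}_{V(v)}$ and $\widehat V(\widehat a)=V(a)$. The Euler form of $\widehat Q$ is $\langle\mathbf e,\mathbf f\rangle_{\widehat Q}=\sum_{i\in\widehat Q_0}\mathbf e(i)\mathbf f(i)-\sum_{b\in\widehat Q_1}\mathbf e(tb)\mathbf f(hb)$. If $\langle\widehat{\mathbf c},\widehat{\mathbf d}\rangle_{\widehat Q}=0$, then for $\widehat V\in\operatorname{rep}(\widehat Q,\widehat{\mathbf c})$ and $\widehat W\in\operatorname{rep}(\widehat Q,\widehat{\mathbf d})$ the linear map $d^{\widehat V}_{\widehat W}\colon\bigoplus_{i\in\widehat Q_0}\operatorname{Hom}_K(\widehat V(i),\widehat W(i))\to\bigoplus_{b\in\widehat Q_1}\operatorname{Hom}_K(\widehat V(tb),\widehat W(hb))$, $(\varphi(i))_i\mapsto(\varphi(hb)\widehat V(b)-\widehat W(b)\varphi(tb))_b$, is represented by a square matrix (in the standard bases), and $c^{\widehat V}(\widehat W):=\det(d^{\widehat V}_{\widehat W})$ defines the Schofield determinantal semi-invariant $c^{\widehat V}$ on $\operatorname{rep}(\widehat Q,\widehat{\mathbf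 d})$. Set $\operatorname{res}_{A,\mathbf d}(c^{\widehat V})=(c^{\widehat V}\circ\tau_{\mathbf d})|_{\operatorname{rep}(A,\mathbf d)}$ and, for a subvariety $C\subseteq\operatorname{rep}(A,\mathbf d)$, $\operatorname{res}_C(c^{\widehat V})=(c^{\widehat V}\circ\tau_{\mathbf d})|_C$. *)

theory Defs
  imports
    "HOL-Library.Function_Algebras"
    "HOL-Library.Countable_Set"
    "HOL-Algebra.Ideal_Product"
    "HOL-Algebra.Product_Groups"
    "Graph_Theory.Arc_Walk"
    "Jordan_Normal_Form.Determinant"
begin

section \<open>Path algebras and admissible ideals\<close>

text \<open>
  A finite quiver is a \<^locale>\<open>fin_digraph\<close> (loops and parallel arrows are allowed).
  The pair \<open>(u, p)\<close> stands for the path that starts at \<open>u\<close> and runs through the arrows of the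
  list \<open>p\<close> in order of traversal; \<open>(u, [])\<close> is the trivial path at \<open>u\<close>. An element of \<open>KQ\<close> is
  the function sending a path to its coefficient.
\<close>

abbreviation path_target :: "('v, 'a) pre_digraph \<Rightarrow> 'v \<Rightarrow> 'a list \<Rightarrow> 'v" where
  "path_target Q u p \<equiv> pre_digraph.awlast Q u p"

definition quiver_paths :: "('v, 'a) pre_digraph \<Rightarrow> ('v \<times> 'a list) set" where
  "quiver_paths Q = {(u, p). \<exists>v. pre_digraph.awalk Q u p v}"

definition path_algebra :: "('v, 'a) pre_digraph \<Rightarrow> ('v \<times> 'a list \<Rightarrow> 'k::field) ring" where
  "path_algebra Q = \<lparr>
     carrier = {x. finite {w. x w \<noteq> 0} \<and> {w. x w \<noteq> 0} \<subseteq> quiver_paths Q},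
     monoid.mult = (\<lambda>x y (u, p). \<Sum>k\<le>length p.
               x (u, take k p) * y (path_target Q u (take k p), drop k p)),
     one = (\<lambda>(u, p). if u \<in> verts Q \<and> p = [] then 1 else 0),
     zero = 0,
     add = (+)\<rparr>"

definition path_elem :: "'v \<times> 'a list \<Rightarrow> ('v \<times> 'a list \<Rightarrow> 'k::field)" where
  "path_elem w = (\<lambda>w'. if w' = w then 1 else 0)"

definition arrow_ideal :: "('v, 'a) pre_digraph \<Rightarrow> ('v \<times> 'a list \<Rightarrow> 'k::field) set" where
  "arrow_ideal Q = Idl\<^bsub>path_algebra Q\<^esub> {path_elem (tail Q a, [a]) | a. a \<in> arcs Q}"

definition arrow_ideal_power ::
    "('v, 'a) pre_digraph \<Rightarrow> nat \<Rightarrow> ('v \<times> 'a list \<Rightarrow> 'k::field) set" where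
  "arrow_ideal_power Q m =
     ((\<lambda>J. ideal_prod (path_algebra Q) J (arrow_ideal Q)) ^^ m) (carrier (path_algebra Q))"

text \<open>For a finite quiver, admissibility of \<open>I\<close> makes \<open>KQ/I\<close> finite-dimensional.\<close>

definition admissible ::
    "('v, 'a) pre_digraph \<Rightarrow> ('v \<times> 'a list \<Rightarrow> 'k::field) set \<Rightarrow> bool" where
  "admissible Q I \<longleftrightarrow> ideal I (path_algebra Q) \<and> I \<subseteq> arrow_ideal_power Q 2 \<and>
     (\<exists>m\<ge>2. arrow_ideal_power Q m \<subseteq> I)"

definition quiver_relation ::
    "('v, 'a) pre_digraph \<Rightarrow> ('v \<times> 'a list \<Rightarrow> 'k::field) \<Rightarrow> bool" where
  "quiver_relation Q r \<longleftrightarrow> r \<in> carrier (path_algebra Q) \<and>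
     (\<exists>u v. \<forall>u' p. r (u', p) \<noteq> 0 \<longrightarrow> u' = u \<and> pre_digraph.awalk Q u p v \<and> 2 \<le> length p)"

section \<open>Representation varieties\<close>

type_synonym ('a, 'k) qrep = "'a \<Rightarrow> 'k mat"

definition rep_space :: "('v, 'a) pre_digraph \<Rightarrow> ('v \<Rightarrow> nat) \<Rightarrow> ('a, 'k::field) qrep set" where
  "rep_space Q d = (\<Pi>\<^sub>E a\<in>arcs Q. carrier_mat (d (head Q a)) (d (tail Q a)))"

fun path_mat ::
    "('v, 'a) pre_digraph \<Rightarrow> ('v \<Rightarrow> nat) \<Rightarrow> ('a, 'k::field) qrep \<Rightarrow> 'v \<Rightarrow> 'a list \<Rightarrow> 'k mat" where
  "path_mat Q d M u [] = 1\<^sub>m (d u)"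
| "path_mat Q d M u (a # p) = path_mat Q d M (head Q a) p * M a"

text \<open>The component \<open>M(u) \<rightarrow> M(v)\<close> of \<open>M(r)\<close>; for a relation at most one component is nonzero.\<close>

definition eval_rel ::
    "('v, 'a) pre_digraph \<Rightarrow> ('v \<Rightarrow> nat) \<Rightarrow> ('a, 'k::field) qrep \<Rightarrow> ('v \<times> 'a list \<Rightarrow> 'k) \<Rightarrow>
     'v \<Rightarrow> 'v \<Rightarrow> 'k mat" where
  "eval_rel Q d M r u v = mat (d v) (d u) (\<lambda>ij.
     \<Sum>p | r (u, p) \<noteq> 0 \<and> pre_digraph.awalk Q u p v. r (u, p) * path_mat Q d M u p $$ ij)"

definition rep_variety ::
    "('v, 'a) pre_digraph \<Rightarrow> ('v \<times> 'a list \<Rightarrow> 'k) set \<Rightarrow> ('v \<Rightarrow> nat) \<Rightarrow> ('a, 'k::field) qrep set" where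
  "rep_variety Q R d = {M \<in> rep_space Q d.
     \<forall>r\<in>R. \<forall>u\<in>verts Q. \<forall>v\<in>verts Q. eval_rel Q d M r u v = 0\<^sub>m (d v) (d u)}"

section \<open>Zariski topology and coordinate rings\<close>

inductive_set poly_funs ::
    "('v, 'a) pre_digraph \<Rightarrow> ('v \<Rightarrow> nat) \<Rightarrow> (('a, 'k::field) qrep \<Rightarrow> 'k) set"
  for Q d where
  const: "(\<lambda>M. c) \<in> poly_funs Q d"
| coord: "\<lbrakk>a \<in> arcs Q; i < d (head Q a); j < d (tail Q a)\<rbrakk> \<Longrightarrow> (\<lambda>M. M a $$ (i, j)) \<in> poly_funs Q d"
| add: "\<lbrakk>f \<in> poly_funs Q d; g \<in> poly_funs Q d\<rbrakk> \<Longrightarrow> f + g \<in> poly_funs Q d"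
| mult: "\<lbrakk>f \<in> poly_funs Q d; g \<in> poly_funs Q d\<rbrakk> \<Longrightarrow> f * g \<in> poly_funs Q d"

definition zariski_closed ::
    "('v, 'a) pre_digraph \<Rightarrow> ('v \<Rightarrow> nat) \<Rightarrow> ('a, 'k::field) qrep set \<Rightarrow> bool" where
  "zariski_closed Q d C \<longleftrightarrow>
     (\<exists>F\<subseteq>poly_funs Q d. C = {M \<in> rep_space Q d. \<forall>f\<in>F. f M = 0})"

definition zariski_open ::
    "('v, 'a) pre_digraph \<Rightarrow> ('v \<Rightarrow> nat) \<Rightarrow> ('a, 'k::field) qrep set \<Rightarrow> bool" where
  "zariski_open Q d U \<longleftrightarrow> U \<subseteq> rep_space Q d \<and> zariski_closed Q d (rep_space Q d - U)"

definition irreducible_closed ::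
    "('v, 'a) pre_digraph \<Rightarrow> ('v \<Rightarrow> nat) \<Rightarrow> ('a, 'k::field) qrep set \<Rightarrow> bool" where
  "irreducible_closed Q d C \<longleftrightarrow> zariski_closed Q d C \<and> C \<noteq> {} \<and>
     (\<forall>Z1 Z2. zariski_closed Q d Z1 \<and> zariski_closed Q d Z2 \<and> C = Z1 \<union> Z2 \<longrightarrow> C = Z1 \<or> C = Z2)"

text \<open>
  A function on \<open>C\<close> is represented by its extension by zero, so that functions on \<open>C\<close> form a
  subspace of the space of all functions and are equal iff they agree on \<open>C\<close>.
\<close>

definition restr :: "'x set \<Rightarrow> ('x \<Rightarrow> 'k::zero) \<Rightarrow> 'x \<Rightarrow> 'k" where
  "restr C f = (\<lambda>x. if x \<in> C then f x else 0)"

definition coord_ring ::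
    "('v, 'a) pre_digraph \<Rightarrow> ('v \<Rightarrow> nat) \<Rightarrow> ('a, 'k::field) qrep set \<Rightarrow> (('a, 'k) qrep \<Rightarrow> 'k) set" where
  "coord_ring Q d C = restr C ` poly_funs Q d"

interpretation fun_space: vector_space "\<lambda>(c::'k::field) (f::'x \<Rightarrow> 'k) x. c * f x"
  by unfold_locales (auto simp: fun_eq_iff algebra_simps)

section \<open>Semi-invariants\<close>

definition GL :: "('v, 'a) pre_digraph \<Rightarrow> ('v \<Rightarrow> nat) \<Rightarrow> ('v \<Rightarrow> 'k::field mat) monoid" where
  "GL Q d = product_group (verts Q) (\<lambda>x. units_of (ring_mat TYPE('k) (d x) ()))"

definition rep_act ::
    "('v, 'a) pre_digraph \<Rightarrow> ('v \<Rightarrow> nat) \<Rightarrow> ('v \<Rightarrow> 'k::field mat) \<Rightarrow> ('a, 'k) qrep \<Rightarrow> ('a, 'k) qrep" where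
  "rep_act Q d g M = (\<lambda>a\<in>arcs Q. g (head Q a) * M a * (inv\<^bsub>GL Q d\<^esub> g) (tail Q a))"

definition GL_invariant ::
    "('v, 'a) pre_digraph \<Rightarrow> ('v \<Rightarrow> nat) \<Rightarrow> ('a, 'k::field) qrep set \<Rightarrow> bool" where
  "GL_invariant Q d C \<longleftrightarrow> (\<forall>g\<in>carrier (GL Q d). \<forall>M\<in>C. rep_act Q d g M \<in> C)"

definition weight_eval :: "('v, 'a) pre_digraph \<Rightarrow> ('v \<Rightarrow> int) \<Rightarrow> ('v \<Rightarrow> nat) \<Rightarrow> int" where
  "weight_eval Q \<theta> d = (\<Sum>x\<in>verts Q. \<theta> x * int (d x))"

definition weight_char :: "('v, 'a) pre_digraph \<Rightarrow> ('v \<Rightarrow> int) \<Rightarrow> ('v \<Rightarrow> 'k::field mat) \<Rightarrow> 'k" where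
  "weight_char Q \<theta> g = (\<Prod>x\<in>verts Q. det (g x) powi \<theta> x)"

definition SI ::
    "('v, 'a) pre_digraph \<Rightarrow> ('v \<Rightarrow> nat) \<Rightarrow> ('v \<Rightarrow> int) \<Rightarrow> ('a, 'k::field) qrep set \<Rightarrow>
     (('a, 'k) qrep \<Rightarrow> 'k) set" where
  "SI Q d \<theta> C = {f \<in> coord_ring Q d C. \<forall>g\<in>carrier (GL Q d). \<forall>M\<in>C.
     f (rep_act Q d (inv\<^bsub>GL Q d\<^esub> g) M) = weight_char Q \<theta> g * f M}"

section \<open>The double quiver and determinantal semi-invariants\<close>

text \<open>\<open>Inl v\<close> is the arrow \<open>c\<^sub>v\<close>, and \<open>Inr a\<close> is the arrow \<open>a\<close> with a hat.\<close>

definition double_quiver :: "('v, 'a) pre_digraph \<Rightarrow> ('v \<times> nat, 'v + 'a) pre_digraph" where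
  "double_quiver Q = \<lparr>
     verts = verts Q \<times> {0, 1},
     arcs = verts Q <+> arcs Q,
     tail = case_sum (\<lambda>v. (v, 0)) (\<lambda>a. (tail Q a, 0)),
     head = case_sum (\<lambda>v. (v, 1)) (\<lambda>a. (head Q a, 1))\<rparr>"

definition double_dim :: "('v \<Rightarrow> nat) \<Rightarrow> 'v \<times> nat \<Rightarrow> nat" where
  "double_dim d = (\<lambda>(v, _). d v)"

definition double_rep ::
    "('v, 'a) pre_digraph \<Rightarrow> ('v \<Rightarrow> nat) \<Rightarrow> ('a, 'k::field) qrep \<Rightarrow> ('v + 'a, 'k) qrep" where
  "double_rep Q d M = (\<lambda>b\<in>arcs (double_quiver Q). case b of Inl v \<Rightarrow> 1\<^sub>m (d v) | Inr a \<Rightarrow> M a)"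

definition euler_form :: "('v, 'a) pre_digraph \<Rightarrow> ('v \<Rightarrow> nat) \<Rightarrow> ('v \<Rightarrow> nat) \<Rightarrow> int" where
  "euler_form Q e f =
     (\<Sum>i\<in>verts Q. int (e i) * int (f i)) - (\<Sum>b\<in>arcs Q. int (e (tail Q b)) * int (f (head Q b)))"

text \<open>The linear map \<open>d\<^sup>V\<^sub>W\<close>, on families of matrices indexed by the vertices.\<close>

definition schofield_map ::
    "('v, 'a) pre_digraph \<Rightarrow> ('a, 'k::field) qrep \<Rightarrow> ('a, 'k) qrep \<Rightarrow> ('v \<Rightarrow> 'k mat) \<Rightarrow> 'a \<Rightarrow> 'k mat" where
  "schofield_map Q V W \<phi> = (\<lambda>b\<in>arcs Q. \<phi> (head Q b) * V b - W b * \<phi> (tail Q b))"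

text \<open>
  The standard bases of the source and the target of \<open>d\<^sup>V\<^sub>W\<close> consist of the matrix units, indexed
  by (vertex or arrow, row, column). They are enumerated by \<^const>\<open>from_nat_into\<close>, a fixed
  bijection from \<open>{..<card S}\<close> onto the finite index set \<open>S\<close>. The enumerations do not depend on
  \<open>V\<close> and \<open>W\<close>; another choice changes all determinants by one common sign.
\<close>

definition source_index ::
    "('v, 'a) pre_digraph \<Rightarrow> ('v \<Rightarrow> nat) \<Rightarrow> ('v \<Rightarrow> nat) \<Rightarrow> ('v \<times> nat \<times> nat) set" where
  "source_index Q c d = (SIGMA i : verts Q. {..<d i} \<times> {..<c i})"

definition target_index ::
    "('v, 'a) pre_digraph \<Rightarrow> ('v \<Rightarrow> nat) \<Rightarrow> ('v \<Rightarrow> nat) \<Rightarrow> ('a \<times> nat \<times> nat) set" where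
  "target_index Q c d = (SIGMA b : arcs Q. {..<d (head Q b)} \<times> {..<c (tail Q b)})"

definition source_basis ::
    "('v \<Rightarrow> nat) \<Rightarrow> ('v \<Rightarrow> nat) \<Rightarrow> 'v \<times> nat \<times> nat \<Rightarrow> 'v \<Rightarrow> 'k::field mat" where
  "source_basis c d = (\<lambda>(i, p, q) j.
     mat (d j) (c j) (\<lambda>rs. if j = i \<and> rs = (p, q) then 1 else 0))"

definition schofield_mat ::
    "('v, 'a) pre_digraph \<Rightarrow> ('v \<Rightarrow> nat) \<Rightarrow> ('v \<Rightarrow> nat) \<Rightarrow> ('a, 'k::field) qrep \<Rightarrow> ('a, 'k) qrep \<Rightarrow> 'k mat" where
  "schofield_mat Q c d V W =
     mat (card (target_index Q c d)) (card (source_index Q c d)) (\<lambda>(k, l).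
       let (b, p, q) = from_nat_into (target_index Q c d) k;
           \<phi> = source_basis c d (from_nat_into (source_index Q c d) l)
       in schofield_map Q V W \<phi> b $$ (p, q))"

definition schofield ::
    "('v, 'a) pre_digraph \<Rightarrow> ('v \<Rightarrow> nat) \<Rightarrow> ('v \<Rightarrow> nat) \<Rightarrow> ('a, 'k::field) qrep \<Rightarrow> ('a, 'k) qrep \<Rightarrow> 'k" where
  "schofield Q c d V W = det (schofield_mat Q c d V W)"

definition res_schofield ::
    "('v, 'a) pre_digraph \<Rightarrow> ('v \<times> nat \<Rightarrow> nat) \<Rightarrow> ('v \<Rightarrow> nat) \<Rightarrow> ('a, 'k::field) qrep set \<Rightarrow>
     ('v + 'a, 'k) qrep \<Rightarrow> ('a, 'k) qrep \<Rightarrow> 'k" where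
  "res_schofield Q c d C V =
     restr C (schofield (double_quiver Q) c (double_dim d) V \<circ> double_rep Q d)"

section \<open>The ring and group axioms\<close>

lemma path_target_simps [simp]: "path_target Q u [] = u"
  "path_target Q u (p @ q) = path_target Q (path_target Q u p) q"
proof -
  have [simp]: "pre_digraph.awalk_verts Q u p \<noteq> []" for u p
    by (cases p) (auto simp: pre_digraph.awalk_verts.simps)
  have *: "path_target Q u p = (if p = [] then u else head Q (last p))" for u p
    by (induction p arbitrary: u) (auto simp: pre_digraph.awalk_verts.simps)
  show "path_target Q u [] = u" by (simp add: *)
  show "path_target Q u (p @ q) = path_target Q (path_target Q u p) q" by (simp add: *)
qed

lemma awalk_append:
  "pre_digraph.awalk Q u p v \<Longrightarrow> pre_digraph.awalk Q v q w \<Longrightarrow> pre_digraph.awalk Q u (p @ q) w"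
proof -
  have "pre_digraph.cas Q u p v \<Longrightarrow> pre_digraph.cas Q v q w \<Longrightarrow> pre_digraph.cas Q u (p @ q) w"
    by (induction p arbitrary: u) (auto simp: pre_digraph.cas.simps)
  then show "pre_digraph.awalk Q u p v \<Longrightarrow> pre_digraph.awalk Q v q w \<Longrightarrow> pre_digraph.awalk Q u (p @ q) w"
    by (auto simp: pre_digraph.awalk_def)
qed

lemma awalk_path_target: "pre_digraph.awalk Q u p v \<Longrightarrow> path_target Q u p = v"
proof -
  have [simp]: "pre_digraph.awalk_verts Q u p \<noteq> []" for u p
    by (cases p) (auto simp: pre_digraph.awalk_verts.simps)
  have "pre_digraph.cas Q u p v \<Longrightarrow> path_target Q u p = v"
    by (induction p arbitrary: u) (auto simp: pre_digraph.cas.simps pre_digraph.awalk_verts.simps)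
  then show "pre_digraph.awalk Q u p v \<Longrightarrow> path_target Q u p = v"
    by (auto simp: pre_digraph.awalk_def)
qed

lemma path_target_verts:
  assumes "wf_digraph Q" "(u, p) \<in> quiver_paths Q" shows "path_target Q u p \<in> verts Q"
proof -
  interpret wf_digraph Q by fact
  show ?thesis using assms(2) awalk_path_target unfolding quiver_paths_def by fastforce
qed

lemma ring_path_algebra:
  assumes "fin_digraph Q"
  shows "ring (path_algebra Q :: ('v \<times> 'a list \<Rightarrow> 'k::field) ring)"
proof -
  interpret fin_digraph Q by fact
  let ?A = "path_algebra Q :: ('v \<times> 'a list \<Rightarrow> 'k::field) ring"
  let ?C = "carrier ?A"
  have carr: "x \<in> ?C \<longleftrightarrow> finite {w. x w \<noteq> 0} \<and> {w. x w \<noteq> 0} \<subseteq> quiver_paths Q" for x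
    by (simp add: path_algebra_def)
  have mul: "(x \<otimes>\<^bsub>?A\<^esub> y) (u, p) =
      (\<Sum>k\<le>length p. x (u, take k p) * y (path_target Q u (take k p), drop k p))" for x y u p
    by (simp add: path_algebra_def)
  have one: "\<one>\<^bsub>?A\<^esub> = (\<lambda>(u, p). if u \<in> verts Q \<and> p = [] then 1 else 0)"
    and zero: "\<zero>\<^bsub>?A\<^esub> = 0" and add: "x \<oplus>\<^bsub>?A\<^esub> y = x + y" for x y
    by (simp_all add: path_algebra_def)
  have addc: "x + y \<in> ?C" if "x \<in> ?C" "y \<in> ?C" for x y
  proof -
    have "{w. (x + y) w \<noteq> 0} \<subseteq> {w. x w \<noteq> 0} \<union> {w. y w \<noteq> 0}" by auto
    then show ?thesis using that unfolding carr by (meson finite_UnI finite_subset le_sup_iff order_trans)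
  qed
  have mulc: "x \<otimes>\<^bsub>?A\<^esub> y \<in> ?C" if x: "x \<in> ?C" and y: "y \<in> ?C" for x y
  proof -
    have sub: "{w. (x \<otimes>\<^bsub>?A\<^esub> y) w \<noteq> 0} \<subseteq>
        (\<lambda>((u, p), (v, q)). (u, p @ q)) ` {((u,p),(v,q)). x (u,p) \<noteq> 0 \<and> y (v,q) \<noteq> 0 \<and> v = path_target Q u p}"
    proof
      fix w assume "w \<in> {w. (x \<otimes>\<^bsub>?A\<^esub> y) w \<noteq> 0}"
      then obtain u p where w: "w = (u, p)" and "(x \<otimes>\<^bsub>?A\<^esub> y) (u,p) \<noteq> 0" by (cases w) auto
      then obtain k where "x (u, take k p) * y (path_target Q u (take k p), drop k p) \<noteq> 0"
        unfolding mul by (meson sum.not_neutral_contains_not_neutral)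
      then show "w \<in> (\<lambda>((u, p), (v, q)). (u, p @ q)) ` {((u,p),(v,q)). x (u,p) \<noteq> 0 \<and> y (v,q) \<noteq> 0 \<and> v = path_target Q u p}"
        unfolding w by (intro image_eqI[where x = "((u, take k p), (path_target Q u (take k p), drop k p))"]) auto
    qed
    have "finite ((\<lambda>((u, p), (v, q)). (u, p @ q)) ` ({w. x w \<noteq> 0} \<times> {w. y w \<noteq> 0}))"
      using x y unfolding carr by blast
    moreover have "(\<lambda>((u, p), (v, q)). (u, p @ q)) ` {((u,p),(v,q)). x (u,p) \<noteq> 0 \<and> y (v,q) \<noteq> 0 \<and> v = path_target Q u p}
       \<subseteq> (\<lambda>((u, p), (v, q)). (u, p @ q)) ` ({w. x w \<noteq> 0} \<times> {w. y w \<noteq> 0})"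
      by (rule image_mono) auto
    ultimately have "finite {w. (x \<otimes>\<^bsub>?A\<^esub> y) w \<noteq> 0}" using sub by (meson finite_subset)
    moreover have "(\<lambda>((u, p), (v, q)). (u, p @ q)) ` {((u,p),(v,q)). x (u,p) \<noteq> 0 \<and> y (v,q) \<noteq> 0 \<and> v = path_target Q u p}
       \<subseteq> quiver_paths Q"
    proof clarsimp
      fix u p q assume "x (u,p) \<noteq> 0" "y (path_target Q u p, q) \<noteq> 0"
      then have "(u,p) \<in> quiver_paths Q" "(path_target Q u p, q) \<in> quiver_paths Q"
        using x y unfolding carr by auto
      then show "(u, p @ q) \<in> quiver_paths Q"
      proof -
        obtain v w where "pre_digraph.awalk Q u p v" "pre_digraph.awalk Q (path_target Q u p) q w"
          using \<open>(u,p) \<in> quiver_paths Q\<close> \<open>(path_target Q u p, q) \<in> quiver_paths Q\<close>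
          by (auto simp: quiver_paths_def)
        then show ?thesis unfolding quiver_paths_def
          by (auto dest: awalk_append simp: awalk_path_target)
      qed
    qed
    ultimately show ?thesis unfolding carr using sub by blast
  qed
  have onec: "\<one>\<^bsub>?A\<^esub> \<in> ?C"
  proof -
    have "{w. \<one>\<^bsub>?A\<^esub> w \<noteq> 0} = (\<lambda>u. (u, [])) ` verts Q"
      unfolding one by (auto split: if_splits)
    then show ?thesis unfolding carr
      by (auto simp: quiver_paths_def pre_digraph.awalk_def pre_digraph.cas.simps)
  qed
  have assoc: "(x \<otimes>\<^bsub>?A\<^esub> y) \<otimes>\<^bsub>?A\<^esub> z = x \<otimes>\<^bsub>?A\<^esub> (y \<otimes>\<^bsub>?A\<^esub> z)" for x y z
  proof (rule ext, clarify)
    fix u :: 'v and p :: "'a list"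
    let ?n = "length p"
    have "((x \<otimes>\<^bsub>?A\<^esub> y) \<otimes>\<^bsub>?A\<^esub> z) (u, p) = (\<Sum>k\<le>?n. \<Sum>j\<le>k. x (u, take j p) *
        y (path_target Q u (take j p), take (k - j) (drop j p)) * z (path_target Q u (take k p), drop k p))"
      unfolding mul by (intro sum.cong refl) (auto simp: sum_distrib_right min_def drop_take intro!: sum.cong)
    also have "\<dots> = (\<Sum>(k,j)\<in>(SIGMA k:{..?n}. {..k}). x (u, take j p) *
        y (path_target Q u (take j p), take (k - j) (drop j p)) * z (path_target Q u (take k p), drop k p))"
      by (rule sum.Sigma) auto
    also have "\<dots> = (\<Sum>(j,i)\<in>(SIGMA j:{..?n}. {..?n - j}). x (u, take j p) *
        y (path_target Q u (take j p), take i (drop j p)) * z (path_target Q u (take (j + i) p), drop (j + i) p))"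
      by (rule sum.reindex_bij_witness[where i = "\<lambda>(j,i). (j + i, j)" and j = "\<lambda>(k,j). (j, k - j)"]) auto
    also have "\<dots> = (\<Sum>j\<le>?n. \<Sum>i\<le>?n - j. x (u, take j p) *
        y (path_target Q u (take j p), take i (drop j p)) * z (path_target Q u (take (j + i) p), drop (j + i) p))"
      by (rule sum.Sigma[symmetric]) auto
    also have "\<dots> = (x \<otimes>\<^bsub>?A\<^esub> (y \<otimes>\<^bsub>?A\<^esub> z)) (u, p)"
      unfolding mul by (intro sum.cong refl)
        (auto simp: sum_distrib_left mult.assoc take_add add.commute intro!: sum.cong)
    finally show "((x \<otimes>\<^bsub>?A\<^esub> y) \<otimes>\<^bsub>?A\<^esub> z) (u, p) = (x \<otimes>\<^bsub>?A\<^esub> (y \<otimes>\<^bsub>?A\<^esub> z)) (u, p)" .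
  qed
  have l_one: "\<one>\<^bsub>?A\<^esub> \<otimes>\<^bsub>?A\<^esub> x = x" if "x \<in> ?C" for x
  proof (rule ext, clarify)
    fix u :: 'v and p :: "'a list"
    have "u \<notin> verts Q \<Longrightarrow> x (u, p) = 0"
      using that unfolding carr by (auto simp: quiver_paths_def pre_digraph.awalk_def)
    moreover have "(\<one>\<^bsub>?A\<^esub> \<otimes>\<^bsub>?A\<^esub> x) (u, p) = (\<Sum>k\<le>length p. if k = 0 then (if u \<in> verts Q then x (u, p) else 0) else 0)"
      unfolding mul one by (intro sum.cong refl) auto
    ultimately show "(\<one>\<^bsub>?A\<^esub> \<otimes>\<^bsub>?A\<^esub> x) (u, p) = x (u, p)" by auto
  qed
  have r_one: "x \<otimes>\<^bsub>?A\<^esub> \<one>\<^bsub>?A\<^esub> = x" if "x \<in> ?C" for x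
  proof (rule ext, clarify)
    fix u :: 'v and p :: "'a list"
    have "path_target Q u p \<notin> verts Q \<Longrightarrow> x (u, p) = 0"
      using that path_target_verts[OF wf_digraph] unfolding carr by auto
    moreover have "(x \<otimes>\<^bsub>?A\<^esub> \<one>\<^bsub>?A\<^esub>) (u, p) = (\<Sum>k\<le>length p. if k = length p then (if path_target Q u p \<in> verts Q then x (u, p) else 0) else 0)"
      unfolding mul one by (intro sum.cong refl) auto
    ultimately show "(x \<otimes>\<^bsub>?A\<^esub> \<one>\<^bsub>?A\<^esub>) (u, p) = x (u, p)" by auto
  qed
  show ?thesis
  proof (rule ringI)
    show "abelian_group ?A"
    proof (rule abelian_groupI; unfold add zero)
      fix x assume x: "x \<in> ?C"
      then have "- x \<in> ?C" unfolding carr by simp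
      then show "\<exists>y\<in>?C. y + x = 0" by (intro bexI[of _ "- x"]) auto
    qed (auto simp: addc add.assoc add.commute, simp add: carr)
    show "monoid ?A" by (rule monoidI) (auto simp: mulc onec assoc l_one r_one)
  qed (auto simp: fun_eq_iff mul add sum.distrib algebra_simps)
qed

lemma group_GL: "Group.group (GL Q d)"
  unfolding GL_def
  by (intro product_group monoid.units_group ring.is_monoid ring_mat)

end

theory Submission
  imports Defs "Jordan_Normal_Form.Char_Poly"
begin

text \<open>
  Write \<open>M(a) = W(head a)\<^sup>-\<^sup>1 W(a)\<close>. If a semi-invariant \<open>F\<close> of degree \<open>k\<close> is multiplied by powers
  \<open>det W(v) ^ m v\<close> with \<open>m v \<ge> k\<close>, it becomes a polynomial in \<open>W\<close> that is semi-invariant under left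
  multiplication at the vertices. Cayley's Omega process averages it, and by Ryser's formula the average
  of a monomial is a linear combination of block determinants in the \<open>W(b)\<close>; these are
  determinantal semi-invariants of the double quiver restricted to \<open>\<tau>\<close>. So every dimension vector
  with large enough blocks spans all semi-invariants of degree at most \<open>k\<close>.

  For admissible ideals a single \<open>k\<close> suffices: representations of the variety are nilpotent, and
  along the line through the origin a semi-invariant of weight \<open>\<theta>\<close> is then a polynomial of
  degree bounded in terms of \<open>\<theta>\<close>, \<open>d\<close> and the nilpotency index. For part (b), a semi-invariant of
  \<open>C\<close> of any degree is reached by a larger double dimension vector, whose semi-invariants extend to the
  whole variety and hence lie in the given span. Restricting to generic \<open>V\<close> keeps the span, because
  a polynomial curve is recovered by interpolation from all but finitely many of its points.
\<close>

section \<open>Determinants over finite index sets\<close>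

text \<open>One dimension vector has to serve all d_i. It is built from block counts m and N = m +
  \<theta>, with N v at (v,0) and the number of incoming copies minus m v at (v,1). Neither depends
  on d_i; rows and columns balance because \<theta>(d_i) = 0. The obstacle is nonnegativity at
  (v,1): the arrow c_v alone supplies m v + \<theta> v copies, so a negative \<theta> v needs
  another arrow into v. At a supported vertex without one, a nonzero semi-invariant forces \<theta>
  v \<ge> 0. Omega would differentiate functions known by their values. For forms of degree T,
  polarization replaces T derivatives by an alternating sum of values at sums of matrix units, hence
  Ryser's formula. Characteristic zero enters through the nonvanishing of the resulting constant and
  through parameters chosen outside finite sets. The degree bound needs a semi-invariant on the
  whole representation space, because neither the line through the origin nor the degenerating curve
  need respect the relations. Spanning by determinants, applied to one function of known degree,
  provides this extension.\<close>

definition sdet :: "'i set \<Rightarrow> ('i \<Rightarrow> 'i \<Rightarrow> 'k::comm_ring_1) \<Rightarrow> 'k" where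
  "sdet S A = (\<Sum>p | p permutes S. of_int (sign p) * (\<Prod>i\<in>S. A i (p i)))"

lemma sdet_cong:
  assumes "\<And>i j. i \<in> S \<Longrightarrow> j \<in> S \<Longrightarrow> A i j = B i j"
  shows "sdet S A = sdet S B"
  unfolding sdet_def
  by (intro sum.cong refl arg_cong2[where f = "(*)"] prod.cong) (auto simp: assms permutes_in_image)

lemma det_sdet: "det (mat n n (\<lambda>(i, j). A i j)) = sdet {..<n} A"
  unfolding sdet_def
  by (subst det_def'[of _ n])
    (auto intro!: sum.cong prod.cong simp: atLeast0LessThan permutes_in_image)

lemma sdet_reindex:
  assumes "inj_on f S" "finite S"
  shows "sdet (f ` S) A = sdet S (\<lambda>i j. A (f i) (f j))"
proof -
  let ?h = "map_permutation S f"
  have bij: "bij_betw f S (f ` S)" using assms(1) by (simp add: inj_on_imp_bij_betw)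
  have eq: "?h = (\<lambda>p x. if x \<in> f ` S then f (p (inv_into S f x)) else x)"
    by (auto simp: map_permutation_def restrict_id_def fun_eq_iff)
  have "bij_betw ?h {p. p permutes S} {p. p permutes f ` S}"
    unfolding eq by (rule bij_betw_permutations[OF bij])
  then have "sdet (f ` S) A =
      (\<Sum>p | p permutes S. of_int (sign (?h p)) * (\<Prod>i\<in>f ` S. A i (?h p i)))"
    unfolding sdet_def by (intro sum.reindex_bij_betw[symmetric])
  also have "\<dots> = sdet S (\<lambda>i j. A (f i) (f j))"
    unfolding sdet_def using assms
    by (intro sum.cong refl)
      (auto simp: sign_map_permutation prod.reindex map_permutation_apply intro!: prod.cong)
  finally show ?thesis .
qed

lemma sdet_permute_cols:
  assumes "q permutes S" "finite S"
  shows "sdet S (\<lambda>i j. A i (q j)) = of_int (sign q) * sdet S A"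
proof -
  have "sdet S A = (\<Sum>p | p permutes S. of_int (sign (q \<circ> p)) * (\<Prod>i\<in>S. A i (q (p i))))"
    unfolding sdet_def by (subst setum_permutations_compose_left[OF assms(1)]) simp
  also have "\<dots> = (\<Sum>p | p permutes S. of_int (sign q) * (of_int (sign p) * (\<Prod>i\<in>S. A i (q (p i)))))"
    using assms by (intro sum.cong refl) (auto simp: sign_compose permutes_imp_permutation)
  also have "\<dots> = of_int (sign q) * sdet S (\<lambda>i j. A i (q j))"
    unfolding sdet_def by (simp add: sum_distrib_left)
  finally show ?thesis
    by (simp add: mult.assoc[symmetric] flip: of_int_mult)
qed

text \<open>A permutation that sends some element of S into T picks up a zero entry. The surviving
  ones map S to itself, hence T to itself, and factor uniquely as p \<circ> q with p on S and q on
  T. This is block triangularity.\<close>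

lemma sdet_Un:
  assumes fin: "finite S" "finite T" and disj: "S \<inter> T = {}"
    and zero: "\<And>i j. i \<in> S \<Longrightarrow> j \<in> T \<Longrightarrow> A i j = 0"
  shows "sdet (S \<union> T) A = sdet S A * sdet T A"
proof -
  let ?f = "\<lambda>(p, q). p \<circ> q :: 'a \<Rightarrow> 'a"
  let ?PP = "{p. p permutes S} \<times> {q. q permutes T}"
  let ?t = "\<lambda>p. of_int (sign p) * (\<Prod>i\<in>S \<union> T. A i (p i))"
  have S: "p (q x) = p x" if "p permutes S" "q permutes T" "x \<in> S" for p q x
    using that disj by (metis disjoint_iff permutes_not_in)
  have T: "p (q x) = q x" if "p permutes S" "q permutes T" "x \<in> T" for p q x
    using that disj by (metis disjoint_iff permutes_in_image permutes_not_in)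
  have inj: "inj_on ?f ?PP"
  proof (rule inj_onI, clarify)
    fix p q p' q' assume *: "p permutes S" "q permutes T" "p' permutes S" "q' permutes T"
      and eq: "p \<circ> q = p' \<circ> q'"
    have "p x = p' x" for x
      using S[OF *(1,2), of x] S[OF *(3,4), of x] fun_cong[OF eq, of x] * by (cases "x \<in> S") (auto simp: permutes_not_in)
    moreover have "q x = q' x" for x
      using T[OF *(1,2), of x] T[OF *(3,4), of x] fun_cong[OF eq, of x] * by (cases "x \<in> T") (auto simp: permutes_not_in)
    ultimately show "p = p' \<and> q = q'" by auto
  qed
  have img: "?f ` ?PP = {p. p permutes S \<union> T \<and> p ` S \<subseteq> S}"
  proof (intro equalityI subsetI)
    fix x assume "x \<in> ?f ` ?PP"
    then obtain p q where pq: "p permutes S" "q permutes T" "x = p \<circ> q" by auto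
    then have "x permutes S \<union> T"
      by (auto intro!: permutes_compose intro: permutes_subset)
    then show "x \<in> {p. p permutes S \<union> T \<and> p ` S \<subseteq> S}"
      using S[OF pq(1,2)] pq by (auto simp: permutes_in_image)
  next
    fix r assume "r \<in> {p. p permutes S \<union> T \<and> p ` S \<subseteq> S}"
    then have r: "r permutes S \<union> T" "r ` S \<subseteq> S" by auto
    have injr: "inj r" using r(1) by (rule permutes_inj)
    have rS: "r ` S = S" using r(2) fin(1) injr by (meson endo_inj_surj inj_on_subset subset_UNIV)
    have rT: "r ` T = T"
    proof -
      have "r ` ((S \<union> T) - S) = (S \<union> T) - S"
        using permutes_image[OF r(1)] rS injr by (simp add: image_set_diff)
      moreover have "(S \<union> T) - S = T" using disj by blast
      ultimately show ?thesis by simp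
    qed
    define p where "p x = (if x \<in> S then r x else x)" for x
    define q where "q x = (if x \<in> T then r x else x)" for x
    have p: "p permutes S"
      by (rule bij_imp_permutes) (auto simp: p_def bij_betw_def rS inj_on_def injr[THEN inj_eq] cong: image_cong)
    have q: "q permutes T"
      by (rule bij_imp_permutes) (auto simp: q_def bij_betw_def rT inj_on_def injr[THEN inj_eq] cong: image_cong)
    have "r = p \<circ> q"
    proof
      fix x
      consider "x \<in> S" | "x \<in> T" | "x \<notin> S \<union> T" by blast
      then show "r x = (p \<circ> q) x"
      proof cases
        case 1 then show ?thesis using disj by (auto simp: p_def q_def)
      next
        case 2 then have "r x \<in> T" using rT by auto
        then show ?thesis using 2 disj by (auto simp: p_def q_def)
      next
        case 3 then show ?thesis using r(1) by (auto simp: p_def q_def permutes_not_in)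
      qed
    qed
    then show "r \<in> ?f ` ?PP" using p q by force
  qed
  have fin': "finite {p. p permutes S \<union> T}" using fin by (simp add: finite_permutations)
  have "sdet (S \<union> T) A = (\<Sum>p\<in>{p. p permutes S \<union> T \<and> p ` S \<subseteq> S}. ?t p)"
    unfolding sdet_def
  proof (rule sum.mono_neutral_right[OF fin'])
    show "\<forall>p\<in>{p. p permutes S \<union> T} - {p. p permutes S \<union> T \<and> p ` S \<subseteq> S}. ?t p = 0"
    proof
      fix p assume "p \<in> {p. p permutes S \<union> T} - {p. p permutes S \<union> T \<and> p ` S \<subseteq> S}"
      then obtain i where "i \<in> S" "p i \<notin> S" "p permutes S \<union> T" by auto
      then have "A i (p i) = 0" by (metis Un_iff permutes_in_image zero)
      then have "(\<Prod>i\<in>S \<union> T. A i (p i)) = 0"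
        using \<open>i \<in> S\<close> fin by (intro prod_zero) auto
      then show "?t p = 0" by simp
    qed
  qed auto
  also have "\<dots> = (\<Sum>(p, q)\<in>?PP. ?t (p \<circ> q))"
    unfolding img[symmetric] by (subst sum.reindex[OF inj]) (simp add: case_prod_unfold)
  also have "\<dots> = (\<Sum>(p, q)\<in>?PP. (of_int (sign p) * (\<Prod>i\<in>S. A i (p i))) *
      (of_int (sign q) * (\<Prod>i\<in>T. A i (q i))))"
  proof (intro sum.cong refl, clarify)
    fix p q assume pq: "p permutes S" "q permutes T"
    have "(\<Prod>i\<in>S \<union> T. A i ((p \<circ> q) i)) = (\<Prod>i\<in>S. A i (p i)) * (\<Prod>i\<in>T. A i (q i))"
      using S[OF pq] T[OF pq] by (subst prod.union_disjoint[OF fin disj]) auto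
    moreover have "sign (p \<circ> q) = sign p * sign q"
      using pq fin by (intro sign_compose) (auto simp: permutes_imp_permutation)
    ultimately show "?t (p \<circ> q) = (of_int (sign p) * (\<Prod>i\<in>S. A i (p i))) *
      (of_int (sign q) * (\<Prod>i\<in>T. A i (q i)))" by (simp add: mult_ac)
  qed
  also have "\<dots> = sdet S A * sdet T A"
    unfolding sdet_def by (simp add: sum_product sum.cartesian_product)
  finally show ?thesis .
qed

lemma sdet_empty [simp]: "sdet {} A = 1"
  by (simp add: sdet_def)

lemma sdet_Sigma:
  assumes "finite K" "\<And>k. k \<in> K \<Longrightarrow> finite (I k)"
  shows "sdet (Sigma K I) (\<lambda>(k, i) (k', i'). if k = k' then A k i i' else 0) = (\<Prod>k\<in>K. sdet (I k) (A k))"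
  using assms
proof (induction K)
  case (insert k K)
  let ?A = "\<lambda>(k, i) (k', i'). if k = k' then A k i i' else 0"
  have "Sigma (insert k K) I = Pair k ` I k \<union> Sigma K I" by auto
  then have "sdet (Sigma (insert k K) I) ?A = sdet (Pair k ` I k) ?A * sdet (Sigma K I) ?A"
    using insert by (simp only:) (rule sdet_Un, auto)
  also have "sdet (Pair k ` I k) ?A = sdet (I k) (A k)"
    using insert by (subst sdet_reindex) (auto simp: inj_on_def)
  finally show ?case using insert by simp
qed simp

lemma sdet_one:
  assumes "finite S" shows "sdet S (\<lambda>i j. if i = j then 1 else 0) = (1::'k::comm_ring_1)"
proof -
  have "sdet S (\<lambda>i j. if i = j then 1 else (0::'k)) = (\<Sum>p | p permutes S. if p = id then 1 else 0)"
    unfolding sdet_def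
  proof (intro sum.cong refl)
    fix p assume "p \<in> {p. p permutes S}"
    then have p: "p permutes S" by simp
    show "of_int (sign p) * (\<Prod>i\<in>S. if i = p i then 1 else 0) = (if p = id then 1 else (0::'k))"
    proof (cases "p = id")
      case False
      then obtain i where "p i \<noteq> i" by (auto simp: fun_eq_iff)
      then have "i \<in> S" using p by (metis permutes_not_in)
      then have "(\<Prod>i\<in>S. if i = p i then 1 else (0::'k)) = 0"
        using \<open>p i \<noteq> i\<close> assms by (intro prod_zero) (auto intro!: bexI[of _ i])
      then show ?thesis using False by simp
    qed simp
  qed
  then show ?thesis using assms by (simp add: finite_permutations permutes_id)
qed

text \<open>Rows and columns may come from different sets, so the value depends on the enumerations
  by a sign. \<open>from_nat_into\<close> is used because \<open>schofield_mat\<close> enumerates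
  its bases that way.\<close>

definition detI :: "'i set \<Rightarrow> 'j set \<Rightarrow> ('i \<Rightarrow> 'j \<Rightarrow> 'k::comm_ring_1) \<Rightarrow> 'k" where
  "detI R C A = det (mat (card R) (card C) (\<lambda>(k, l). A (from_nat_into R k) (from_nat_into C l)))"

lemma from_nat_into_mem: "k < card S \<Longrightarrow> from_nat_into S k \<in> S"
  by (metis card.empty from_nat_into less_zeroE)

lemma detI_cong:
  assumes "\<And>i j. i \<in> R \<Longrightarrow> j \<in> C \<Longrightarrow> A i j = B i j"
  shows "detI R C A = detI R C B"
  unfolding detI_def by (intro arg_cong[where f = det] eq_matI) (auto simp: assms from_nat_into_mem)

lemma detI_same: "finite S \<Longrightarrow> detI S S A = sdet S A"
proof -
  assume fin: "finite S"
  have b: "bij_betw (from_nat_into S) {..<card S} S" by (rule bij_betw_from_nat_into_finite[OF fin])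
  have "sdet (from_nat_into S ` {..<card S}) A = detI S S A"
    unfolding detI_def det_sdet using b by (subst sdet_reindex) (auto simp: bij_betw_def)
  then show ?thesis using b by (simp add: bij_betw_def)
qed

lemma detI_mult:
  assumes fin: "finite S" and card: "card R = card S" "card C = card S"
  shows "detI R C (\<lambda>r c. \<Sum>s\<in>S. A r s * B s c) = detI R S A * detI S C B"
proof -
  let ?n = "card S"
  let ?A = "mat ?n ?n (\<lambda>(k, l). A (from_nat_into R k) (from_nat_into S l))"
  let ?B = "mat ?n ?n (\<lambda>(k, l). B (from_nat_into S k) (from_nat_into C l))"
  have b: "bij_betw (from_nat_into S) {..<?n} S" by (rule bij_betw_from_nat_into_finite[OF fin])
  have "mat ?n ?n (\<lambda>(k, l). \<Sum>s\<in>S. A (from_nat_into R k) s * B s (from_nat_into C l)) = ?A * ?B"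
    by (rule eq_matI)
      (auto simp: scalar_prod_def atLeast0LessThan sum.reindex_bij_betw[OF b, symmetric])
  then show ?thesis unfolding detI_def card by (simp add: det_mult[of _ ?n])
qed

text \<open>The sign compares the enumeration of C with the one carried over from R by f. It is
  fixed before A is given, so one sign serves a whole family of matrices.\<close>

lemma detI_bij:
  fixes R :: "'i set" and C :: "'j set"
  assumes f: "bij_betw f R C" and fin: "finite R"
  obtains \<epsilon> :: "'k::comm_ring_1" where "\<epsilon> * \<epsilon> = 1"
    "\<And>A. detI R C A = \<epsilon> * sdet R (\<lambda>r r'. A r (f r'))"
proof -
  let ?n = "card R"
  have finC: "finite C" using f fin by (simp add: bij_betw_finite)
  have n: "card C = ?n" using f by (simp add: bij_betw_same_card)
  have bR: "bij_betw (from_nat_into R) {..<?n} R" by (rule bij_betw_from_nat_into_finite[OF fin])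
  have bC: "bij_betw (from_nat_into C) {..<?n} C"
    using bij_betw_from_nat_into_finite[OF finC] n by simp
  define q where "q k = (if k < ?n then inv_into {..<?n} (from_nat_into C) (f (from_nat_into R k)) else k)" for k
  have "bij_betw (inv_into {..<?n} (from_nat_into C) \<circ> (f \<circ> from_nat_into R)) {..<?n} {..<?n}"
    using bij_betw_trans[OF bij_betw_trans[OF bR f] bij_betw_inv_into[OF bC]] .
  then have "bij_betw q {..<?n} {..<?n}"
    by (rule bij_betw_cong[THEN iffD1, rotated]) (auto simp: q_def)
  then have q: "q permutes {..<?n}" by (rule bij_imp_permutes) (auto simp: q_def)
  have qf: "from_nat_into C (q k) = f (from_nat_into R k)" if "k < ?n" for k
  proof -
    have "f (from_nat_into R k) \<in> C" using that f bR by (auto simp: bij_betw_def)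
    then show ?thesis using that bC by (auto simp: q_def bij_betw_def f_inv_into_f)
  qed
  let ?e = "of_int (sign q) :: 'k"
  have ee: "?e * ?e = 1" by (simp flip: of_int_mult)
  show thesis
  proof (rule that[of ?e])
    fix A :: "'i \<Rightarrow> 'j \<Rightarrow> 'k"
    have "sdet R (\<lambda>r r'. A r (f r')) = sdet {..<?n} (\<lambda>k l. A (from_nat_into R k) (from_nat_into C (q l)))"
      unfolding detI_same[OF fin, symmetric] detI_def det_sdet by (rule sdet_cong) (simp add: qf)
    also have "\<dots> = ?e * detI R C A"
      unfolding detI_def det_sdet n
      using sdet_permute_cols[OF q, of "\<lambda>k l. A (from_nat_into R k) (from_nat_into C l)"] by simp
    finally show "detI R C A = ?e * sdet R (\<lambda>r r'. A r (f r'))"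
      using ee by (simp add: mult.assoc[symmetric])
  qed (rule ee)
qed

section \<open>Ryser's formula\<close>

text \<open>Complementation in A turns the sum into the expansion of the product of - 1 + 1 over A -
  B, which is empty exactly when A = B.\<close>

lemma sum_Pow_alternating:
  assumes "finite A" "B \<subseteq> A"
  shows "(\<Sum>S | B \<subseteq> S \<and> S \<subseteq> A. (- 1) ^ (card A - card S)) = (if A = B then 1 else (0::'k::comm_ring_1))"
proof -
  have "(\<Sum>S | B \<subseteq> S \<and> S \<subseteq> A. (- 1) ^ (card A - card S)) = (\<Sum>S\<in>Pow (A - B). (- 1::'k) ^ card S)"
    using assms
    by (intro sum.reindex_bij_witness[where i = "\<lambda>S. A - S" and j = "\<lambda>S. A - S"])
      (auto simp: card_Diff_subset finite_subset double_diff)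
  also have "\<dots> = (\<Prod>x\<in>A - B. (- 1 + 1))"
    using assms by (subst prod_add) (auto simp: finite_subset intro!: sum.cong)
  also have "\<dots> = (if A = B then 1 else 0)"
    using assms by (auto simp: prod_constant power_0_left card_eq_0_iff)
  finally show ?thesis .
qed

text \<open>Expanding the product gives a sum over maps from \<open>{..<T}\<close> into S.
  Inclusion-exclusion over S leaves the surjective maps, that is the permutations, and so the
  permanent. It serves as a polarization formula: the alternating sum of values of a product of T
  linear forms extracts the part linear in each of T directions.\<close>

lemma ryser:
  fixes a :: "nat \<Rightarrow> nat \<Rightarrow> 'k::comm_ring_1"
  shows "(\<Sum>S\<in>Pow {..<T}. (- 1) ^ (T - card S) * (\<Prod>s<T. \<Sum>r\<in>S. a s r)) =
    (\<Sum>p | p permutes {..<T}. \<Prod>s<T. a s (p s))"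
proof -
  let ?E = "{..<T} \<rightarrow>\<^sub>E {..<T}"
  have fE: "finite ?E" by (intro finite_PiE) auto
  have 1: "(\<Prod>s<T. \<Sum>r\<in>S. a s r) = (\<Sum>f\<in>{f\<in>?E. f ` {..<T} \<subseteq> S}. \<Prod>s<T. a s (f s))"
    if "S \<subseteq> {..<T}" for S
  proof -
    have "finite S" using that finite_subset by blast
    moreover have "{..<T} \<rightarrow>\<^sub>E S = {f\<in>?E. f ` {..<T} \<subseteq> S}" using that unfolding PiE_def Pi_def by blast
    ultimately show ?thesis by (simp add: prod_sum_PiE)
  qed
  have "(\<Sum>S\<in>Pow {..<T}. (- 1) ^ (T - card S) * (\<Prod>s<T. \<Sum>r\<in>S. a s r)) =
      (\<Sum>S\<in>Pow {..<T}. \<Sum>f\<in>{f\<in>?E. f ` {..<T} \<subseteq> S}. (- 1) ^ (T - card S) * (\<Prod>s<T. a s (f s)))"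
    by (intro sum.cong refl) (simp add: 1 sum_distrib_left)
  also have "\<dots> = (\<Sum>f\<in>?E. \<Sum>S\<in>{S\<in>Pow {..<T}. f ` {..<T} \<subseteq> S}. (- 1) ^ (T - card S) * (\<Prod>s<T. a s (f s)))"
    by (rule sum.swap_restrict) (use fE in auto)
  also have "\<dots> = (\<Sum>f\<in>?E. (\<Sum>S | f ` {..<T} \<subseteq> S \<and> S \<subseteq> {..<T}. (- 1) ^ (card {..<T} - card S)) * (\<Prod>s<T. a s (f s)))"
    by (intro sum.cong refl) (auto simp: sum_distrib_right intro!: sum.cong)
  also have "\<dots> = (\<Sum>f\<in>?E. (if {..<T} = f ` {..<T} then 1 else 0) * (\<Prod>s<T. a s (f s)))"
    by (intro sum.cong refl, subst sum_Pow_alternating) auto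
  also have "\<dots> = (\<Sum>f\<in>{f\<in>?E. f ` {..<T} = {..<T}}. \<Prod>s<T. a s (f s))"
  proof -
    have "(if {..<T} = X then 1 else 0) * c = (if X = {..<T} then c else (0::'k))" for X c by auto
    then show ?thesis by (simp only: sum.inter_filter[OF fE])
  qed
  also have "\<dots> = (\<Sum>p | p permutes {..<T}. \<Prod>s<T. a s (p s))"
  proof (rule sum.reindex_bij_witness[where i = "\<lambda>p. restrict p {..<T}" and j = "\<lambda>f s. if s < T then f s else s"])
    fix f assume f: "f \<in> {f\<in>?E. f ` {..<T} = {..<T}}"
    then have "bij_betw f {..<T} {..<T}" by (auto simp: bij_betw_def eq_card_imp_inj_on)
    then have "bij_betw (\<lambda>s. if s < T then f s else s) {..<T} {..<T}"
      by (rule bij_betw_cong[THEN iffD1, rotated]) auto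
    then have "(\<lambda>s. if s < T then f s else s) permutes {..<T}"
      by (rule bij_imp_permutes) auto
    then show "(\<lambda>s. if s < T then f s else s) \<in> {p. p permutes {..<T}}" by simp
  next
    fix f assume f: "f \<in> {f\<in>?E. f ` {..<T} = {..<T}}"
    then show "restrict (\<lambda>s. if s < T then f s else s) {..<T} = f"
      by (auto simp: fun_eq_iff PiE_def extensional_def)
  next
    fix p assume "p \<in> {p. p permutes {..<T}}"
    then have p: "p permutes {..<T}" by simp
    then show "(\<lambda>s. if s < T then restrict p {..<T} s else s) = p"
      by (auto simp: fun_eq_iff permutes_not_in)
    have "p ` {..<T} = {..<T}" using p by (rule permutes_image)
    then show "restrict p {..<T} \<in> {f\<in>?E. f ` {..<T} = {..<T}}"
      by auto
  qed (auto intro!: prod.cong)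
  finally show ?thesis .
qed

section \<open>The Omega operator\<close>

text \<open>The numbers below T label the rows of a block diagonal matrix: \<open>blk\<close> gives
  the block of a row and \<open>ty\<close> the row of G that it copies. Different blocks may copy
  the same rows, which is how powers of a determinant arise.\<close>

definition block_perms :: "nat \<Rightarrow> (nat \<Rightarrow> 'x) \<Rightarrow> (nat \<Rightarrow> nat) set" where
  "block_perms T blk = {p. p permutes {..<T} \<and> (\<forall>r<T. blk (p r) = blk r)}"

definition block_det :: "nat \<Rightarrow> (nat \<Rightarrow> 'x) \<Rightarrow> (nat \<Rightarrow> 'y) \<Rightarrow> ('y \<Rightarrow> 'y \<Rightarrow> 'k::comm_ring_1) \<Rightarrow> 'k" where
  "block_det T blk ty G = (\<Sum>p\<in>block_perms T blk. of_int (sign p) * (\<Prod>r<T. G (ty r) (ty (p r))))"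

text \<open>The Omega operator obtained from \<open>block_det\<close> by replacing the entries of G
  with partial derivatives. On a form \<Phi> of degree T the inner alternating sum is the mixed
  derivative along the T matrix units at (ty r, ty (p r)); written with values of \<Phi> it makes
  sense for arbitrary functions.\<close>

definition omega ::
    "nat \<Rightarrow> (nat \<Rightarrow> 'x) \<Rightarrow> (nat \<Rightarrow> 'y) \<Rightarrow> (('y \<Rightarrow> 'y \<Rightarrow> 'k::comm_ring_1) \<Rightarrow> 'k) \<Rightarrow> 'k" where
  "omega T blk ty \<Phi> = (\<Sum>p\<in>block_perms T blk. of_int (sign p) *
     (\<Sum>S\<in>Pow {..<T}. (- 1) ^ (T - card S) *
        \<Phi> (\<lambda>t t'. \<Sum>r\<in>S. if ty r = t \<and> ty (p r) = t' then 1 else 0)))"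

lemma finite_block_perms [simp]: "finite (block_perms T blk)"
  by (rule finite_subset[of _ "{p. p permutes {..<T}}"]) (auto simp: block_perms_def finite_permutations)

lemma id_block_perms [simp]: "id \<in> block_perms T blk"
  by (simp add: block_perms_def permutes_id)

lemma omega_linear:
  "omega T blk ty (\<lambda>G. \<Sum>i\<in>I. a i * \<Phi> i G) = (\<Sum>i\<in>I. a i * omega T blk ty (\<Phi> i))"
proof -
  have "omega T blk ty (\<lambda>G. \<Sum>i\<in>I. a i * \<Phi> i G) =
      (\<Sum>p\<in>block_perms T blk. \<Sum>S\<in>Pow {..<T}. \<Sum>i\<in>I. a i * (of_int (sign p) * ((- 1) ^ (T - card S) *
        \<Phi> i (\<lambda>t t'. \<Sum>r\<in>S. if ty r = t \<and> ty (p r) = t' then 1 else 0))))"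
    unfolding omega_def by (simp add: sum_distrib_left mult_ac)
  also have "\<dots> = (\<Sum>i\<in>I. \<Sum>p\<in>block_perms T blk. \<Sum>S\<in>Pow {..<T}. a i * (of_int (sign p) * ((- 1) ^ (T - card S) *
        \<Phi> i (\<lambda>t t'. \<Sum>r\<in>S. if ty r = t \<and> ty (p r) = t' then 1 else 0))))"
    by (subst sum.swap, subst (2) sum.swap) (rule refl)
  finally show ?thesis
    unfolding omega_def by (simp add: sum_distrib_left)
qed

text \<open>At a sum of matrix units over S each linear form becomes a sum over r in S, so
  \<open>ryser\<close> turns the alternating sum into a permanent. In its terms, q s is the
  derivative that falls on the factor s.\<close>

lemma omega_prod:
  assumes "finite Y" "ty ` {..<T} \<subseteq> Y"
  shows "omega T blk ty (\<lambda>G. \<Prod>s<T. \<Sum>t\<in>Y. G (u s) t * y s t) =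
    (\<Sum>p\<in>block_perms T blk. of_int (sign p) *
      (\<Sum>q | q permutes {..<T}. \<Prod>s<T. if ty (q s) = u s then y s (ty (p (q s))) else 0))"
  unfolding omega_def
proof (intro sum.cong refl arg_cong[where f = "\<lambda>x. _ * x"])
  fix p assume "p \<in> block_perms T blk"
  then have p: "p r < T" if "r < T" for r
    using that permutes_in_image[of p "{..<T}" r] by (auto simp: block_perms_def)
  have "(\<Sum>t\<in>Y. (\<Sum>r\<in>S. if ty r = u s \<and> ty (p r) = t then 1 else 0) * y s t) =
      (\<Sum>r\<in>S. if ty r = u s then y s (ty (p r)) else 0)" if "S \<subseteq> {..<T}" for S s
  proof -
    have "(\<Sum>t\<in>Y. (\<Sum>r\<in>S. if ty r = u s \<and> ty (p r) = t then 1 else 0) * y s t) =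
        (\<Sum>r\<in>S. \<Sum>t\<in>Y. if ty (p r) = t then (if ty r = u s then y s t else 0) else 0)"
      by (subst sum.swap) (auto simp: sum_distrib_right intro!: sum.cong)
    also have "\<dots> = (\<Sum>r\<in>S. if ty r = u s then y s (ty (p r)) else 0)"
      using assms p that by (intro sum.cong refl) (auto simp: image_subset_iff)
    finally show ?thesis .
  qed
  then have "(\<Sum>S\<in>Pow {..<T}. (- 1) ^ (T - card S) *
        (\<Prod>s<T. \<Sum>t\<in>Y. (\<Sum>r\<in>S. if ty r = u s \<and> ty (p r) = t then 1 else 0) * y s t)) =
      (\<Sum>S\<in>Pow {..<T}. (- 1) ^ (T - card S) *
        (\<Prod>s<T. \<Sum>r\<in>S. if ty r = u s then y s (ty (p r)) else 0))"
    by (intro sum.cong refl) auto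
  then show "(\<Sum>S\<in>Pow {..<T}. (- 1) ^ (T - card S) *
        (\<Prod>s<T. \<Sum>t\<in>Y. (\<Sum>r\<in>S. if ty r = u s \<and> ty (p r) = t then 1 else 0) * y s t)) =
      (\<Sum>q | q permutes {..<T}. \<Prod>s<T. if ty (q s) = u s then y s (ty (p (q s))) else 0)"
    using ryser[where T = T and a = "\<lambda>s r. if ty r = u s then y s (ty (p r)) else 0"] by simp
qed

text \<open>
  \<open>T!\<close> times the constant is a sum of squares of integers, one for each word: the square of
  the signed number of ways in which a permutation of the letters of \<open>r \<mapsto> (ty r, ty (p r))\<close>,
  \<open>p\<close> block-preserving, produces the word. The word of \<open>p = id\<close> arises from no other \<open>p\<close>.
\<close>

lemma omega_block_det_nonzero:
  assumes inj: "\<And>r r'. r < T \<Longrightarrow> r' < T \<Longrightarrow> blk r = blk r' \<Longrightarrow> ty r = ty r' \<Longrightarrow> r = r'"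
  shows "omega T blk ty (block_det T blk ty) \<noteq> (0::'k::{field_char_0})"
proof -
  let ?P = "{q. q permutes {..<T}}" and ?G = "block_perms T blk"
  have fP: "finite ?P" by (simp add: finite_permutations)
  define e where "e p q = restrict (\<lambda>s. (ty (q s), ty (p (q s)))) {..<T}" for p q :: "nat \<Rightarrow> nat"
  define I where "I b = (if b then 1 else 0 :: int)" for b
  define c where "c = (\<Sum>p'\<in>?G. \<Sum>p\<in>?G. sign p' * (sign p * (\<Sum>q\<in>?P. I (e p q = e p' id))))"
  have "omega T blk ty (block_det T blk ty) = (of_int c :: 'k)"
  proof -
    have "omega T blk ty (block_det T blk ty) =
        (\<Sum>p'\<in>?G. of_int (sign p') * omega T blk ty (\<lambda>G. \<Prod>r<T. G (ty r) (ty (p' r)) :: 'k))"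
      unfolding block_det_def[abs_def] by (rule omega_linear)
    also have "\<dots> = (\<Sum>p'\<in>?G. of_int (sign p') *
        (\<Sum>p\<in>?G. of_int (sign p) * (\<Sum>q\<in>?P. of_int (I (e p q = e p' id)))))"
    proof (intro sum.cong refl arg_cong[where f = "\<lambda>x. _ * x"])
      fix p' assume "p' \<in> ?G"
      then have p': "p' r < T" if "r < T" for r
        using that permutes_in_image[of p' "{..<T}" r] by (auto simp: block_perms_def)
      have "(\<lambda>G. \<Prod>r<T. G (ty r) (ty (p' r)) :: 'k) =
          (\<lambda>G. \<Prod>r<T. \<Sum>t\<in>ty ` {..<T}. G (ty r) t * (if t = ty (p' r) then 1 else 0))"
        using p' by (intro ext prod.cong refl) (auto simp: if_distrib cong: if_cong)
      then have "omega T blk ty (\<lambda>G. \<Prod>r<T. G (ty r) (ty (p' r)) :: 'k) =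
          (\<Sum>p\<in>?G. of_int (sign p) * (\<Sum>q\<in>?P. \<Prod>s<T. if ty (q s) = ty s then
             (if ty (p (q s)) = ty (p' s) then 1 else 0) else 0))"
        by (simp add: omega_prod)
      also have "\<dots> = (\<Sum>p\<in>?G. of_int (sign p) * (\<Sum>q\<in>?P. of_int (I (e p q = e p' id))))"
      proof (intro sum.cong refl arg_cong[where f = "\<lambda>x. _ * x"])
        fix p q
        have "(\<Prod>s<T. if ty (q s) = ty s then (if ty (p (q s)) = ty (p' s) then 1 else 0) else 0) =
            (\<Prod>s<T. if ty (q s) = ty s \<and> ty (p (q s)) = ty (p' s) then 1 else (0::'k))"
          by (intro prod.cong) auto
        also have "\<dots> = (if \<forall>s<T. ty (q s) = ty s \<and> ty (p (q s)) = ty (p' s) then 1 else 0)"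
          by (auto intro!: prod_zero bexI)
        also have "(\<forall>s<T. ty (q s) = ty s \<and> ty (p (q s)) = ty (p' s)) \<longleftrightarrow> e p q = e p' id"
          by (auto simp: e_def fun_eq_iff restrict_def)
        finally show "(\<Prod>s<T. if ty (q s) = ty s then (if ty (p (q s)) = ty (p' s) then 1 else 0) else 0) =
            (of_int (I (e p q = e p' id)) :: 'k)" by (simp add: I_def)
      qed
      finally show "omega T blk ty (\<lambda>G. \<Prod>r<T. G (ty r) (ty (p' r)) :: 'k) =
          (\<Sum>p\<in>?G. of_int (sign p) * (\<Sum>q\<in>?P. of_int (I (e p q = e p' id))))" .
    qed
    also have "\<dots> = of_int c"
      unfolding c_def by (simp add: sum_distrib_left)
    finally show ?thesis .
  qed
  moreover have "c \<noteq> 0"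
  proof -
    define W where "W = (\<lambda>(p, q). e p q) ` (?G \<times> ?P)"
    have fW: "finite W" unfolding W_def using fP by simp
    have mem: "e p q \<in> W" if "p \<in> ?G" "q \<in> ?P" for p q using that unfolding W_def by force
    \<comment> \<open>q' permutes the letters of both words simultaneously, so the count does not
      depend on it. Summing over q' therefore contributes the factor T!.\<close>
    have shift: "(\<Sum>q\<in>?P. I (e p q = e p' q')) = (\<Sum>q\<in>?P. I (e p q = e p' id))" if q': "q' \<in> ?P" for p p' q'
    proof -
      have "e p (q \<circ> q') = e p' q' \<longleftrightarrow> e p q = e p' id" for q
      proof -
        have im: "q' ` {..<T} = {..<T}" using q' by (simp add: permutes_image)
        have "e p (q \<circ> q') = e p' q' \<longleftrightarrow> (\<forall>s\<in>{..<T}. (ty (q (q' s)), ty (p (q (q' s)))) = (ty (q' s), ty (p' (q' s))))"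
          by (auto simp: e_def fun_eq_iff restrict_def)
        also have "\<dots> \<longleftrightarrow> (\<forall>s\<in>q' ` {..<T}. (ty (q s), ty (p (q s))) = (ty s, ty (p' s)))" by simp
        also have "\<dots> \<longleftrightarrow> e p q = e p' id"
          unfolding im by (auto simp: e_def fun_eq_iff restrict_def)
        finally show ?thesis .
      qed
      then show ?thesis
        using q' by (subst sum_permutations_compose_right[of q']) auto
    qed
    have sq: "(\<Sum>w\<in>W. (\<Sum>p\<in>?G. \<Sum>q\<in>?P. sign p * I (e p q = w)) ^ 2) = int (card ?P) * c"
    proof -
      let ?X = "?G \<times> ?P"
      let ?E = "\<lambda>x. e (fst x) (snd x)"
      have "(\<Sum>w\<in>W. (\<Sum>p\<in>?G. \<Sum>q\<in>?P. sign p * I (e p q = w)) ^ 2) =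
          (\<Sum>w\<in>W. (\<Sum>x\<in>?X. sign (fst x) * I (?E x = w)) ^ 2)"
        unfolding sum.cartesian_product' fst_conv snd_conv ..
      also have "\<dots> = (\<Sum>w\<in>W. \<Sum>x\<in>?X. \<Sum>y\<in>?X.
          (sign (fst x) * I (?E x = w)) * (sign (fst y) * I (?E y = w)))"
        unfolding power2_eq_square sum_product ..
      also have "\<dots> = (\<Sum>x\<in>?X. \<Sum>y\<in>?X. \<Sum>w\<in>W.
          (sign (fst x) * I (?E x = w)) * (sign (fst y) * I (?E y = w)))"
        by (subst sum.swap) (rule sum.cong[OF refl], rule sum.swap)
      also have "\<dots> = (\<Sum>x\<in>?X. \<Sum>y\<in>?X. sign (fst x) * (sign (fst y) * I (?E y = ?E x)))"
      proof (intro sum.cong refl)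
        fix x y assume "x \<in> ?X" "y \<in> ?X"
        have "(\<Sum>w\<in>W. (sign (fst x) * I (?E x = w)) * (sign (fst y) * I (?E y = w))) =
            (\<Sum>w\<in>W. if w = ?E x then sign (fst x) * (sign (fst y) * I (?E y = ?E x)) else 0)"
          by (intro sum.cong refl) (auto simp: I_def)
        also have "\<dots> = sign (fst x) * (sign (fst y) * I (?E y = ?E x))"
          using fW mem \<open>x \<in> ?X\<close> by (auto simp: mem_Times_iff)
        finally show "(\<Sum>w\<in>W. (sign (fst x) * I (?E x = w)) * (sign (fst y) * I (?E y = w))) =
          sign (fst x) * (sign (fst y) * I (?E y = ?E x))" .
      qed
      also have "\<dots> = (\<Sum>p'\<in>?G. \<Sum>q'\<in>?P. \<Sum>p\<in>?G. sign p' * (sign p * (\<Sum>q\<in>?P. I (e p q = e p' q'))))"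
        unfolding sum.cartesian_product' fst_conv snd_conv sum_distrib_left ..
      also have "\<dots> = (\<Sum>p'\<in>?G. \<Sum>q'\<in>?P. \<Sum>p\<in>?G. sign p' * (sign p * (\<Sum>q\<in>?P. I (e p q = e p' id))))"
        by (rule sum.cong[OF refl], rule sum.cong[OF refl], rule sum.cong[OF refl]) (simp only: shift)
      also have "\<dots> = int (card ?P) * c"
        unfolding c_def sum_constant sum_distrib_left[symmetric] ..
      finally show ?thesis .
    qed
    have idW: "e id id \<in> W" by (rule mem) (auto simp: permutes_id)
    have "(\<Sum>p\<in>?G. \<Sum>q\<in>?P. sign p * I (e p q = e id id)) =
        (\<Sum>p\<in>?G. if p = id then (\<Sum>q\<in>?P. I (e id q = e id id)) else 0)"
    proof (intro sum.cong refl)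
      fix p assume p: "p \<in> ?G"
      \<comment> \<open>Each letter of the identity word has equal components, so p preserves the
        type of every row as well as its block, and \<open>inj\<close> makes it the
        identity.\<close>
      have "e p q \<noteq> e id id" if "p \<noteq> id" and q: "q \<in> ?P" for q
      proof
        assume eq: "e p q = e id id"
        have "p r = r" if "r < T" for r
        proof -
          have "r \<in> q ` {..<T}" using that q by (simp add: permutes_image)
          then obtain s where s: "s < T" "r = q s" by auto
          then have "ty (q s) = ty s \<and> ty (p (q s)) = ty s"
            using fun_cong[OF eq, of s] by (simp add: e_def)
          then have "ty (p r) = ty r" using s by simp
          moreover have "blk (p r) = blk r" "p r < T"
            using p that permutes_in_image[of p "{..<T}" r] by (auto simp: block_perms_def)
          ultimately show ?thesis using inj that by blast
        qed
        then have "p r = r" for r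
          using p permutes_not_in[of p "{..<T}" r] by (cases "r < T") (auto simp: block_perms_def)
        then show False using \<open>p \<noteq> id\<close> by auto
      qed
      then show "(\<Sum>q\<in>?P. sign p * I (e p q = e id id)) =
          (if p = id then (\<Sum>q\<in>?P. I (e id q = e id id)) else 0)"
        by (auto simp: I_def)
    qed
    also have "\<dots> = (\<Sum>q\<in>?P. I (e id q = e id id))" by simp
    also have "\<dots> > 0"
      using fP by (intro sum_pos2[of _ id]) (auto simp: I_def permutes_id)
    finally have "0 < (\<Sum>w\<in>W. (\<Sum>p\<in>?G. \<Sum>q\<in>?P. sign p * I (e p q = w)) ^ 2)"
      using idW fW by (intro sum_pos2[of _ "e id id"]) auto
    then show "c \<noteq> 0" unfolding sq by auto
  qed
  ultimately show ?thesis by simp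
qed

text \<open>
  The double sum is the coefficient of \<open>x\<^sub>1 \<cdots> x\<^sub>T\<close> in the determinant of the generic linear
  combination of the \<open>T\<close> matrices \<open>w s\<close>, each truncated to one block.
\<close>

lemma block_perms_sum_det:
  fixes w :: "nat \<Rightarrow> nat \<Rightarrow> nat \<Rightarrow> 'k::comm_ring_1"
  assumes \<beta>: "\<beta> permutes {..<T}" and \<gamma>: "\<gamma> permutes {..<T}"
  shows "(\<Sum>\<pi>\<in>block_perms T blk. \<Sum>\<rho>\<in>block_perms T blk'. of_int (sign \<pi>) * of_int (sign \<rho>) *
      (\<Prod>s<T. w s (\<pi> (\<beta> s)) (\<rho> (\<gamma> s)))) =
    of_int (sign \<beta>) * of_int (sign \<gamma>) * (\<Sum>S\<in>Pow {..<T}. (- 1) ^ (T - card S) *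
      det (mat T T (\<lambda>(r, c). \<Sum>s\<in>S. if blk r = blk (\<beta> s) \<and> blk' c = blk' (\<gamma> s) then w s r c else 0)))"
proof -
  let ?P = "{q. q permutes {..<T}}"
  let ?X = "\<lambda>s r c. if blk r = blk (\<beta> s) \<and> blk' c = blk' (\<gamma> s) then w s r c else 0"
  have fP: "finite ?P" by (simp add: finite_permutations)
  have "(\<Sum>S\<in>Pow {..<T}. (- 1) ^ (T - card S) * det (mat T T (\<lambda>(r, c). \<Sum>s\<in>S. ?X s r c))) =
      (\<Sum>\<alpha>\<in>?P. of_int (sign \<alpha>) * (\<Sum>S\<in>Pow {..<T}. (- 1) ^ (T - card S) * (\<Prod>r<T. \<Sum>s\<in>S. ?X s r (\<alpha> r))))"
    unfolding det_sdet sdet_def sum_distrib_left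
    by (subst sum.swap) (simp add: mult_ac)
  also have "\<dots> = (\<Sum>\<alpha>\<in>?P. of_int (sign \<alpha>) * (\<Sum>\<eta>\<in>?P. \<Prod>r<T. ?X (\<eta> r) r (\<alpha> r)))"
    by (subst ryser) simp
  \<comment> \<open>\<delta> is the inverse of \<eta>: the product over rows becomes a product over
    the factors s, with \<delta> s the row that s occupies.\<close>
  also have "\<dots> = (\<Sum>\<alpha>\<in>?P. of_int (sign \<alpha>) * (\<Sum>\<delta>\<in>?P. \<Prod>s<T. ?X s (\<delta> s) (\<alpha> (\<delta> s))))"
  proof (rule sum.cong[OF refl], rule arg_cong[where f = "\<lambda>x. _ * x"])
    fix \<alpha>
    have "(\<Prod>r<T. ?X (inv_into UNIV \<delta> r) r (\<alpha> r)) = (\<Prod>s<T. ?X s (\<delta> s) (\<alpha> (\<delta> s)))" if "\<delta> \<in> ?P" for \<delta>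
    proof -
      have z: "\<delta> permutes {..<T}" using that by simp
      have b: "bij_betw \<delta> {..<T} {..<T}" using z by (rule permutes_imp_bij)
      show ?thesis
        by (subst prod.reindex_bij_betw[OF b, symmetric]) (simp only: permutes_inverses(2)[OF z])
    qed
    then show "(\<Sum>\<eta>\<in>?P. \<Prod>r<T. ?X (\<eta> r) r (\<alpha> r)) = (\<Sum>\<delta>\<in>?P. \<Prod>s<T. ?X s (\<delta> s) (\<alpha> (\<delta> s)))"
      by (subst sum_permutations_inverse) (intro sum.cong refl, simp)
  qed
  also have "\<dots> = (\<Sum>\<alpha>\<in>?P. of_int (sign \<alpha>) * (\<Sum>\<pi>\<in>?P. \<Prod>s<T. ?X s (\<pi> (\<beta> s)) (\<alpha> (\<pi> (\<beta> s)))))"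
    by (rule sum.cong[OF refl], subst sum_permutations_compose_right[OF \<beta>]) (simp only: o_apply)
  also have "\<dots> = (\<Sum>\<pi>\<in>?P. \<Sum>\<alpha>\<in>?P. of_int (sign \<alpha>) * (\<Prod>s<T. ?X s (\<pi> (\<beta> s)) (\<alpha> (\<pi> (\<beta> s)))))"
    unfolding sum_distrib_left by (rule sum.swap)
  \<comment> \<open>For fixed \<pi> put \<alpha> = \<rho> \<circ> \<gamma> \<circ> (\<pi> \<circ>
    \<beta>)^-1, so that the column of the factor s becomes \<rho> (\<gamma> s). The sign of
    \<alpha> splits into four signs.\<close>
  also have "\<dots> = (\<Sum>\<pi>\<in>?P. \<Sum>\<rho>\<in>?P. of_int (sign \<rho> * (sign \<gamma> * (sign \<pi> * sign \<beta>))) *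
      (\<Prod>s<T. ?X s (\<pi> (\<beta> s)) (\<rho> (\<gamma> s))))"
  proof (rule sum.cong[OF refl])
    fix \<pi> assume "\<pi> \<in> ?P"
    then have p: "\<pi> permutes {..<T}" by simp
    have pb: "\<pi> \<circ> \<beta> permutes {..<T}" by (rule permutes_compose[OF \<beta> p])
    have q: "\<gamma> \<circ> inv_into UNIV (\<pi> \<circ> \<beta>) permutes {..<T}"
      by (rule permutes_compose[OF permutes_inv[OF pb] \<gamma>])
    have perm: "permutation \<pi>" "permutation \<beta>" "permutation \<gamma>" "permutation (\<pi> \<circ> \<beta>)" "permutation (inv_into UNIV (\<pi> \<circ> \<beta>))" "permutation (\<gamma> \<circ> inv_into UNIV (\<pi> \<circ> \<beta>))"
      using p \<beta> \<gamma> pb q permutes_inv[OF pb] by (auto simp only: permutes_imp_permutation[OF finite_lessThan])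
    have sg: "sign (\<rho> \<circ> (\<gamma> \<circ> inv_into UNIV (\<pi> \<circ> \<beta>))) = sign \<rho> * (sign \<gamma> * (sign \<pi> * sign \<beta>))" if "\<rho> \<in> ?P" for \<rho>
    proof -
      have "permutation \<rho>" using that by (auto intro: permutes_imp_permutation[OF finite_lessThan])
      then show ?thesis using perm by (simp add: sign_compose sign_inverse)
    qed
    have app: "(\<rho> \<circ> (\<gamma> \<circ> inv_into UNIV (\<pi> \<circ> \<beta>))) (\<pi> (\<beta> s)) = \<rho> (\<gamma> s)" for \<rho> :: "nat \<Rightarrow> nat" and s
      using permutes_inverses(2)[OF pb, of s] by simp
    show "(\<Sum>\<alpha>\<in>?P. of_int (sign \<alpha>) * (\<Prod>s<T. ?X s (\<pi> (\<beta> s)) (\<alpha> (\<pi> (\<beta> s))))) =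
      (\<Sum>\<rho>\<in>?P. of_int (sign \<rho> * (sign \<gamma> * (sign \<pi> * sign \<beta>))) * (\<Prod>s<T. ?X s (\<pi> (\<beta> s)) (\<rho> (\<gamma> s))))"
      by (subst sum_permutations_compose_right[OF q]) (intro sum.cong refl, simp only: sg app)
  qed
  \<comment> \<open>The truncation of w s to one block annihilates every term in which \<pi> or
    \<rho> moves a block.\<close>
  also have "\<dots> = (\<Sum>\<pi>\<in>?P. \<Sum>\<rho>\<in>?P. if \<pi> \<in> block_perms T blk \<and> \<rho> \<in> block_perms T blk' then
      of_int (sign \<beta>) * of_int (sign \<gamma>) * (of_int (sign \<pi>) * of_int (sign \<rho>) * (\<Prod>s<T. w s (\<pi> (\<beta> s)) (\<rho> (\<gamma> s)))) else 0)"
  proof (intro sum.cong refl)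
    fix \<pi> \<rho> assume p: "\<pi> \<in> ?P" "\<rho> \<in> ?P"
    have b: "(\<forall>s<T. blk (\<pi> (\<beta> s)) = blk (\<beta> s)) \<longleftrightarrow> \<pi> \<in> block_perms T blk"
    proof -
      have "(\<forall>s\<in>{..<T}. blk (\<pi> (\<beta> s)) = blk (\<beta> s)) \<longleftrightarrow> (\<forall>r\<in>\<beta> ` {..<T}. blk (\<pi> r) = blk r)" by simp
      then show ?thesis unfolding permutes_image[OF \<beta>] using p by (auto simp: block_perms_def)
    qed
    have c: "(\<forall>s<T. blk' (\<rho> (\<gamma> s)) = blk' (\<gamma> s)) \<longleftrightarrow> \<rho> \<in> block_perms T blk'"
    proof -
      have "(\<forall>s\<in>{..<T}. blk' (\<rho> (\<gamma> s)) = blk' (\<gamma> s)) \<longleftrightarrow> (\<forall>r\<in>\<gamma> ` {..<T}. blk' (\<rho> r) = blk' r)" by simp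
      then show ?thesis unfolding permutes_image[OF \<gamma>] using p by (auto simp: block_perms_def)
    qed
    show "of_int (sign \<rho> * (sign \<gamma> * (sign \<pi> * sign \<beta>))) * (\<Prod>s<T. ?X s (\<pi> (\<beta> s)) (\<rho> (\<gamma> s))) =
      (if \<pi> \<in> block_perms T blk \<and> \<rho> \<in> block_perms T blk' then
      of_int (sign \<beta>) * of_int (sign \<gamma>) * (of_int (sign \<pi>) * of_int (sign \<rho>) * (\<Prod>s<T. w s (\<pi> (\<beta> s)) (\<rho> (\<gamma> s)))) else 0)"
    proof (cases "\<forall>s<T. blk (\<pi> (\<beta> s)) = blk (\<beta> s) \<and> blk' (\<rho> (\<gamma> s)) = blk' (\<gamma> s)")
      case True
      then have "(\<Prod>s<T. ?X s (\<pi> (\<beta> s)) (\<rho> (\<gamma> s))) = (\<Prod>s<T. w s (\<pi> (\<beta> s)) (\<rho> (\<gamma> s)))"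
        by (intro prod.cong) auto
      moreover have "\<pi> \<in> block_perms T blk \<and> \<rho> \<in> block_perms T blk'" using True b c by blast
      ultimately show ?thesis by (simp add: mult_ac)
    next
      case False
      then obtain s where "s < T" "\<not> (blk (\<pi> (\<beta> s)) = blk (\<beta> s) \<and> blk' (\<rho> (\<gamma> s)) = blk' (\<gamma> s))" by blast
      then have "(\<Prod>s<T. ?X s (\<pi> (\<beta> s)) (\<rho> (\<gamma> s))) = 0"
        by (intro prod_zero) (auto intro!: bexI[of _ s])
      moreover have "\<not> (\<pi> \<in> block_perms T blk \<and> \<rho> \<in> block_perms T blk')" using False b c by blast
      ultimately show ?thesis by (simp only: if_False mult_zero_right)
    qed
  qed
  also have "\<dots> = (\<Sum>\<pi>\<in>?P. if \<pi> \<in> block_perms T blk then (\<Sum>\<rho>\<in>?P. if \<rho> \<in> block_perms T blk' then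
      of_int (sign \<beta>) * of_int (sign \<gamma>) * (of_int (sign \<pi>) * of_int (sign \<rho>) * (\<Prod>s<T. w s (\<pi> (\<beta> s)) (\<rho> (\<gamma> s)))) else 0) else 0)"
    by (intro sum.cong refl) auto
  also have "\<dots> = of_int (sign \<beta>) * of_int (sign \<gamma>) * (\<Sum>\<pi>\<in>block_perms T blk. \<Sum>\<rho>\<in>block_perms T blk'.
      of_int (sign \<pi>) * of_int (sign \<rho>) * (\<Prod>s<T. w s (\<pi> (\<beta> s)) (\<rho> (\<gamma> s))))"
  proof -
    have sub: "?P \<inter> block_perms T f = block_perms T f" for f :: "nat \<Rightarrow> 'z" by (auto simp: block_perms_def)
    have sub': "?P \<inter> {x. x \<in> block_perms T f} = block_perms T f" for f :: "nat \<Rightarrow> 'z" by (auto simp: block_perms_def)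
    show ?thesis using fP by (simp add: sum.If_cases sub sub' sum_distrib_left)
  qed
  finally have eq: "(\<Sum>S\<in>Pow {..<T}. (- 1) ^ (T - card S) * det (mat T T (\<lambda>(r, c). \<Sum>s\<in>S. ?X s r c))) =
      of_int (sign \<beta>) * of_int (sign \<gamma>) * (\<Sum>\<pi>\<in>block_perms T blk. \<Sum>\<rho>\<in>block_perms T blk'.
      of_int (sign \<pi>) * of_int (sign \<rho>) * (\<Prod>s<T. w s (\<pi> (\<beta> s)) (\<rho> (\<gamma> s))))" .
  have "(of_int (sign \<beta>) * of_int (sign \<gamma>)) * (of_int (sign \<beta>) * of_int (sign \<gamma>)) = (1::'k)"
    by (simp add: mult_ac flip: of_int_mult) (simp add: mult.assoc[symmetric])?
  then show ?thesis unfolding eq by (simp add: mult.assoc[symmetric])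
qed

section \<open>Block determinants\<close>

lemma span_scale: "f \<in> fun_space.span B \<Longrightarrow> (\<lambda>x. c * f x) \<in> fun_space.span B"
  by (rule fun_space.span_scale)

lemma span_sum:
  assumes "\<And>i. i \<in> I \<Longrightarrow> f i \<in> fun_space.span B"
  shows "(\<lambda>x. \<Sum>i\<in>I. f i x) \<in> fun_space.span B"
proof (cases "finite I")
  case True
  have "(\<lambda>x. \<Sum>i\<in>I. f i x) = (\<Sum>i\<in>I. f i)"
    using True by (induction I rule: finite_induct) (auto simp: fun_eq_iff)
  then show ?thesis using fun_space.span_sum[OF assms, of I] by simp
next
  case False
  then show ?thesis using fun_space.span_zero[of B] by (simp add: zero_fun_def)
qed

text \<open>An arrow of the double quiver is recorded by the vertices of Q below its ends, so c_v
  becomes a loop at v. The tags are implied: 0 at the source and 1 at the target.\<close>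

definition src :: "('v, 'a) pre_digraph \<Rightarrow> 'v + 'a \<Rightarrow> 'v" where
  "src Q = case_sum (\<lambda>v. v) (tail Q)"

definition tgt :: "('v, 'a) pre_digraph \<Rightarrow> 'v + 'a \<Rightarrow> 'v" where
  "tgt Q = case_sum (\<lambda>v. v) (head Q)"

lemma src_tgt_simps [simp]: "src Q (Inl v) = v" "src Q (Inr a) = tail Q a"
  "tgt Q (Inl v) = v" "tgt Q (Inr a) = head Q a"
  by (simp_all add: src_def tgt_def)

definition darcs :: "('v, 'a) pre_digraph \<Rightarrow> ('v + 'a) set" where
  "darcs Q = verts Q <+> arcs Q"

lemma darcs_verts:
  assumes "fin_digraph Q" "b \<in> darcs Q"
  shows "src Q b \<in> verts Q" "tgt Q b \<in> verts Q"
proof -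
  interpret fin_digraph Q by fact
  show "src Q b \<in> verts Q" "tgt Q b \<in> verts Q" using assms(2) by (auto simp: darcs_def)
qed

lemma finite_darcs: "fin_digraph Q \<Longrightarrow> finite (darcs Q)"
  by (simp add: darcs_def fin_digraph.finite_verts fin_digraph.finite_arcs)

text \<open>The element \<open>(v, j, i)\<close> is the \<open>i\<close>-th row of the \<open>j\<close>-th of \<open>m v\<close> blocks of size \<open>d v\<close>.\<close>

definition brk :: "('v, 'a) pre_digraph \<Rightarrow> ('v \<Rightarrow> nat) \<Rightarrow> ('v \<Rightarrow> nat) \<Rightarrow> ('v \<times> nat \<times> nat) set" where
  "brk Q d m = (SIGMA v : verts Q. {..<m v} \<times> {..<d v})"

lemma finite_brk: "fin_digraph Q \<Longrightarrow> finite (brk Q d m)"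
  by (simp add: brk_def fin_digraph.finite_verts)

lemma card_brk: "fin_digraph Q \<Longrightarrow> card (brk Q d m) = (\<Sum>v\<in>verts Q. m v * d v)"
  by (simp add: brk_def fin_digraph.finite_verts)

text \<open>With these blocks and types \<open>block_det\<close> is the product of the det(G_v)^(m
  v), and \<open>omegaQ\<close> is the Omega operator of that product.\<close>

definition bblk :: "('v, 'a) pre_digraph \<Rightarrow> ('v \<Rightarrow> nat) \<Rightarrow> ('v \<Rightarrow> nat) \<Rightarrow> nat \<Rightarrow> 'v \<times> nat" where
  "bblk Q d m r = (case from_nat_into (brk Q d m) r of (v, j, i) \<Rightarrow> (v, j))"

definition bty :: "('v, 'a) pre_digraph \<Rightarrow> ('v \<Rightarrow> nat) \<Rightarrow> ('v \<Rightarrow> nat) \<Rightarrow> nat \<Rightarrow> 'v \<times> nat" where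
  "bty Q d m r = (case from_nat_into (brk Q d m) r of (v, j, i) \<Rightarrow> (v, i))"

definition omegaQ ::
    "('v, 'a) pre_digraph \<Rightarrow> ('v \<Rightarrow> nat) \<Rightarrow> ('v \<Rightarrow> nat) \<Rightarrow>
     (('v \<times> nat \<Rightarrow> 'v \<times> nat \<Rightarrow> 'k::comm_ring_1) \<Rightarrow> 'k) \<Rightarrow> 'k" where
  "omegaQ Q d m = omega (card (brk Q d m)) (bblk Q d m) (bty Q d m)"

definition diag_block :: "('v \<Rightarrow> nat) \<Rightarrow> ('v \<times> nat \<Rightarrow> 'v \<times> nat \<Rightarrow> 'k) \<Rightarrow> 'v \<Rightarrow> 'k mat" where
  "diag_block d G v = mat (d v) (d v) (\<lambda>(i, j). G (v, i) (v, j))"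

lemma sdet_brk:
  assumes "fin_digraph Q"
  shows "sdet (brk Q d m) (\<lambda>(v, j, i) (v', j', i'). if v = v' \<and> j = j' then A v i i' else 0) =
    (\<Prod>v\<in>verts Q. det (mat (d v) (d v) (\<lambda>(i, j). A v i j)) ^ m v)"
proof -
  interpret fin_digraph Q by fact
  have "sdet (brk Q d m) (\<lambda>(v, j, i) (v', j', i'). if v = v' \<and> j = j' then A v i i' else 0) =
      sdet (brk Q d m) (\<lambda>(v, x) (v', x'). if v = v' then
        (\<lambda>(j, i) (j', i'). if j = j' then A v i i' else 0) x x' else 0)"
    by (rule sdet_cong) auto
  also have "\<dots> = (\<Prod>v\<in>verts Q. sdet ({..<m v} \<times> {..<d v}) (\<lambda>(j, i) (j', i'). if j = j' then A v i i' else 0))"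
    unfolding brk_def by (rule sdet_Sigma) auto
  also have "\<dots> = (\<Prod>v\<in>verts Q. det (mat (d v) (d v) (\<lambda>(i, j). A v i j)) ^ m v)"
    by (intro prod.cong refl, subst sdet_Sigma) (auto simp: det_sdet)
  finally show ?thesis .
qed

text \<open>Setting the entries between different blocks to zero kills exactly the permutations
  outside \<open>block_perms\<close>. What remains is the full Leibniz sum of a block diagonal
  matrix with m v equal blocks at v.\<close>

lemma block_det_brk:
  assumes "fin_digraph Q"
  shows "block_det (card (brk Q d m)) (bblk Q d m) (bty Q d m) G =
    (\<Prod>v\<in>verts Q. det (diag_block d G v) ^ m v)"
proof -
  let ?B = "brk Q d m" and ?blk = "bblk Q d m" and ?ty = "bty Q d m"
  let ?T = "card ?B"
  have fB: "finite ?B" using assms by (rule finite_brk)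
  have "block_det ?T ?blk ?ty G = sdet {..<?T} (\<lambda>r r'. if ?blk r = ?blk r' then G (?ty r) (?ty r') else 0)"
  proof -
    have "(\<Prod>r<?T. if ?blk r = ?blk (p r) then G (?ty r) (?ty (p r)) else 0) =
        (if p \<in> block_perms ?T ?blk then (\<Prod>r<?T. G (?ty r) (?ty (p r))) else 0)"
      if p: "p permutes {..<?T}" for p
    proof (cases "p \<in> block_perms ?T ?blk")
      case True then show ?thesis by (auto simp: block_perms_def intro!: prod.cong)
    next
      case False
      then obtain r where "r < ?T" "?blk (p r) \<noteq> ?blk r" using p by (auto simp: block_perms_def)
      then have "(\<Prod>r<?T. if ?blk r = ?blk (p r) then G (?ty r) (?ty (p r)) else 0) = 0"
        by (intro prod_zero) (auto intro!: bexI[of _ r])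
      then show ?thesis using False by simp
    qed
    then have "sdet {..<?T} (\<lambda>r r'. if ?blk r = ?blk r' then G (?ty r) (?ty r') else 0) =
        (\<Sum>p | p permutes {..<?T}. if p \<in> block_perms ?T ?blk then
          of_int (sign p) * (\<Prod>r<?T. G (?ty r) (?ty (p r))) else 0)"
      unfolding sdet_def by (intro sum.cong) auto
    also have "\<dots> = block_det ?T ?blk ?ty G"
      unfolding block_det_def
      by (rule sum.mono_neutral_cong_right) (auto simp: finite_permutations block_perms_def)
    finally show ?thesis ..
  qed
  also have "\<dots> = detI ?B ?B (\<lambda>(v, j, i) (v', j', i'). if v = v' \<and> j = j' then G (v, i) (v, i') else 0)"
    unfolding detI_def det_sdet
    by (rule sdet_cong) (auto simp: bblk_def bty_def split: prod.splits)
  also have "\<dots> = sdet ?B (\<lambda>(v, j, i) (v', j', i'). if v = v' \<and> j = j' then G (v, i) (v, i') else 0)"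
    by (rule detI_same[OF fB])
  also have "\<dots> = (\<Prod>v\<in>verts Q. det (diag_block d G v) ^ m v)"
    using sdet_brk[OF assms, of d m "\<lambda>v i i'. G (v, i) (v, i')"] by (simp add: diag_block_def)
  finally show ?thesis .
qed

lemma omegaQ_det_nonzero:
  assumes "fin_digraph Q"
  shows "omegaQ Q d m (\<lambda>G. \<Prod>v\<in>verts Q. det (diag_block d G v) ^ m v) \<noteq> (0::'k::field_char_0)"
proof -
  have fB: "finite (brk Q d m)" using assms by (rule finite_brk)
  have "r = r'" if "r < card (brk Q d m)" "r' < card (brk Q d m)"
    "bblk Q d m r = bblk Q d m r'" "bty Q d m r = bty Q d m r'" for r r'
  proof -
    have "from_nat_into (brk Q d m) r = from_nat_into (brk Q d m) r'"
      using that(3,4) by (auto simp: bblk_def bty_def split: prod.splits)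
    then show ?thesis
      using bij_betw_from_nat_into_finite[OF fB] that(1,2) by (auto simp: bij_betw_def inj_on_def)
  qed
  then have "omega (card (brk Q d m)) (bblk Q d m) (bty Q d m)
      (block_det (card (brk Q d m)) (bblk Q d m) (bty Q d m)) \<noteq> (0::'k)"
    by (rule omega_block_det_nonzero)
  then show ?thesis
    unfolding omegaQ_def block_det_brk[OF assms, abs_def] by simp
qed

text \<open>The determinant of a map from N v copies of each space at v to m w copies of each space
  at w, with linear combinations of the W b as blocks. Such determinants are the Domokos-Zubkov form
  of determinantal semi-invariants.\<close>

definition block_poly ::
    "('v, 'a) pre_digraph \<Rightarrow> ('v \<Rightarrow> nat) \<Rightarrow> ('v \<Rightarrow> nat) \<Rightarrow> ('v \<Rightarrow> nat) \<Rightarrow>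
     ('v + 'a \<Rightarrow> nat \<Rightarrow> nat \<Rightarrow> 'k::field) \<Rightarrow> ('v + 'a \<Rightarrow> nat \<Rightarrow> nat \<Rightarrow> 'k) \<Rightarrow> 'k" where
  "block_poly Q d m N x W = detI (brk Q d m) (brk Q d N)
     (\<lambda>(w, j, i) (v, k, l). \<Sum>b | b \<in> darcs Q \<and> src Q b = v \<and> tgt Q b = w. x b k j * W b i l)"

section \<open>Averaging a monomial\<close>

text \<open>
  \<open>W \<mapsto> g W h\<close> on families of matrices indexed by the arrows of the double quiver, where \<open>G\<close>
  is \<open>g\<close> and \<open>H\<close> is the transpose of \<open>h\<close>.
\<close>

definition two_sided ::
    "('v, 'a) pre_digraph \<Rightarrow> ('v \<Rightarrow> nat) \<Rightarrow> ('v \<times> nat \<Rightarrow> 'v \<times> nat \<Rightarrow> 'k::field) \<Rightarrow>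
     ('v \<times> nat \<Rightarrow> 'v \<times> nat \<Rightarrow> 'k) \<Rightarrow> ('v + 'a \<Rightarrow> nat \<Rightarrow> nat \<Rightarrow> 'k) \<Rightarrow> 'v + 'a \<Rightarrow> nat \<Rightarrow> nat \<Rightarrow> 'k" where
  "two_sided Q d G H W b i l = (\<Sum>i'<d (tgt Q b). \<Sum>l'<d (src Q b).
     G (tgt Q b, i) (tgt Q b, i') * W b i' l' * H (src Q b, l) (src Q b, l'))"

definition arrow_monos ::
    "('v, 'a) pre_digraph \<Rightarrow> ('v \<Rightarrow> nat) \<Rightarrow> nat \<Rightarrow> (('v + 'a \<Rightarrow> nat \<Rightarrow> nat \<Rightarrow> 'k::field) \<Rightarrow> 'k) set" where
  "arrow_monos Q d T = {\<lambda>W. \<Prod>s<T. W (bs s) (is s) (ls s) | bs is ls.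
     \<forall>s<T. bs s \<in> darcs Q \<and> is s < d (tgt Q (bs s)) \<and> ls s < d (src Q (bs s))}"

text \<open>Brings an entry into the shape that \<open>omega_prod\<close> accepts: a linear form in
  G, and in H, over one index set common to all vertices.\<close>

lemma two_sided_alt:
  assumes Q: "fin_digraph Q" and b: "b \<in> darcs Q"
  shows "two_sided Q d G H W b i l = (\<Sum>t\<in>(SIGMA v:verts Q. {..<d v}). G (tgt Q b, i) t *
    (\<Sum>t'\<in>(SIGMA v:verts Q. {..<d v}). H (src Q b, l) t' *
      (if fst t = tgt Q b \<and> fst t' = src Q b then W b (snd t) (snd t') else 0)))"
proof -
  let ?Y = "SIGMA v:verts Q. {..<d v}"
  have fY: "finite ?Y" using Q by (simp add: fin_digraph.finite_verts)
  have S: "(\<Sum>t\<in>?Y. if fst t = v then f t else 0) = (\<Sum>i<d v. f (v, i))" if "v \<in> verts Q"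
    for v and f :: "_ \<Rightarrow> 'c"
  proof -
    have "(\<Sum>t\<in>?Y. if fst t = v then f t else 0) = (\<Sum>t\<in>Pair v ` {..<d v}. f t)"
      using that by (intro sum.mono_neutral_cong_right fY) auto
    then show ?thesis by (simp add: sum.reindex inj_on_def)
  qed
  have "(\<Sum>t\<in>?Y. G (tgt Q b, i) t * (\<Sum>t'\<in>?Y. H (src Q b, l) t' *
      (if fst t = tgt Q b \<and> fst t' = src Q b then W b (snd t) (snd t') else 0))) =
    (\<Sum>t\<in>?Y. if fst t = tgt Q b then G (tgt Q b, i) t * (\<Sum>t'\<in>?Y. if fst t' = src Q b then
      H (src Q b, l) t' * W b (snd t) (snd t') else 0) else 0)"
    by (rule sum.cong[OF refl]) (auto intro!: sum.cong arg_cong[where f = "\<lambda>x. _ * x"])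
  also have "\<dots> = two_sided Q d G H W b i l"
    using darcs_verts[OF Q b] by (simp add: S two_sided_def sum_distrib_left mult_ac)
  finally show ?thesis ..
qed

text \<open>The monomial is a product of T linear forms in H and likewise in G, so
  \<open>omega_prod\<close> applies twice. It leaves block permutations \<pi>, \<rho> and placements
  \<beta>, \<gamma> of the factors; for fixed placements the signed sum over \<pi> and \<rho> is a
  combination of determinants by \<open>block_perms_sum_det\<close>.\<close>

lemma omega_mono:
  assumes Q: "fin_digraph Q" and card: "card (brk Q d m) = T" "card (brk Q d N) = T"
    and b: "\<And>s. s < T \<Longrightarrow> bs s \<in> darcs Q"
  shows "(\<lambda>W. omegaQ Q d m (\<lambda>G. omegaQ Q d N (\<lambda>H. \<Prod>s<T. two_sided Q d G H W (bs s) (is s) (ls s))))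
    \<in> fun_space.span (range (block_poly Q d m N :: _ \<Rightarrow> _ \<Rightarrow> 'k::field))"
proof -
  let ?Y = "SIGMA v:verts Q. {..<d v}"
  let ?P = "{q. q permutes {..<T}}"
  let ?bR = "bblk Q d m" and ?tR = "bty Q d m" and ?bC = "bblk Q d N" and ?tC = "bty Q d N"
  let ?GR = "block_perms T ?bR" and ?GC = "block_perms T ?bC"
  define u where "u s = (tgt Q (bs s), is s)" for s
  define u' where "u' s = (src Q (bs s), ls s)" for s
  define w :: "(_ \<Rightarrow> nat \<Rightarrow> nat \<Rightarrow> 'k) \<Rightarrow> _" where "w W s t t' = (if fst t = tgt Q (bs s) \<and> fst t' = src Q (bs s) then W (bs s) (snd t) (snd t') else 0)" for W s t t'
  have fY: "finite ?Y" using Q by (simp add: fin_digraph.finite_verts)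
  have tyY: "bty Q d k ` {..<card (brk Q d k)} \<subseteq> ?Y" for k
  proof
    fix t assume "t \<in> bty Q d k ` {..<card (brk Q d k)}"
    then obtain r where "r < card (brk Q d k)" "t = bty Q d k r" by auto
    then show "t \<in> ?Y" using from_nat_into_mem[of r "brk Q d k"]
      by (auto simp: bty_def brk_def split: prod.splits)
  qed
  define D where "D W \<beta> \<gamma> = (\<Sum>\<pi>\<in>?GR. \<Sum>\<rho>\<in>?GC. of_int (sign \<pi>) * of_int (sign \<rho>) *
      (\<Prod>s<T. w W s (?tR (\<pi> (\<beta> s))) (?tC (\<rho> (\<gamma> s)))))" for W :: "_ \<Rightarrow> nat \<Rightarrow> nat \<Rightarrow> 'k" and \<beta> \<gamma>
  \<comment> \<open>A placement counts if row \<beta> s and column \<gamma> s have the types by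
    which G and H enter the factor s; all others contribute zero.\<close>
  define ok where "ok \<beta> \<gamma> \<longleftrightarrow> (\<forall>s<T. ?tR (\<beta> s) = u s \<and> ?tC (\<gamma> s) = u' s)" for \<beta> \<gamma>
  have 1: "omegaQ Q d N (\<lambda>H. \<Prod>s<T. two_sided Q d G H W (bs s) (is s) (ls s)) =
      (\<Sum>x\<in>?GC \<times> ?P. of_int (sign (fst x)) * (\<Prod>s<T. \<Sum>t\<in>?Y. G (u s) t *
         (if ?tC (snd x s) = u' s then w W s t (?tC (fst x (snd x s))) else 0)))" for G W
  proof -
    have "(\<lambda>H. \<Prod>s<T. two_sided Q d G H W (bs s) (is s) (ls s)) =
        (\<lambda>H. \<Prod>s<T. \<Sum>t'\<in>?Y. H (u' s) t' * (\<Sum>t\<in>?Y. G (u s) t * w W s t t'))"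
    proof (intro ext prod.cong refl)
      fix H s assume "s \<in> {..<T}"
      then have "two_sided Q d G H W (bs s) (is s) (ls s) =
          (\<Sum>t\<in>?Y. G (u s) t * (\<Sum>t'\<in>?Y. H (u' s) t' * w W s t t'))"
        using two_sided_alt[OF Q b] by (simp add: u_def u'_def w_def)
      also have "\<dots> = (\<Sum>t'\<in>?Y. H (u' s) t' * (\<Sum>t\<in>?Y. G (u s) t * w W s t t'))"
        unfolding sum_distrib_left by (subst sum.swap) (simp only: mult_ac)
      finally show "two_sided Q d G H W (bs s) (is s) (ls s) =
          (\<Sum>t'\<in>?Y. H (u' s) t' * (\<Sum>t\<in>?Y. G (u s) t * w W s t t'))" .
    qed
    then have "omegaQ Q d N (\<lambda>H. \<Prod>s<T. two_sided Q d G H W (bs s) (is s) (ls s)) =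
        (\<Sum>\<rho>\<in>?GC. of_int (sign \<rho>) * (\<Sum>\<gamma>\<in>?P. \<Prod>s<T. if ?tC (\<gamma> s) = u' s then
           (\<Sum>t\<in>?Y. G (u s) t * w W s t (?tC (\<rho> (\<gamma> s)))) else 0))"
      unfolding omegaQ_def card by (simp only:) (rule omega_prod[OF fY], use tyY[of N] card in simp)
    also have "\<dots> = (\<Sum>\<rho>\<in>?GC. \<Sum>\<gamma>\<in>?P. of_int (sign \<rho>) * (\<Prod>s<T. \<Sum>t\<in>?Y. G (u s) t *
        (if ?tC (\<gamma> s) = u' s then w W s t (?tC (\<rho> (\<gamma> s))) else 0)))"
      unfolding sum_distrib_left[of "of_int _"]
      by (intro sum.cong refl arg_cong[where f = "\<lambda>x. _ * x"] prod.cong) auto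
    finally show ?thesis unfolding sum.cartesian_product' fst_conv snd_conv .
  qed
  have 2: "omegaQ Q d m (\<lambda>G. omegaQ Q d N (\<lambda>H. \<Prod>s<T. two_sided Q d G H W (bs s) (is s) (ls s))) =
      (\<Sum>\<beta>\<in>?P. \<Sum>\<gamma>\<in>?P. if ok \<beta> \<gamma> then D W \<beta> \<gamma> else 0)" for W
  proof -
    have "omegaQ Q d m (\<lambda>G. omegaQ Q d N (\<lambda>H. \<Prod>s<T. two_sided Q d G H W (bs s) (is s) (ls s))) =
        (\<Sum>x\<in>?GC \<times> ?P. of_int (sign (fst x)) * (\<Sum>\<pi>\<in>?GR. of_int (sign \<pi>) * (\<Sum>\<beta>\<in>?P. \<Prod>s<T.
          if ?tR (\<beta> s) = u s then (if ?tC (snd x s) = u' s then w W s (?tR (\<pi> (\<beta> s))) (?tC (fst x (snd x s))) else 0) else 0)))"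
      unfolding 1 unfolding omegaQ_def card
      by (subst omega_linear, subst omega_prod[OF fY]) (use tyY[of m] card in simp_all)
    also have "\<dots> = (\<Sum>x\<in>?GC \<times> ?P. \<Sum>y\<in>?GR \<times> ?P. if ok (snd y) (snd x) then of_int (sign (fst y)) * of_int (sign (fst x)) *
          (\<Prod>s<T. w W s (?tR (fst y (snd y s))) (?tC (fst x (snd x s)))) else 0)"
    proof (rule sum.cong[OF refl])
      fix x :: "(nat \<Rightarrow> nat) \<times> (nat \<Rightarrow> nat)"
      have "of_int (sign (fst x)) * (of_int (sign (\<pi> :: nat \<Rightarrow> nat)) * (\<Prod>s<T.
          if ?tR (\<beta> s) = u s then (if ?tC (snd x s) = u' s then w W s (?tR (\<pi> (\<beta> s))) (?tC (fst x (snd x s))) else 0) else 0)) =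
          (if ok \<beta> (snd x) then of_int (sign \<pi>) * of_int (sign (fst x)) *
          (\<Prod>s<T. w W s (?tR (\<pi> (\<beta> s))) (?tC (fst x (snd x s)))) else 0)" for \<pi> \<beta>
      proof (cases "ok \<beta> (snd x)")
        case True
        then have "(\<Prod>s<T. if ?tR (\<beta> s) = u s then (if ?tC (snd x s) = u' s then w W s (?tR (\<pi> (\<beta> s))) (?tC (fst x (snd x s))) else 0) else 0) =
          (\<Prod>s<T. w W s (?tR (\<pi> (\<beta> s))) (?tC (fst x (snd x s))))"
          by (intro prod.cong) (auto simp: ok_def)
        then show ?thesis using True by (simp add: mult_ac)
      next
        case False
        then obtain s where "s < T" "\<not> (?tR (\<beta> s) = u s \<and> ?tC (snd x s) = u' s)" by (auto simp: ok_def)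
        then have "(\<Prod>s<T. if ?tR (\<beta> s) = u s then (if ?tC (snd x s) = u' s then w W s (?tR (\<pi> (\<beta> s))) (?tC (fst x (snd x s))) else 0) else 0) = 0"
          by (intro prod_zero) (auto intro!: bexI[of _ s])
        then show ?thesis using False by (simp only: if_False mult_zero_right)
      qed
      then show "of_int (sign (fst x)) * (\<Sum>\<pi>\<in>?GR. of_int (sign \<pi>) * (\<Sum>\<beta>\<in>?P. \<Prod>s<T.
          if ?tR (\<beta> s) = u s then (if ?tC (snd x s) = u' s then w W s (?tR (\<pi> (\<beta> s))) (?tC (fst x (snd x s))) else 0) else 0)) =
        (\<Sum>y\<in>?GR \<times> ?P. if ok (snd y) (snd x) then of_int (sign (fst y)) * of_int (sign (fst x)) *
          (\<Prod>s<T. w W s (?tR (fst y (snd y s))) (?tC (fst x (snd x s)))) else 0)"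
        unfolding sum.cartesian_product' fst_conv snd_conv sum_distrib_left by (simp only:)
    qed
    also have "\<dots> = (\<Sum>\<rho>\<in>?GC. \<Sum>\<gamma>\<in>?P. \<Sum>\<pi>\<in>?GR. \<Sum>\<beta>\<in>?P. if ok \<beta> \<gamma> then of_int (sign \<pi>) * of_int (sign \<rho>) *
          (\<Prod>s<T. w W s (?tR (\<pi> (\<beta> s))) (?tC (\<rho> (\<gamma> s)))) else 0)"
      unfolding sum.cartesian_product' fst_conv snd_conv ..
    also have "\<dots> = (\<Sum>\<gamma>\<in>?P. \<Sum>\<rho>\<in>?GC. \<Sum>\<beta>\<in>?P. \<Sum>\<pi>\<in>?GR. if ok \<beta> \<gamma> then of_int (sign \<pi>) * of_int (sign \<rho>) *
          (\<Prod>s<T. w W s (?tR (\<pi> (\<beta> s))) (?tC (\<rho> (\<gamma> s)))) else 0)"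
      by (subst sum.swap) (rule sum.cong[OF refl], rule sum.cong[OF refl], rule sum.swap)
    also have "\<dots> = (\<Sum>\<gamma>\<in>?P. \<Sum>\<beta>\<in>?P. \<Sum>\<pi>\<in>?GR. \<Sum>\<rho>\<in>?GC. if ok \<beta> \<gamma> then of_int (sign \<pi>) * of_int (sign \<rho>) *
          (\<Prod>s<T. w W s (?tR (\<pi> (\<beta> s))) (?tC (\<rho> (\<gamma> s)))) else 0)"
      by (rule sum.cong[OF refl], subst sum.swap, rule sum.cong[OF refl], rule sum.swap)
    also have "\<dots> = (\<Sum>\<beta>\<in>?P. \<Sum>\<gamma>\<in>?P. if ok \<beta> \<gamma> then D W \<beta> \<gamma> else 0)"
      by (subst sum.swap) (intro sum.cong refl, simp add: D_def)
    finally show ?thesis .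
  qed
  have 3: "(\<lambda>W. D W \<beta> \<gamma>) \<in> fun_space.span (range (block_poly Q d m N))"
    if \<beta>: "\<beta> permutes {..<T}" and \<gamma>: "\<gamma> permutes {..<T}" for \<beta> \<gamma>
  proof -
    \<comment> \<open>The coefficient counts the factors s in S that carry the arrow b and are
      placed in the row block j at its target and the column block k at its source.\<close>
    define x :: "nat set \<Rightarrow> 'a + 'b \<Rightarrow> nat \<Rightarrow> nat \<Rightarrow> 'k" where
      "x S b k j = (\<Sum>s\<in>S. if bs s = b \<and> ?bR (\<beta> s) = (tgt Q b, j) \<and> ?bC (\<gamma> s) = (src Q b, k) then 1 else 0)" for S b k j
    have "det (mat T T (\<lambda>(r, c). \<Sum>s\<in>S. if ?bR r = ?bR (\<beta> s) \<and> ?bC c = ?bC (\<gamma> s) then w W s (?tR r) (?tC c) else 0)) =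
        block_poly Q d m N (x S) W" if S: "S \<subseteq> {..<T}" for S W
      unfolding block_poly_def detI_def card
    proof (intro arg_cong[where f = det] eq_matI, goal_cases)
      case (1 r c)
      obtain w' j i where R: "from_nat_into (brk Q d m) r = (w', j, i)" by (metis prod_cases3)
      obtain v k l where C: "from_nat_into (brk Q d N) c = (v, k, l)" by (metis prod_cases3)
      have fin: "finite {b \<in> darcs Q. src Q b = v \<and> tgt Q b = w'}" using finite_darcs[OF Q] by simp
      have "(\<Sum>b | b \<in> darcs Q \<and> src Q b = v \<and> tgt Q b = w'. x S b k j * W b i l) =
          (\<Sum>s\<in>S. \<Sum>b | b \<in> darcs Q \<and> src Q b = v \<and> tgt Q b = w'.
            if b = bs s then (if ?bR (\<beta> s) = (tgt Q b, j) \<and> ?bC (\<gamma> s) = (src Q b, k) then W b i l else 0) else 0)"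
        unfolding x_def sum_distrib_right by (subst sum.swap) (intro sum.cong refl, auto)
      also have "\<dots> = (\<Sum>s\<in>S. if (w', j) = ?bR (\<beta> s) \<and> (v, k) = ?bC (\<gamma> s) then w W s (w', i) (v, l) else 0)"
        using S b by (intro sum.cong refl, subst sum.delta[OF fin]) (auto simp: w_def)
      finally show ?case using 1 R C
        by (simp add: bblk_def[of Q d m r] bty_def[of Q d m r] bblk_def[of Q d N c] bty_def[of Q d N c] cong: if_cong)
    qed auto
    then have "(\<lambda>W. D W \<beta> \<gamma>) = (\<lambda>W. of_int (sign \<beta>) * of_int (sign \<gamma>) *
        (\<Sum>S\<in>Pow {..<T}. (- 1) ^ (T - card S) * block_poly Q d m N (x S) W))"
      unfolding D_def using block_perms_sum_det[OF \<beta> \<gamma>, where w = "\<lambda>s r c. w _ s (?tR r) (?tC c)"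
        and blk = ?bR and blk' = ?bC]
      by (simp add: fun_eq_iff)
    then show ?thesis
      by (simp only:) (intro span_scale span_sum fun_space.span_base rangeI)
  qed
  show ?thesis
    unfolding 2
  proof (intro span_sum)
    fix \<beta> \<gamma> assume "\<beta> \<in> ?P" "\<gamma> \<in> ?P"
    then show "(\<lambda>W. if ok \<beta> \<gamma> then D W \<beta> \<gamma> else 0) \<in> fun_space.span (range (block_poly Q d m N))"
      using 3[of \<beta> \<gamma>] fun_space.span_zero by (cases "ok \<beta> \<gamma>") (auto simp: zero_fun_def)
  qed
qed

lemma omega_add: "omega T blk ty (\<lambda>G. c * \<Phi> G + \<Psi> G) = c * omega T blk ty \<Phi> + omega T blk ty \<Psi>"
  unfolding omega_def by (simp add: algebra_simps sum.distrib sum_distrib_left)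

lemma omega_span_arrow_monos:
  assumes Q: "fin_digraph Q" and card: "card (brk Q d m) = T" "card (brk Q d N) = T"
    and F: "F \<in> fun_space.span (arrow_monos Q d T)"
  shows "(\<lambda>W. omegaQ Q d m (\<lambda>G. omegaQ Q d N (\<lambda>H. F (two_sided Q d G H W))))
    \<in> fun_space.span (range (block_poly Q d m N :: _ \<Rightarrow> _ \<Rightarrow> 'k::field))"
  using F
proof (induction F rule: fun_space.span_induct_alt)
  case base
  have "omega T' blk ty (\<lambda>G. 0) = (0::'k)" for T' and blk :: "nat \<Rightarrow> 'a \<times> nat" and ty :: "nat \<Rightarrow> 'a \<times> nat"
    by (simp add: omega_def)
  then show ?case using fun_space.span_zero by (auto simp: omegaQ_def zero_fun_def)
next
  case (step c f F)
  then obtain bs "is" ls where f: "f = (\<lambda>W. \<Prod>s<T. W (bs s) (is s) (ls s))"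
    and b: "\<And>s. s < T \<Longrightarrow> bs s \<in> darcs Q" by (auto simp: arrow_monos_def)
  have "(\<lambda>W. omegaQ Q d m (\<lambda>G. omegaQ Q d N (\<lambda>H. f (two_sided Q d G H W))))
      \<in> fun_space.span (range (block_poly Q d m N))"
    unfolding f by (rule omega_mono[OF Q card b])
  from fun_space.span_add[OF fun_space.span_scale[OF this] step.IH, of c] show ?case
    by (simp add: omegaQ_def omega_add plus_fun_def)
qed

section \<open>Polynomial functions\<close>

definition is_poly :: "('k::field \<Rightarrow> 'k) \<Rightarrow> bool" where
  "is_poly f \<longleftrightarrow> (\<exists>q. \<forall>t. f t = poly q t)"

lemma is_poly_const [simp]: "is_poly (\<lambda>t. c)"
  unfolding is_poly_def by (rule exI[of _ "[:c:]"]) simp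

lemma is_poly_id [simp]: "is_poly (\<lambda>t. t)"
  unfolding is_poly_def by (rule exI[of _ "[:0, 1:]"]) simp

lemma is_poly_add: "is_poly f \<Longrightarrow> is_poly g \<Longrightarrow> is_poly (\<lambda>t. f t + g t)"
  unfolding is_poly_def by (metis poly_add)

lemma is_poly_mult: "is_poly f \<Longrightarrow> is_poly g \<Longrightarrow> is_poly (\<lambda>t. f t * g t)"
  unfolding is_poly_def by (metis poly_mult)

lemma is_poly_diff: "is_poly f \<Longrightarrow> is_poly g \<Longrightarrow> is_poly (\<lambda>t. f t - g t)"
  unfolding is_poly_def by (metis poly_diff)

lemma is_poly_sum: "(\<And>i. i \<in> I \<Longrightarrow> is_poly (f i)) \<Longrightarrow> is_poly (\<lambda>t. \<Sum>i\<in>I. f i t)"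
  by (induction I rule: infinite_finite_induct) (simp_all add: is_poly_add)

lemma is_poly_prod: "(\<And>i. i \<in> I \<Longrightarrow> is_poly (f i)) \<Longrightarrow> is_poly (\<lambda>t. \<Prod>i\<in>I. f i t)"
  by (induction I rule: infinite_finite_induct) (simp_all add: is_poly_mult)

lemma is_poly_power: "is_poly f \<Longrightarrow> is_poly (\<lambda>t. f t ^ n)"
  by (induction n) (simp_all add: is_poly_mult)

lemma permutes_lessThan: "p permutes {..<n} \<Longrightarrow> i < n \<Longrightarrow> p i < n"
  using permutes_in_image[of p "{..<n}" i] by simp

lemma is_poly_det:
  assumes "\<And>i j. i < n \<Longrightarrow> j < n \<Longrightarrow> is_poly (\<lambda>t. A t i j)"
  shows "is_poly (\<lambda>t. det (mat n n (\<lambda>(i, j). A t i j)))"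
  unfolding det_sdet sdet_def
  by (intro is_poly_sum is_poly_mult is_poly_prod is_poly_const assms)
    (auto simp: permutes_lessThan)

lemma is_poly_zero:
  fixes f :: "'k::field_char_0 \<Rightarrow> 'k"
  assumes "is_poly f" "finite B" "\<And>t. t \<notin> B \<Longrightarrow> f t = 0"
  shows "f t = 0"
proof -
  obtain q where q: "\<And>t. f t = poly q t" using assms(1) by (auto simp: is_poly_def)
  have "infinite (- B)" using assms(2) infinite_UNIV_char_0 by (simp add: finite_compl)
  then have "\<not> finite {t. poly q t = 0}"
    using assms(3) q by (metis (mono_tags, lifting) ComplD finite_subset mem_Collect_eq subsetI)
  then have "q = 0" using poly_roots_finite by blast
  then show ?thesis using q by simp
qed

text \<open>The determinant of A + t is the characteristic polynomial of - A at t, which is monic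
  and therefore nonzero. So adding scalars makes a matrix invertible outside finitely many
  parameters.\<close>

lemma finite_det_shift_zeros:
  fixes A :: "'k::field mat"
  assumes A: "A \<in> carrier_mat n n"
  shows "finite {t. det (mat n n (\<lambda>(i, j). A $$ (i, j) + (if i = j then t else 0))) = 0}"
proof -
  let ?p = "char_poly (- A)"
  have "poly ?p t = det (mat n n (\<lambda>(i, j). A $$ (i, j) + (if i = j then t else 0)))" for t
  proof -
    have "poly ?p t = det (- char_matrix (- A) t)" by (rule char_poly_matrix[of _ n]) (use A in auto)
    also have "- char_matrix (- A) t = mat n n (\<lambda>(i, j). A $$ (i, j) + (if i = j then t else 0))"
      using A by (intro eq_matI) (auto simp: char_matrix_def)
    finally show ?thesis .
  qed
  moreover have "?p \<noteq> 0"
    using degree_monic_char_poly[of "- A" n] A by auto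
  ultimately show ?thesis using poly_roots_finite[of ?p] by simp
qed

lemma lagrange_interpolation:
  fixes q :: "'k::field poly"
  assumes "finite S" "degree q < card S"
  shows "poly q t = (\<Sum>s\<in>S. (\<Prod>r\<in>S - {s}. (t - r) / (s - r)) * poly q s)"
proof -
  define l where "l s = (\<Prod>r\<in>S - {s}. smult (inverse (s - r)) [:- r, 1:])" for s
  define L where "L = (\<Sum>s\<in>S. smult (poly q s) (l s))"
  have l: "poly (l s) t = (\<Prod>r\<in>S - {s}. (t - r) / (s - r))" for s t
    by (simp add: l_def poly_prod divide_inverse algebra_simps)
  have l1: "poly (l s) s' = (if s' = s then 1 else 0)" if "s \<in> S" "s' \<in> S" for s s'
    using that assms(1) by (auto simp: l intro!: prod.neutral)
  have dl: "degree (l s) \<le> card S - 1" if "s \<in> S" for s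
  proof -
    have "degree (l s) \<le> (\<Sum>r\<in>S - {s}. degree (smult (inverse (s - r)) [:- r, 1:]))"
      unfolding l_def by (rule degree_prod_sum_le[unfolded o_def]) (use assms in auto)
    also have "\<dots> \<le> (\<Sum>r\<in>S - {s}. 1)" by (rule sum_mono) auto
    finally show ?thesis using that assms(1) by simp
  qed
  have "degree L \<le> card S - 1"
    unfolding L_def using dl by (intro degree_sum_le assms) (auto intro: order_trans[OF degree_smult_le])
  then have deg: "degree (q - L) < card S"
    using assms(2) by (intro degree_diff_less) auto
  have "q - L = 0"
  proof (rule ccontr)
    assume "q - L \<noteq> 0"
    moreover have "S \<subseteq> {x. poly (q - L) x = 0}"
    proof
      fix x assume x: "x \<in> S"
      have "poly L x = (\<Sum>s\<in>S. if s = x then poly q s else 0)"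
        unfolding L_def poly_sum using x by (intro sum.cong refl) (auto simp: l1)
      then show "x \<in> {x. poly (q - L) x = 0}" using x assms(1) by simp
    qed
    ultimately have "card S \<le> degree (q - L)"
      using card_poly_roots_bound[of "q - L"] poly_roots_finite[of "q - L"]
      by (meson card_mono order_trans)
    then show False using deg by simp
  qed
  then have "poly q t = poly L t" by simp
  then show ?thesis by (simp add: L_def poly_sum l mult.commute)
qed

text \<open>The bound D is uniform in x, so the same D + 1 nodes outside B and the same Lagrange
  coefficients work for all x. This is how spans pass from generic parameters to arbitrary
  ones.\<close>

lemma interpolation_in_span:
  fixes f :: "'k::field_char_0 \<Rightarrow> 'x \<Rightarrow> 'k"
  assumes "\<And>x. \<exists>q. degree q \<le> D \<and> (\<forall>t. f t x = poly q t)" and "finite B"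
  shows "f t0 \<in> fun_space.span {f t | t. t \<notin> B}"
proof -
  have "infinite (- B)" using assms(2) infinite_UNIV_char_0 by (simp add: finite_compl)
  then obtain S where S: "S \<subseteq> - B" "finite S" "card S = Suc D"
    using infinite_arbitrarily_large by metis
  have "f t0 = (\<lambda>x. \<Sum>s\<in>S. (\<Prod>r\<in>S - {s}. (t0 - r) / (s - r)) * f s x)"
  proof
    fix x
    obtain q where "degree q \<le> D" "\<And>t. f t x = poly q t" using assms(1) by blast
    then show "f t0 x = (\<Sum>s\<in>S. (\<Prod>r\<in>S - {s}. (t0 - r) / (s - r)) * f s x)"
      using lagrange_interpolation[OF S(2), of q t0] S(3) by simp
  qed
  moreover have "(\<lambda>x. \<Sum>s\<in>S. (\<Prod>r\<in>S - {s}. (t0 - r) / (s - r)) * f s x) \<in> fun_space.span {f t | t. t \<notin> B}"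
    using S(1) by (intro span_sum span_scale fun_space.span_base) auto
  ultimately show ?thesis by simp
qed

lemma span_image_comp:
  assumes "f \<in> fun_space.span B"
    and "\<And>b. b \<in> B \<Longrightarrow> restr Z (\<lambda>x. b (\<phi> x)) \<in> fun_space.span (B' :: ('x \<Rightarrow> 'k::field) set)"
  shows "restr Z (\<lambda>x. f (\<phi> x)) \<in> fun_space.span B'"
  using assms(1)
proof (induction f rule: fun_space.span_induct_alt)
  case base
  have "restr Z (\<lambda>x. (0 :: _ \<Rightarrow> 'k) (\<phi> x)) = 0" by (auto simp: restr_def fun_eq_iff)
  then show ?case using fun_space.span_zero by (simp only:)
next
  case (step c f g)
  have "restr Z (\<lambda>x. ((\<lambda>x. c * f x) + g) (\<phi> x)) =
      (\<lambda>x. c * restr Z (\<lambda>x. f (\<phi> x)) x) + restr Z (\<lambda>x. g (\<phi> x))"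
    by (auto simp: restr_def fun_eq_iff)
  then show ?case
    using fun_space.span_add[OF fun_space.span_scale[OF assms(2)[OF step(1)], of c] step(2)]
    by (simp only:)
qed

section \<open>Degree filtration of the coordinate ring\<close>

inductive poly_le ::
    "('v, 'a) pre_digraph \<Rightarrow> ('v \<Rightarrow> nat) \<Rightarrow> nat \<Rightarrow> (('a, 'k::field) qrep \<Rightarrow> 'k) \<Rightarrow> bool"
  for Q d where
  const: "poly_le Q d k (\<lambda>M. c)"
| coord: "\<lbrakk>a \<in> arcs Q; i < d (head Q a); j < d (tail Q a)\<rbrakk> \<Longrightarrow> poly_le Q d (Suc k) (\<lambda>M. M a $$ (i, j))"
| add: "\<lbrakk>poly_le Q d k f; poly_le Q d k g\<rbrakk> \<Longrightarrow> poly_le Q d k (\<lambda>M. f M + g M)"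
| mult: "\<lbrakk>poly_le Q d k f; poly_le Q d l g\<rbrakk> \<Longrightarrow> poly_le Q d (k + l) (\<lambda>M. f M * g M)"

lemma poly_le_mono: "poly_le Q d k f \<Longrightarrow> k \<le> l \<Longrightarrow> poly_le Q d l f"
  using poly_le.mult[OF _ poly_le.const[of Q d "l - k" 1], of k f] by simp

lemma poly_le_imp_poly_funs: "poly_le Q d k f \<Longrightarrow> f \<in> poly_funs Q d"
proof (induction rule: poly_le.induct)
  case (add k f g)
  then show ?case using poly_funs.add[of f Q d g] by (simp add: plus_fun_def)
next
  case (mult k f l g)
  then show ?case using poly_funs.mult[of f Q d g] by (simp add: times_fun_def)
qed (auto intro: poly_funs.intros)

lemma poly_funs_imp_poly_le: "f \<in> poly_funs Q d \<Longrightarrow> \<exists>k. poly_le Q d k f"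
proof (induction rule: poly_funs.induct)
  case (add f g)
  then obtain k l where "poly_le Q d k f" "poly_le Q d l g" by blast
  then have "poly_le Q d (max k l) f" "poly_le Q d (max k l) g" by (auto elim: poly_le_mono)
  then show ?case using poly_le.add[of Q d _ f g] by (auto simp: plus_fun_def)
next
  case (mult f g)
  then show ?case using poly_le.mult[of Q d _ f _ g] by (auto simp: times_fun_def)
qed (auto intro: poly_le.intros)

lemma poly_le_sum:
  "(\<And>i. i \<in> I \<Longrightarrow> poly_le Q d k (f i)) \<Longrightarrow> poly_le Q d k (\<lambda>M. \<Sum>i\<in>I. f i M)"
  by (induction I rule: infinite_finite_induct) (simp_all add: poly_le.const poly_le.add)

lemma poly_le_cmult: "poly_le Q d k f \<Longrightarrow> poly_le Q d k (\<lambda>M. c * f M)"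
  using poly_le.mult[OF poly_le.const[of Q d 0 c], of k f] by simp

lemma poly_le_prod:
  "finite I \<Longrightarrow> (\<And>i. i \<in> I \<Longrightarrow> poly_le Q d k (f i)) \<Longrightarrow> poly_le Q d (card I * k) (\<lambda>M. \<Prod>i\<in>I. f i M)"
proof (induction I rule: finite_induct)
  case (insert i I)
  then have "poly_le Q d (k + card I * k) (\<lambda>M. f i M * (\<Prod>i\<in>I. f i M))"
    by (intro poly_le.mult) auto
  then show ?case using insert by simp
qed (simp add: poly_le.const)

lemma poly_le_det:
  assumes "\<And>i j. i < n \<Longrightarrow> j < n \<Longrightarrow> poly_le Q d 1 (\<lambda>M. A M i j)"
  shows "poly_le Q d n (\<lambda>M. det (mat n n (\<lambda>(i, j). A M i j)))"
  unfolding det_sdet sdet_def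
proof (intro poly_le_sum poly_le_cmult)
  fix p assume "p \<in> {p. p permutes {..<n}}"
  then have "poly_le Q d (card {..<n} * 1) (\<lambda>M. \<Prod>i<n. A M i (p i))"
    using assms by (intro poly_le_prod) (auto simp: permutes_lessThan)
  then show "poly_le Q d n (\<lambda>M. \<Prod>i<n. A M i (p i))" by simp
qed

lemma poly_le_curve:
  assumes "poly_le Q d k f"
    and "\<And>a i j. a \<in> arcs Q \<Longrightarrow> i < d (head Q a) \<Longrightarrow> j < d (tail Q a) \<Longrightarrow>
      \<exists>p. degree p \<le> e \<and> (\<forall>t. M t a $$ (i, j) = poly p t)"
  shows "\<exists>q. degree q \<le> k * e \<and> (\<forall>t. f (M t) = poly q t)"
  using assms(1)
proof (induction rule: poly_le.induct)
  case (const k c)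
  show ?case by (rule exI[of _ "[:c:]"]) simp
next
  case (coord a i j k)
  then show ?case using assms(2) by (metis le_add1 mult_Suc order_trans)
next
  case (add k f g)
  then obtain p q where "degree p \<le> k * e" "degree q \<le> k * e"
    "\<And>t. f (M t) = poly p t" "\<And>t. g (M t) = poly q t" by blast
  then show ?case by (intro exI[of _ "p + q"]) (simp add: degree_add_le)
next
  case (mult k f l g)
  then obtain p q where "degree p \<le> k * e" "degree q \<le> l * e"
    "\<And>t. f (M t) = poly p t" "\<And>t. g (M t) = poly q t" by blast
  then show ?case
    using degree_mult_le[of p q] by (intro exI[of _ "p * q"]) (simp add: add_mult_distrib)
qed

definition scale_rep :: "('v, 'a) pre_digraph \<Rightarrow> 'k \<Rightarrow> ('a, 'k::field) qrep \<Rightarrow> ('a, 'k) qrep" where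
  "scale_rep Q t M = (\<lambda>a\<in>arcs Q. t \<cdot>\<^sub>m M a)"

text \<open>The k-th coefficient of f along t M is the homogeneous part of f of degree k. The
  polynomial p M is constructed along the derivation of \<open>poly_le\<close>, because its
  coefficients have to be polynomial in M.\<close>

lemma poly_le_homogeneous_parts:
  assumes "poly_le Q d n f"
  shows "\<exists>p. (\<forall>k. poly_le Q d k (\<lambda>M. coeff (p M) k)) \<and>
    (\<forall>M\<in>rep_space Q d. \<forall>t. f (scale_rep Q t M) = poly (p M) t)"
  using assms
proof (induction rule: poly_le.induct)
  case (const k c)
  show ?case
    by (rule exI[of _ "\<lambda>M. [:c:]"], intro conjI allI ballI, rule poly_le.const) simp
next
  case (coord a i j k)
  have 1: "poly_le Q d k (\<lambda>M. coeff [:0, M a $$ (i, j):] k)" for k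
  proof (cases k)
    case 0
    show ?thesis unfolding 0 coeff_pCons_0 by (rule poly_le.const)
  next
    case (Suc l)
    show ?thesis
    proof (cases l)
      case 0
      show ?thesis unfolding Suc 0 coeff_pCons_Suc coeff_pCons_0 by (rule poly_le.coord[OF coord])
    next
      case (Suc l')
      show ?thesis unfolding \<open>k = Suc l\<close> Suc coeff_pCons_Suc coeff_0 by (rule poly_le.const)
    qed
  qed
  have 2: "scale_rep Q t M a $$ (i, j) = poly [:0, M a $$ (i, j):] t" if "M \<in> rep_space Q d" for M t
  proof -
    have "M a \<in> carrier_mat (d (head Q a)) (d (tail Q a))"
      using that coord unfolding rep_space_def by (auto simp: PiE_iff)
    then show ?thesis using coord by (simp add: scale_rep_def)
  qed
  show ?case
    by (rule exI[of _ "\<lambda>M. [:0, M a $$ (i, j):]"], intro conjI allI ballI, rule 1, rule 2)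
next
  case (add k f g)
  obtain p where p: "\<And>k. poly_le Q d k (\<lambda>M. coeff (p M) k)"
    "\<And>M t. M \<in> rep_space Q d \<Longrightarrow> f (scale_rep Q t M) = poly (p M) t" using add.IH(1) by (elim exE conjE) (rule that; simp)
  obtain q where q: "\<And>k. poly_le Q d k (\<lambda>M. coeff (q M) k)"
    "\<And>M t. M \<in> rep_space Q d \<Longrightarrow> g (scale_rep Q t M) = poly (q M) t" using add.IH(2) by (elim exE conjE) (rule that; simp)
  have 1: "poly_le Q d k (\<lambda>M. coeff (p M + q M) k)" for k
    unfolding coeff_add by (rule poly_le.add[OF p(1) q(1)])
  show ?case
    by (rule exI[of _ "\<lambda>M. p M + q M"], intro conjI allI ballI, rule 1) (simp add: p(2) q(2))
next
  case (mult k f l g)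
  obtain p where p: "\<And>k. poly_le Q d k (\<lambda>M. coeff (p M) k)"
    "\<And>M t. M \<in> rep_space Q d \<Longrightarrow> f (scale_rep Q t M) = poly (p M) t" using mult.IH(1) by (elim exE conjE) (rule that; simp)
  obtain q where q: "\<And>k. poly_le Q d k (\<lambda>M. coeff (q M) k)"
    "\<And>M t. M \<in> rep_space Q d \<Longrightarrow> g (scale_rep Q t M) = poly (q M) t" using mult.IH(2) by (elim exE conjE) (rule that; simp)
  have 1: "poly_le Q d k (\<lambda>M. coeff (p M * q M) k)" for k
    unfolding coeff_mult
  proof (rule poly_le_sum)
    fix i assume "i \<in> {..k}"
    then have "i + (k - i) = k" by simp
    then show "poly_le Q d k (\<lambda>M. coeff (p M) i * coeff (q M) (k - i))"
      using poly_le.mult[OF p(1)[of i] q(1)[of "k - i"]] by (simp only:)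
  qed
  show ?case
    by (rule exI[of _ "\<lambda>M. p M * q M"], intro conjI allI ballI, rule 1) (simp add: p(2) q(2))
qed

section \<open>Homogenization on the double quiver\<close>

abbreviation arrow_forms ::
    "('v, 'a) pre_digraph \<Rightarrow> ('v \<Rightarrow> nat) \<Rightarrow> nat \<Rightarrow> (('v + 'a \<Rightarrow> nat \<Rightarrow> nat \<Rightarrow> 'k::field) \<Rightarrow> 'k) set" where
  "arrow_forms Q d T \<equiv> fun_space.span (arrow_monos Q d T)"

lemma arrow_monosI:
  assumes "\<And>s. s < T \<Longrightarrow> bs s \<in> darcs Q \<and> is s < d (tgt Q (bs s)) \<and> ls s < d (src Q (bs s))"
  shows "(\<lambda>W. \<Prod>s<T. W (bs s) (is s) (ls s)) \<in> arrow_monos Q d T"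
  unfolding arrow_monos_def mem_Collect_eq using assms by (intro exI conjI) (rule refl, simp)

lemma prod_lessThan_add: "(\<Prod>s<k + l. h s) = (\<Prod>s<k. h s) * (\<Prod>s<l. h (k + s :: nat) :: 'k::comm_monoid_mult)"
  by (induction l) (simp_all add: mult_ac)

lemma arrow_monos_mult:
  assumes "f \<in> arrow_monos Q d k" "g \<in> arrow_monos Q d l"
  shows "(\<lambda>W. f W * g W) \<in> arrow_monos Q d (k + l)"
proof -
  obtain bs "is" ls where f: "f = (\<lambda>W. \<Prod>s<k. W (bs s) (is s) (ls s))"
    and 1: "\<And>s. s < k \<Longrightarrow> bs s \<in> darcs Q \<and> is s < d (tgt Q (bs s)) \<and> ls s < d (src Q (bs s))"
    using assms(1) by (auto simp: arrow_monos_def)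
  obtain bs' is' ls' where g: "g = (\<lambda>W. \<Prod>s<l. W (bs' s) (is' s) (ls' s))"
    and 2: "\<And>s. s < l \<Longrightarrow> bs' s \<in> darcs Q \<and> is' s < d (tgt Q (bs' s)) \<and> ls' s < d (src Q (bs' s))"
    using assms(2) by (auto simp: arrow_monos_def)
  let ?c = "\<lambda>x y s. if s < k then x s else y (s - k)"
  have "(\<lambda>W. f W * g W) = (\<lambda>W. \<Prod>s<k + l. W (?c bs bs' s) (?c is is' s) (?c ls ls' s))"
    by (simp add: f g prod_lessThan_add)
  moreover have "(\<lambda>W. \<Prod>s<k + l. W (?c bs bs' s) (?c is is' s) (?c ls ls' s)) \<in> arrow_monos Q d (k + l)"
    by (rule arrow_monosI) (use 1 2 in auto)
  ultimately show ?thesis by simp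
qed

lemma span_zero_fun: "(\<lambda>x. 0) \<in> fun_space.span B"
  using fun_space.span_zero[of B] unfolding zero_fun_def .

lemma span_mult:
  assumes f: "f \<in> fun_space.span A" and g: "g \<in> fun_space.span B"
    and AB: "\<And>a b. a \<in> A \<Longrightarrow> b \<in> B \<Longrightarrow> (\<lambda>x. a x * b x) \<in> fun_space.span (C :: ('x \<Rightarrow> 'k::field) set)"
  shows "(\<lambda>x. f x * g x) \<in> fun_space.span C"
  using f
proof (induction f rule: fun_space.span_induct_alt)
  case base
  show ?case using span_zero_fun by (simp only: zero_fun_apply mult_zero_left)
next
  case (step c a f)
  have "(\<lambda>x. a x * g x) \<in> fun_space.span C"
    using g
  proof (induction g rule: fun_space.span_induct_alt)
    case base
    show ?case using span_zero_fun by (simp only: zero_fun_apply mult_zero_right)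
  next
    case (step c' b g)
    have "(\<lambda>x. a x * ((\<lambda>x. c' * b x) + g) x) = (\<lambda>x. c' * (a x * b x)) + (\<lambda>x. a x * g x)"
      by (rule ext) (simp add: algebra_simps)
    then show ?case
      using fun_space.span_add[OF fun_space.span_scale[OF AB[OF \<open>a \<in> A\<close> step(1)], of c'] step(2)]
      by (simp only:)
  qed
  note a = this
  have "(\<lambda>x. ((\<lambda>x. c * a x) + f) x * g x) = (\<lambda>x. c * (a x * g x)) + (\<lambda>x. f x * g x)"
    by (rule ext) (simp add: algebra_simps)
  then show ?case
    using fun_space.span_add[OF fun_space.span_scale[OF a, of c] step(2)] by (simp only:)
qed

lemma arrow_forms_mult:
  assumes "f \<in> arrow_forms Q d k" "g \<in> arrow_forms Q d l"
  shows "(\<lambda>W. f W * g W) \<in> arrow_forms Q d (k + l)"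
  by (rule span_mult[OF assms]) (rule fun_space.span_base[OF arrow_monos_mult])

lemma arrow_forms_one: "(\<lambda>W. 1) \<in> arrow_forms Q d 0"
  by (rule fun_space.span_base) (auto simp: arrow_monos_def)

lemma arrow_forms_prod:
  assumes "finite I" "\<And>i. i \<in> I \<Longrightarrow> f i \<in> arrow_forms Q d (n i)"
  shows "(\<lambda>W. \<Prod>i\<in>I. f i W) \<in> arrow_forms Q d (\<Sum>i\<in>I. n i)"
  using assms by (induction I rule: finite_induct) (auto simp: arrow_forms_one arrow_forms_mult)

lemma arrow_forms_power:
  "f \<in> arrow_forms Q d n \<Longrightarrow> (\<lambda>W. f W ^ k) \<in> arrow_forms Q d (k * n)"
  by (induction k) (auto simp: arrow_forms_one arrow_forms_mult)

lemma arrow_forms_det: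
  assumes "\<And>r c. r < n \<Longrightarrow> c < n \<Longrightarrow> B r c \<in> darcs Q \<and> I r c < d (tgt Q (B r c)) \<and> L r c < d (src Q (B r c))"
  shows "(\<lambda>W. det (mat n n (\<lambda>(r, c). W (B r c) (I r c) (L r c)))) \<in> arrow_forms Q d n"
  unfolding det_sdet sdet_def
proof (intro span_sum span_scale fun_space.span_base)
  fix p assume "p \<in> {p. p permutes {..<n}}"
  then have "p r < n" if "r < n" for r using that by (simp add: permutes_lessThan)
  then show "(\<lambda>W. \<Prod>r<n. W (B r (p r)) (I r (p r)) (L r (p r))) \<in> arrow_monos Q d n"
    using assms by (intro arrow_monosI) simp
qed

definition vmat :: "('v \<Rightarrow> nat) \<Rightarrow> ('v + 'a \<Rightarrow> nat \<Rightarrow> nat \<Rightarrow> 'k) \<Rightarrow> 'v \<Rightarrow> 'k mat" where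
  "vmat d W v = mat (d v) (d v) (\<lambda>(i, j). W (Inl v) i j)"

definition amat :: "('v, 'a) pre_digraph \<Rightarrow> ('v \<Rightarrow> nat) \<Rightarrow> ('v + 'a \<Rightarrow> nat \<Rightarrow> nat \<Rightarrow> 'k) \<Rightarrow> 'a \<Rightarrow> 'k mat" where
  "amat Q d W a = mat (d (head Q a)) (d (tail Q a)) (\<lambda>(i, j). W (Inr a) i j)"

lemma vmat_carrier [simp]: "vmat d W v \<in> carrier_mat (d v) (d v)"
  by (simp add: vmat_def)

lemma vmat_prod_form:
  assumes "fin_digraph Q"
  shows "(\<lambda>W. \<Prod>v\<in>verts Q. det (vmat d W v) ^ m v) \<in> arrow_forms Q d (\<Sum>v\<in>verts Q. m v * d v)"
  unfolding vmat_def
  by (intro arrow_forms_prod arrow_forms_power arrow_forms_det)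
    (use assms in \<open>auto simp: darcs_def fin_digraph.finite_verts\<close>)

text \<open>
  \<open>F(Y\<^sup>-\<^sup>1X)\<close> becomes polynomial in \<open>W = (Y, X)\<close> after multiplication by powers of the
  determinants; the entries of \<open>adj(Y)X\<close> are given by Cramer's rule.
\<close>

lemma homogenization:
  assumes Q: "fin_digraph Q" and F: "poly_le Q d k F" and m: "\<And>v. v \<in> verts Q \<Longrightarrow> k \<le> m v"
  shows "\<exists>Ft\<in>arrow_forms Q d (\<Sum>v\<in>verts Q. m v * d v). \<forall>W M. M \<in> rep_space Q d \<and>
    (\<forall>a\<in>arcs Q. vmat d W (head Q a) * M a = amat Q d W a) \<longrightarrow>
      Ft W = (\<Prod>v\<in>verts Q. det (vmat d W v) ^ m v) * F M"
proof -
  interpret fin_digraph Q by fact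
  let ?T = "\<lambda>m. \<Sum>v\<in>verts Q. m v * d v"
  let ?ok = "\<lambda>W M. M \<in> rep_space Q d \<and> (\<forall>a\<in>arcs Q. vmat d W (head Q a) * M a = amat Q d W a)"
  let ?D = "\<lambda>m W. \<Prod>v\<in>verts Q. det (vmat d W v) ^ m v"
  from F m show "\<exists>Ft\<in>arrow_forms Q d (?T m). \<forall>W M. ?ok W M \<longrightarrow> Ft W = ?D m W * F M"
  proof (induction arbitrary: m rule: poly_le.induct)
    case (const k c)
    have "(\<lambda>W. c * ?D m W) \<in> arrow_forms Q d (?T m)" by (intro span_scale vmat_prod_form Q)
    then show ?case by (rule bexI[rotated]) auto
  next
    case (coord a i j k)
    let ?v = "head Q a"
    \<comment> \<open>Cramer numerator: Y with its i-th column replaced by the j-th column of X(a).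
      It equals det Y times the entry of M a, so it uses up one of the factors det Y at the head of
      a.\<close>
    let ?C = "\<lambda>W. det (mat (d ?v) (d ?v) (\<lambda>(r, c). W (if c = i then Inr a else Inl ?v) r (if c = i then j else c)))"
    define m' where "m' v = (if v = ?v then m v - 1 else m v)" for v
    have v: "?v \<in> verts Q" using coord by simp
    have m1: "m ?v = Suc (m' ?v)" using coord(4)[OF v] by (simp add: m'_def)
    have T: "?T m = d ?v + ?T m'"
    proof -
      have "?T m = m ?v * d ?v + (\<Sum>v\<in>verts Q - {?v}. m v * d v)" by (rule sum.remove[OF finite_verts v])
      moreover have "?T m' = m' ?v * d ?v + (\<Sum>v\<in>verts Q - {?v}. m' v * d v)" by (rule sum.remove[OF finite_verts v])
      moreover have "(\<Sum>v\<in>verts Q - {?v}. m v * d v) = (\<Sum>v\<in>verts Q - {?v}. m' v * d v)"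
        by (rule sum.cong) (auto simp: m'_def)
      ultimately show ?thesis by (simp add: m1)
    qed
    have D: "?D m W = det (vmat d W ?v) * ?D m' W" for W
    proof -
      have "?D m W = det (vmat d W ?v) ^ m ?v * (\<Prod>v\<in>verts Q - {?v}. det (vmat d W v) ^ m v)"
        by (rule prod.remove[OF finite_verts v])
      moreover have "?D m' W = det (vmat d W ?v) ^ m' ?v * (\<Prod>v\<in>verts Q - {?v}. det (vmat d W v) ^ m' v)"
        by (rule prod.remove[OF finite_verts v])
      moreover have "(\<Prod>v\<in>verts Q - {?v}. det (vmat d W v) ^ m v) = (\<Prod>v\<in>verts Q - {?v}. det (vmat d W v) ^ m' v)"
        by (rule prod.cong) (auto simp: m'_def)
      ultimately show ?thesis by (simp add: m1)
    qed
    have "?C \<in> arrow_forms Q d (d ?v)"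
      by (rule arrow_forms_det) (use coord v in \<open>auto simp: darcs_def\<close>)
    then have "(\<lambda>W. ?C W * ?D m' W) \<in> arrow_forms Q d (?T m)"
      unfolding T by (intro arrow_forms_mult vmat_prod_form Q)
    note A = this
    have "?C W * ?D m' W = ?D m W * M a $$ (i, j)" if ok: "?ok W M" for W M
    proof -
      let ?Y = "vmat d W ?v"
      have Ma: "M a \<in> carrier_mat (d ?v) (d (tail Q a))" using ok coord by (auto simp: rep_space_def)
      have X: "?Y * M a = amat Q d W a" using ok coord by auto
      have "?Y *\<^sub>v col (M a) j = col (amat Q d W a) j"
        unfolding X[symmetric] using Ma coord by (simp add: col_mult2[OF vmat_carrier])
      then have "mat (d ?v) (d ?v) (\<lambda>(r, c). W (if c = i then Inr a else Inl ?v) r (if c = i then j else c)) =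
          replace_col ?Y (?Y *\<^sub>v col (M a) j) i"
        using coord by (intro eq_matI) (auto simp: replace_col_def vmat_def amat_def)
      then have "?C W = col (M a) j $ i * det ?Y"
        using coord Ma by (simp add: cramer_lemma_mat[OF vmat_carrier])
      then show ?thesis using coord Ma by (simp add: D)
    qed
    then show ?case by (intro bexI[OF _ A] allI impI)
  next
    case (add k f g)
    obtain Ft where F: "Ft \<in> arrow_forms Q d (?T m)" "\<And>W M. ?ok W M \<Longrightarrow> Ft W = ?D m W * f M"
      proof -
      have "\<exists>Ft\<in>arrow_forms Q d (?T m). \<forall>W M. ?ok W M \<longrightarrow> Ft W = ?D m W * f M"
        by (rule add.IH(1)) (rule add.prems)
      then show ?thesis by (elim bexE) (erule that, simp)
    qed
    obtain Gt where G: "Gt \<in> arrow_forms Q d (?T m)" "\<And>W M. ?ok W M \<Longrightarrow> Gt W = ?D m W * g M"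
      proof -
      have "\<exists>Ft\<in>arrow_forms Q d (?T m). \<forall>W M. ?ok W M \<longrightarrow> Ft W = ?D m W * g M"
        by (rule add.IH(2)) (rule add.prems)
      then show ?thesis by (elim bexE) (erule that, simp)
    qed
    have "Ft + Gt \<in> arrow_forms Q d (?T m)" using F(1) G(1) by (rule fun_space.span_add)
    note A = this
    have "(Ft + Gt) W = ?D m W * (f M + g M)" if "?ok W M" for W M
      using F(2)[OF that] G(2)[OF that] by (simp add: distrib_left)
    then show ?case by (intro bexI[OF _ A] allI impI)
  next
    case (mult k f l g)
    have le: "k + l \<le> m v" if "v \<in> verts Q" for v using mult.prems that .
    have le': "l \<le> m v - k" if "v \<in> verts Q" for v using le[OF that] by linarith
    \<comment> \<open>Degrees add under multiplication, so the powers of the determinants are split: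
      k for f, and the remaining m v - k \<ge> l for g.\<close>
    obtain Ft where F: "Ft \<in> arrow_forms Q d (?T (\<lambda>_. k))"
      "\<And>W M. ?ok W M \<Longrightarrow> Ft W = ?D (\<lambda>_. k) W * f M"
      proof -
      have "\<exists>Ft\<in>arrow_forms Q d (?T (\<lambda>_. k)). \<forall>W M. ?ok W M \<longrightarrow> Ft W = ?D (\<lambda>_. k) W * f M"
        by (rule mult.IH(1)) (rule order_refl)
      then show ?thesis by (elim bexE) (erule that, simp)
    qed
    obtain Gt where G: "Gt \<in> arrow_forms Q d (?T (\<lambda>v. m v - k))"
      "\<And>W M. ?ok W M \<Longrightarrow> Gt W = ?D (\<lambda>v. m v - k) W * g M"
      proof -
      have "\<exists>Ft\<in>arrow_forms Q d (?T (\<lambda>v. m v - k)). \<forall>W M. ?ok W M \<longrightarrow> Ft W = ?D (\<lambda>v. m v - k) W * g M"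
        by (rule mult.IH(2)) (rule le')
      then show ?thesis by (elim bexE) (erule that, simp)
    qed
    have mk: "k + (m v - k) = m v" if "v \<in> verts Q" for v using le[OF that] by simp
    have T: "?T (\<lambda>_. k) + ?T (\<lambda>v. m v - k) = ?T m"
      unfolding sum.distrib[symmetric] add_mult_distrib[symmetric] by (rule sum.cong) (simp_all add: mk)
    have D: "?D (\<lambda>_. k) W * ?D (\<lambda>v. m v - k) W = ?D m W" for W
      unfolding prod.distrib[symmetric] power_add[symmetric] by (rule prod.cong) (simp_all add: mk)
    have "(\<lambda>W. Ft W * Gt W) \<in> arrow_forms Q d (?T m)"
      using arrow_forms_mult[OF F(1) G(1)] unfolding T .
    note A = this
    have "Ft W * Gt W = ?D m W * (f M * g M)" if "?ok W M" for W M
      unfolding D[symmetric] F(2)[OF that] G(2)[OF that] by (simp only: mult_ac)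
    then show ?case by (intro bexI[OF _ A] allI impI)
  qed
qed

section \<open>The Reynolds operator\<close>

lemma GL_carrier_iff:
  "g \<in> carrier (GL Q d :: ('v \<Rightarrow> 'k::field mat) monoid) \<longleftrightarrow>
    g \<in> extensional (verts Q) \<and> (\<forall>v\<in>verts Q. g v \<in> carrier_mat (d v) (d v) \<and> det (g v) \<noteq> 0)"
proof -
  have "A \<in> Units (ring_mat TYPE('k) n ()) \<longleftrightarrow> A \<in> carrier_mat n n \<and> det A \<noteq> 0" for A n
    using det_non_zero_imp_unit[of A n "()"] unit_imp_det_non_zero[of A n "()"]
    by (auto simp: Units_def ring_mat_simps)
  then show ?thesis
    unfolding GL_def carrier_product_group units_of_carrier PiE_def by auto
qed

lemma GL_inv:
  fixes g :: "'v \<Rightarrow> 'k::field mat"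
  assumes "g \<in> carrier (GL Q d)" "v \<in> verts Q"
  shows "(inv\<^bsub>GL Q d\<^esub> g) v \<in> carrier_mat (d v) (d v)"
    "g v * (inv\<^bsub>GL Q d\<^esub> g) v = 1\<^sub>m (d v)" "(inv\<^bsub>GL Q d\<^esub> g) v * g v = 1\<^sub>m (d v)"
proof -
  let ?R = "ring_mat TYPE('k) (d v) ()"
  interpret ring ?R by (rule ring_mat)
  have grp: "Group.group (units_of (ring_mat TYPE('k) n ()))" for n
    by (rule monoid.units_group[OF ring.is_monoid[OF ring_mat]])
  have U: "g v \<in> Units ?R"
    using assms unfolding GL_def carrier_product_group units_of_carrier by auto
  have "(inv\<^bsub>GL Q d\<^esub> g) v = inv\<^bsub>?R\<^esub> (g v)"
    using assms units_of_inv[OF U] unfolding GL_def by (subst inv_product_group) (auto simp: grp)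
  then show "(inv\<^bsub>GL Q d\<^esub> g) v \<in> carrier_mat (d v) (d v)"
    "g v * (inv\<^bsub>GL Q d\<^esub> g) v = 1\<^sub>m (d v)" "(inv\<^bsub>GL Q d\<^esub> g) v * g v = 1\<^sub>m (d v)"
    using Units_inv_closed[OF U] Units_r_inv[OF U] Units_l_inv[OF U] by (auto simp: ring_mat_simps)
qed

lemma rep_act_inv:
  assumes g: "g \<in> carrier (GL Q d)" and a: "a \<in> arcs Q"
  shows "rep_act Q d (inv\<^bsub>GL Q d\<^esub> g) M a = (inv\<^bsub>GL Q d\<^esub> g) (head Q a) * M a * g (tail Q a)"
  unfolding rep_act_def using a group.inv_inv[OF group_GL g] by simp

text \<open>The entries of \<open>double_rep\<close>, that is M as a point of the slice on which the
  matrices at all c_v are identities. As a plain function of the indices it can be substituted into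
  forms without tracking carriers.\<close>

definition rep_W :: "('a, 'k::field) qrep \<Rightarrow> 'v + 'a \<Rightarrow> nat \<Rightarrow> nat \<Rightarrow> 'k" where
  "rep_W M b i l = (case b of Inl v \<Rightarrow> if i = l then 1 else 0 | Inr a \<Rightarrow> M a $$ (i, l))"

lemma vmat_two_sided:
  "vmat d (two_sided Q d G H (rep_W M)) v = diag_block d G v * (diag_block d H v)\<^sup>T"
proof (rule eq_matI)
  fix i l assume "i < dim_row (diag_block d G v * (diag_block d H v)\<^sup>T)" "l < dim_col (diag_block d G v * (diag_block d H v)\<^sup>T)"
  then have il: "i < d v" "l < d v" by (auto simp: diag_block_def)
  have "two_sided Q d G H (rep_W M) (Inl v) i l = (\<Sum>i'<d v. \<Sum>l'<d v. if l' = i' then G (v, i) (v, i') * H (v, l) (v, i') else 0)"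
    unfolding two_sided_def rep_W_def by (intro sum.cong) auto
  also have "\<dots> = (\<Sum>i'<d v. G (v, i) (v, i') * H (v, l) (v, i'))"
    by (intro sum.cong refl) simp
  finally show "vmat d (two_sided Q d G H (rep_W M)) v $$ (i, l) = (diag_block d G v * (diag_block d H v)\<^sup>T) $$ (i, l)"
    using il by (simp add: vmat_def diag_block_def scalar_prod_def atLeast0LessThan)
qed (auto simp: vmat_def diag_block_def)

lemma amat_two_sided:
  assumes "M a \<in> carrier_mat (d (head Q a)) (d (tail Q a))"
  shows "amat Q d (two_sided Q d G H (rep_W M)) a =
    diag_block d G (head Q a) * M a * (diag_block d H (tail Q a))\<^sup>T"
proof (rule eq_matI)
  let ?h = "head Q a" and ?t = "tail Q a"
  fix i l assume "i < dim_row (diag_block d G ?h * M a * (diag_block d H ?t)\<^sup>T)"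
    "l < dim_col (diag_block d G ?h * M a * (diag_block d H ?t)\<^sup>T)"
  then have il: "i < d ?h" "l < d ?t" by (auto simp: diag_block_def)
  have "two_sided Q d G H (rep_W M) (Inr a) i l = (\<Sum>i'<d ?h. \<Sum>l'<d ?t. G (?h, i) (?h, i') * M a $$ (i', l') * H (?t, l) (?t, l'))"
    unfolding two_sided_def rep_W_def by simp
  also have "\<dots> = (\<Sum>l'<d ?t. (\<Sum>i'<d ?h. G (?h, i) (?h, i') * M a $$ (i', l')) * H (?t, l) (?t, l'))"
    unfolding sum_distrib_right by (rule sum.swap)
  finally show "amat Q d (two_sided Q d G H (rep_W M)) a $$ (i, l) =
      (diag_block d G ?h * M a * (diag_block d H ?t)\<^sup>T) $$ (i, l)"
    using il carrier_matD[OF assms] by (simp add: amat_def diag_block_def scalar_prod_def atLeast0LessThan)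
qed (auto simp: amat_def diag_block_def)

lemma diag_block_carrier [simp]: "diag_block d G v \<in> carrier_mat (d v) (d v)"
  by (simp add: diag_block_def)

text \<open>Adding t on the diagonal makes all diagonal blocks invertible for all but finitely many
  t, and t = 0 returns G.\<close>

definition shift :: "'k::field \<Rightarrow> ('v \<times> nat \<Rightarrow> 'v \<times> nat \<Rightarrow> 'k) \<Rightarrow> 'v \<times> nat \<Rightarrow> 'v \<times> nat \<Rightarrow> 'k" where
  "shift t G x y = G x y + (if x = y then t else 0)"

lemma finite_diag_shift_zeros: "finite {t. det (diag_block d (shift t G) v) = 0}"
proof -
  have "diag_block d (shift t G) v = mat (d v) (d v) (\<lambda>(i, j). diag_block d G v $$ (i, j) + (if i = j then t else 0))" for t
    by (intro eq_matI) (auto simp: diag_block_def shift_def)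
  then show ?thesis using finite_det_shift_zeros[OF diag_block_carrier[of d G v]] by simp
qed

lemma is_poly_shift: "is_poly (\<lambda>t. shift t G x y)"
  unfolding shift_def by (cases "x = y") (auto intro: is_poly_add)

lemma is_poly_arrow_form:
  assumes F: "F \<in> arrow_forms Q d T" and W: "\<And>b i l. is_poly (\<lambda>t. W t b i l)"
  shows "is_poly (\<lambda>t. F (W t))"
  using F
proof (induction F rule: fun_space.span_induct_alt)
  case base
  show ?case by simp
next
  case (step c f g)
  from step(1) have "is_poly (\<lambda>t. f (W t))"
    by (auto simp: arrow_monos_def intro!: is_poly_prod W)
  then show ?case using step(2) by (simp add: is_poly_add is_poly_mult)
qed

text \<open>
  Semi-invariance turns \<open>det\<close>-multiples of \<open>F\<close> into a form \<open>Ft(gWh)\<close> on the double quiver;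
  applying the Omega operators in \<open>g\<close> and \<open>h\<close> recovers a nonzero multiple of \<open>F\<close>.
\<close>

lemma averaging:
  fixes Q :: "('v, 'a) pre_digraph" and F :: "('a, 'k::field_char_0) qrep \<Rightarrow> 'k"
  assumes Q: "fin_digraph Q" and Z: "Z \<subseteq> rep_space Q d" "GL_invariant Q d Z"
    and F: "poly_le Q d k F"
    and inv: "\<And>g M. g \<in> carrier (GL Q d) \<Longrightarrow> M \<in> Z \<Longrightarrow> F (rep_act Q d (inv\<^bsub>GL Q d\<^esub> g) M) = weight_char Q \<theta> g * F M"
    and m: "\<And>v. v \<in> verts Q \<Longrightarrow> k \<le> m v"
    and N: "\<And>v. v \<in> verts Q \<Longrightarrow> int (N v) = int (m v) + \<theta> v"
    and sum_eq: "(\<Sum>v\<in>verts Q. m v * d v) = (\<Sum>v\<in>verts Q. N v * d v)"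
  shows "restr Z F \<in> fun_space.span (range (\<lambda>x. restr Z (\<lambda>M. block_poly Q d m N x (rep_W M))))"
proof -
  interpret fin_digraph Q by fact
  let ?T = "\<Sum>v\<in>verts Q. m v * d v"
  let ?D = "\<lambda>m G. \<Prod>v\<in>verts Q. det (diag_block d G v) ^ m v"
  have "\<exists>Ft\<in>arrow_forms Q d ?T. \<forall>W M. M \<in> rep_space Q d \<and>
    (\<forall>a\<in>arcs Q. vmat d W (head Q a) * M a = amat Q d W a) \<longrightarrow>
      Ft W = (\<Prod>v\<in>verts Q. det (vmat d W v) ^ m v) * F M"
    by (rule homogenization[OF Q F]) (rule m)
  then obtain Ft where Ft: "Ft \<in> arrow_forms Q d ?T"
    and Ft': "\<forall>W M. M \<in> rep_space Q d \<and>
      (\<forall>a\<in>arcs Q. vmat d W (head Q a) * M a = amat Q d W a) \<longrightarrow>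
      Ft W = (\<Prod>v\<in>verts Q. det (vmat d W v) ^ m v) * F M"
    by (elim bexE)
  let ?P = "\<lambda>G H M. Ft (two_sided Q d G H (rep_W M))"
  \<comment> \<open>For W = (1, M) the family g W h has Y = g h and X = g M h, so Y^-1 X = h^-1 M h,
    which is the inverse of h acting on M. Semi-invariance contributes the character of h, and det(h
    v)^(m v + \<theta> v) = det(h v)^(N v).\<close>
  have invertible: "?P G H M = ?D m G * ?D N H * F M"
    if M: "M \<in> Z" and GH: "\<And>v. v \<in> verts Q \<Longrightarrow> det (diag_block d G v) \<noteq> 0" "\<And>v. v \<in> verts Q \<Longrightarrow> det (diag_block d H v) \<noteq> 0"
    for G H M
  proof -
    define g where "g v = diag_block d G v" for v
    define h where "h v = (diag_block d H v)\<^sup>T" for v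
    define \<gamma> where "\<gamma> = restrict h (verts Q)"
    define M' where "M' = rep_act Q d (inv\<^bsub>GL Q d\<^esub> \<gamma>) M"
    have gc [simp]: "g v \<in> carrier_mat (d v) (d v)" and hc [simp]: "h v \<in> carrier_mat (d v) (d v)" for v
      by (simp_all add: g_def h_def)
    have dh: "det (h v) = det (diag_block d H v)" for v unfolding h_def by (rule det_transpose[OF diag_block_carrier])
    have \<gamma>: "\<gamma> \<in> carrier (GL Q d)"
      unfolding GL_carrier_iff \<gamma>_def using GH(2) by (auto simp: dh)
    have M'Z: "M' \<in> Z"
      unfolding M'_def using Z(2) M group.inv_closed[OF group_GL \<gamma>] by (auto simp: GL_invariant_def)
    have eq: "vmat d (two_sided Q d G H (rep_W M)) (head Q a) * M' a = amat Q d (two_sided Q d G H (rep_W M)) a"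
      if a: "a \<in> arcs Q" for a
    proof -
      let ?h = "head Q a" and ?t = "tail Q a"
      let ?i = "(inv\<^bsub>GL Q d\<^esub> \<gamma>) ?h"
      have vs: "?h \<in> verts Q" "?t \<in> verts Q" using a by auto
      have Ma: "M a \<in> carrier_mat (d ?h) (d ?t)" using M Z(1) a by (auto simp: rep_space_def)
      have i: "?i \<in> carrier_mat (d ?h) (d ?h)" "h ?h * ?i = 1\<^sub>m (d ?h)"
        using GL_inv[OF \<gamma> vs(1)] vs by (auto simp: \<gamma>_def)
      have X: "M a * h ?t \<in> carrier_mat (d ?h) (d ?t)" by (rule mult_carrier_mat[OF Ma hc])
      have "M' a = ?i * M a * h ?t"
        unfolding M'_def rep_act_inv[OF \<gamma> a] using vs by (simp add: \<gamma>_def)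
      also have "\<dots> = ?i * (M a * h ?t)" by (rule assoc_mult_mat[OF i(1) Ma hc])
      finally have "g ?h * h ?h * M' a = g ?h * (h ?h * (?i * (M a * h ?t)))"
        using assoc_mult_mat[OF gc hc mult_carrier_mat[OF i(1) X]] by simp
      also have "h ?h * (?i * (M a * h ?t)) = h ?h * ?i * (M a * h ?t)"
        by (rule assoc_mult_mat[OF hc i(1) X, symmetric])
      also have "\<dots> = M a * h ?t" unfolding i(2) by (rule left_mult_one_mat[OF X])
      also have "g ?h * (M a * h ?t) = g ?h * M a * h ?t" by (rule assoc_mult_mat[OF gc Ma hc, symmetric])
      finally show ?thesis
        unfolding vmat_two_sided amat_two_sided[of M a d Q, OF Ma] g_def h_def .
    qed
    have "M' \<in> rep_space Q d" using M'Z Z(1) by blast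
    then have "?P G H M = (\<Prod>v\<in>verts Q. det (vmat d (two_sided Q d G H (rep_W M)) v) ^ m v) * F M'"
      by (intro Ft'[rule_format] conjI ballI eq)
    then have "?P G H M = (\<Prod>v\<in>verts Q. det (g v * h v) ^ m v) * F M'"
      by (simp add: vmat_two_sided g_def h_def)
    also have "F M' = weight_char Q \<theta> \<gamma> * F M" unfolding M'_def by (rule inv[OF \<gamma> M])
    also have "(\<Prod>v\<in>verts Q. det (g v * h v) ^ m v) * (weight_char Q \<theta> \<gamma> * F M) =
        (\<Prod>v\<in>verts Q. det (g v) ^ m v * (det (h v) ^ m v * det (h v) powi \<theta> v)) * F M"
    proof -
      have "weight_char Q \<theta> \<gamma> = (\<Prod>v\<in>verts Q. det (h v) powi \<theta> v)"
        unfolding weight_char_def by (rule prod.cong) (simp_all add: \<gamma>_def)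
      then show ?thesis
        by (simp only: det_mult[OF gc hc] power_mult_distrib prod.distrib mult.assoc)
    qed
    also have "(\<Prod>v\<in>verts Q. det (g v) ^ m v * (det (h v) ^ m v * det (h v) powi \<theta> v)) =
        (\<Prod>v\<in>verts Q. det (g v) ^ m v * det (h v) ^ N v)"
    proof (intro prod.cong refl)
      fix v assume v: "v \<in> verts Q"
      have "det (h v) ^ m v * det (h v) powi \<theta> v = det (h v) powi (int (m v) + \<theta> v)"
        using GH(2)[OF v] by (simp add: power_int_add dh)
      also have "\<dots> = det (h v) ^ N v" using N[OF v] by (metis power_int_of_nat)
      finally show "det (g v) ^ m v * (det (h v) ^ m v * det (h v) powi \<theta> v) = det (g v) ^ m v * det (h v) ^ N v"
        by simp
    qed
    finally show ?thesis unfolding g_def dh prod.distrib .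
  qed
  \<comment> \<open>\<open>omega\<close> evaluates at sums of matrix units, which may be singular.
    With t added to both G and H, the identity is polynomial in t and holds outside a finite set,
    hence also at t = 0.\<close>
  have all: "?P G H M = ?D m G * ?D N H * F M" if M: "M \<in> Z" for G H M
  proof -
    let ?f = "\<lambda>t. ?P (shift t G) (shift t H) M - ?D m (shift t G) * ?D N (shift t H) * F M"
    let ?B = "\<Union>v\<in>verts Q. {t. det (diag_block d (shift t G) v) = 0} \<union> {t. det (diag_block d (shift t H) v) = 0}"
    have det: "is_poly (\<lambda>t. det (diag_block d (shift t G) v))" for v G
      unfolding diag_block_def by (rule is_poly_det) (rule is_poly_shift)
    have "is_poly (\<lambda>t. two_sided Q d (shift t G) (shift t H) (rep_W M) b i l)" for b i l
      unfolding two_sided_def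
      by (rule is_poly_sum, rule is_poly_sum, rule is_poly_mult, rule is_poly_mult)
        (rule is_poly_shift is_poly_const)+
    then have P: "is_poly (\<lambda>t. ?P (shift t G) (shift t H) M)"
      by (rule is_poly_arrow_form[OF Ft])
    have D: "is_poly (\<lambda>t. ?D n (shift t G))" for n G
      by (rule is_poly_prod, rule is_poly_power, rule det)
    have "is_poly ?f"
      by (rule is_poly_diff[OF P is_poly_mult[OF is_poly_mult[OF D D] is_poly_const]])
    moreover have "finite ?B" by (intro finite_UN_I finite_UnI finite_verts finite_diag_shift_zeros)
    moreover have "?f t = 0" if "t \<notin> ?B" for t
      using invertible[OF M, of "shift t G" "shift t H"] that by auto
    ultimately have "?f 0 = 0" by (rule is_poly_zero)
    moreover have "shift 0 G = G" "shift 0 H = H" by (auto simp: shift_def fun_eq_iff)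
    ultimately show ?thesis by simp
  qed
  \<comment> \<open>The two Omega operators applied to the determinant factor in front of F.\<close>
  define c where "c = omegaQ Q d m (?D m :: _ \<Rightarrow> 'k) * omegaQ Q d N (?D N)"
  have c: "c \<noteq> 0" unfolding c_def by (rule no_zero_divisors; rule omegaQ_det_nonzero[OF Q])
  let ?R = "\<lambda>W. omegaQ Q d m (\<lambda>G. omegaQ Q d N (\<lambda>H. Ft (two_sided Q d G H W)))"
  have lin: "omegaQ Q d m (\<lambda>G. a * \<Phi> G) = a * omegaQ Q d m \<Phi>" for a m and \<Phi> :: "_ \<Rightarrow> 'k"
    unfolding omegaQ_def omega_def by (simp add: sum_distrib_left mult_ac)
  have R: "?R (rep_W M) = c * F M" if "M \<in> Z" for M
  proof -
    have "omegaQ Q d N (\<lambda>H. ?P G H M) = (F M * omegaQ Q d N (?D N)) * ?D m G" for G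
    proof -
      have "(\<lambda>H. ?P G H M) = (\<lambda>H. (?D m G * F M) * ?D N H)"
        by (rule ext) (simp only: all[OF that] mult.assoc mult.commute[of "F M"])
      then have "omegaQ Q d N (\<lambda>H. ?P G H M) = (?D m G * F M) * omegaQ Q d N (?D N)"
        by (simp only: lin)
      then show ?thesis by (simp only: mult_ac)
    qed
    then have "?R (rep_W M) = omegaQ Q d m (\<lambda>G. (F M * omegaQ Q d N (?D N)) * ?D m G)"
      by (simp only:)
    also have "\<dots> = (F M * omegaQ Q d N (?D N)) * omegaQ Q d m (?D m)" by (rule lin)
    finally show ?thesis unfolding c_def by (simp only: mult_ac)
  qed
  have "?R \<in> fun_space.span (range (block_poly Q d m N))"
    by (rule omega_span_arrow_monos[OF Q _ _ Ft]) (simp_all add: card_brk[OF Q] sum_eq)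
  then have "restr Z (\<lambda>M. ?R (rep_W M)) \<in>
      fun_space.span (range (\<lambda>x. restr Z (\<lambda>M. block_poly Q d m N x (rep_W M))))"
    by (rule span_image_comp) (erule rangeE, simp only:, rule fun_space.span_base, rule rangeI)
  moreover have "restr Z (\<lambda>M. ?R (rep_W M)) = (\<lambda>M. c * restr Z F M)"
    by (rule ext) (simp add: restr_def R)
  ultimately have "(\<lambda>M. inverse c * (c * restr Z F M)) \<in>
      fun_space.span (range (\<lambda>x. restr Z (\<lambda>M. block_poly Q d m N x (rep_W M))))"
    using span_scale[of _ _ "inverse c"] by (simp only:)
  moreover have "(\<lambda>M. inverse c * (c * restr Z F M)) = restr Z F"
    using c by (simp add: mult.assoc[symmetric])
  ultimately show ?thesis by (simp only:)
qed

section \<open>Determinantal semi-invariants of the double quiver\<close>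

lemma arcs_double_quiver: "arcs (double_quiver Q) = darcs Q"
  by (simp add: double_quiver_def darcs_def)

lemma double_quiver_ends: "tail (double_quiver Q) b = (src Q b, 0)" "head (double_quiver Q) b = (tgt Q b, 1)"
  by (cases b; simp add: double_quiver_def)+

lemma verts_double_quiver: "verts (double_quiver Q) = verts Q \<times> {0, 1}"
  by (simp add: double_quiver_def)

definition src_idx :: "('v, 'a) pre_digraph \<Rightarrow> ('v \<times> nat \<Rightarrow> nat) \<Rightarrow> ('v \<Rightarrow> nat) \<Rightarrow> (('v \<times> nat) \<times> nat \<times> nat) set" where
  "src_idx Q c d = (SIGMA i : verts Q \<times> {0, 1}. {..<d (fst i)} \<times> {..<c i})"

definition tgt_idx :: "('v, 'a) pre_digraph \<Rightarrow> ('v \<times> nat \<Rightarrow> nat) \<Rightarrow> ('v \<Rightarrow> nat) \<Rightarrow> (('v + 'a) \<times> nat \<times> nat) set" where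
  "tgt_idx Q c d = (SIGMA b : darcs Q. {..<d (tgt Q b)} \<times> {..<c (src Q b, 0)})"

text \<open>The entry of the Schofield matrix in the row (b, p, q) and the column of the matrix unit
  (p', q') at the vertex i. W is any family of entries; \<open>rep_W M\<close> yields the
  restriction along \<tau>.\<close>

definition sentry ::
    "('v, 'a) pre_digraph \<Rightarrow> ('v + 'a, 'k::field) qrep \<Rightarrow> ('v + 'a \<Rightarrow> nat \<Rightarrow> nat \<Rightarrow> 'k) \<Rightarrow>
     ('v + 'a) \<times> nat \<times> nat \<Rightarrow> ('v \<times> nat) \<times> nat \<times> nat \<Rightarrow> 'k" where
  "sentry Q V W = (\<lambda>(b, p, q) (i, p', q').
     (if i = (tgt Q b, 1) \<and> p = p' then V b $$ (q', q) else 0) -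
     (if i = (src Q b, 0) \<and> q = q' then W b p p' else 0))"

lemma finite_idx:
  assumes "fin_digraph Q"
  shows "finite (src_idx Q c d)" "finite (tgt_idx Q c d)"
  using assms by (simp_all add: src_idx_def tgt_idx_def fin_digraph.finite_verts finite_darcs)

text \<open>The index sets are equal to those of \<open>schofield_mat\<close>, so the enumerations
  coincide and no sign appears. The rest computes the image of a matrix unit.\<close>

lemma schofield_double:
  fixes V :: "('v + 'a, 'k::field) qrep"
  assumes Q: "fin_digraph Q" and V: "V \<in> rep_space (double_quiver Q) c" and M: "M \<in> rep_space Q d"
  shows "schofield (double_quiver Q) c (double_dim d) V (double_rep Q d M) =
    detI (tgt_idx Q c d) (src_idx Q c d) (sentry Q V (rep_W M))"
proof -
  interpret fin_digraph Q by fact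
  let ?D = "double_quiver Q" and ?W = "double_rep Q d M" and ?d = "double_dim d"
  have T: "target_index ?D c ?d = tgt_idx Q c d"
    by (simp add: target_index_def tgt_idx_def arcs_double_quiver double_quiver_ends double_dim_def)
  have S: "source_index ?D c ?d = src_idx Q c d"
    by (simp add: source_index_def src_idx_def verts_double_quiver double_dim_def case_prod_unfold)
  have entry: "schofield_map ?D V ?W (source_basis c ?d (i, p', q')) b $$ (p, q) = sentry Q V (rep_W M) (b, p, q) (i, p', q')"
    if r: "(b, p, q) \<in> tgt_idx Q c d" and s: "(i, p', q') \<in> src_idx Q c d" for b p q i p' q'
  proof -
    let ?\<phi> = "source_basis c ?d (i, p', q') :: _ \<Rightarrow> 'k mat"
    let ?h = "(tgt Q b, 1::nat)" and ?t = "(src Q b, 0::nat)"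
    have b: "b \<in> darcs Q" and p: "p < d (tgt Q b)" and q: "q < c ?t"
      using r by (auto simp: tgt_idx_def)
    have p': "p' < d (fst i)" and q': "q' < c i" using s by (auto simp: src_idx_def)
    have Vb: "V b \<in> carrier_mat (c ?h) (c ?t)"
      using V b by (auto simp: rep_space_def arcs_double_quiver double_quiver_ends PiE_iff)
    have Wb: "?W b \<in> carrier_mat (d (tgt Q b)) (d (src Q b))"
      using M b by (cases b) (auto simp: double_rep_def arcs_double_quiver darcs_def rep_space_def PiE_iff)
    have We: "?W b $$ (x, y) = rep_W M b x y" if "x < d (tgt Q b)" "y < d (src Q b)" for x y
      using that b by (cases b) (auto simp: double_rep_def arcs_double_quiver rep_W_def)
    have \<phi>: "?\<phi> j \<in> carrier_mat (d (fst j)) (c j)" for j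
      by (simp add: source_basis_def double_dim_def case_prod_unfold)
    have \<phi>e: "?\<phi> j $$ (x, y) = (if j = i \<and> x = p' \<and> y = q' then 1 else 0)" if "x < d (fst j)" "y < c j" for j x y
      using that by (simp add: source_basis_def double_dim_def case_prod_unfold)
    have "(?\<phi> ?h * V b) $$ (p, q) = (\<Sum>k<c ?h. ?\<phi> ?h $$ (p, k) * V b $$ (k, q))"
      using carrier_matD[OF Vb] carrier_matD[OF \<phi>[of ?h]] p q by (simp add: scalar_prod_def atLeast0LessThan)
    also have "\<dots> = (\<Sum>k<c ?h. if k = q' then (if i = ?h \<and> p = p' then V b $$ (k, q) else 0) else 0)"
      using p by (intro sum.cong refl) (auto simp: \<phi>e)
    also have "\<dots> = (if i = ?h \<and> p = p' then V b $$ (q', q) else 0)"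
      using q' by auto
    finally have 1: "(?\<phi> ?h * V b) $$ (p, q) = (if i = ?h \<and> p = p' then V b $$ (q', q) else 0)" .
    have "(?W b * ?\<phi> ?t) $$ (p, q) = (\<Sum>k<d (src Q b). ?W b $$ (p, k) * ?\<phi> ?t $$ (k, q))"
      using carrier_matD[OF Wb] carrier_matD[OF \<phi>[of ?t]] p q by (simp add: scalar_prod_def atLeast0LessThan)
    also have "\<dots> = (\<Sum>k<d (src Q b). if k = p' then (if i = ?t \<and> q = q' then rep_W M b p k else 0) else 0)"
      using p q by (intro sum.cong refl) (auto simp: \<phi>e We)
    also have "\<dots> = (if i = ?t \<and> q = q' then rep_W M b p p' else 0)"
      using p' by auto
    finally have 2: "(?W b * ?\<phi> ?t) $$ (p, q) = (if i = ?t \<and> q = q' then rep_W M b p p' else 0)" .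
    have "schofield_map ?D V ?W ?\<phi> b $$ (p, q) = (?\<phi> ?h * V b - ?W b * ?\<phi> ?t) $$ (p, q)"
      using b by (simp add: schofield_map_def arcs_double_quiver double_quiver_ends)
    also have "\<dots> = (?\<phi> ?h * V b) $$ (p, q) - (?W b * ?\<phi> ?t) $$ (p, q)"
      using carrier_matD[OF Wb] carrier_matD[OF \<phi>[of ?t]] p q by (intro index_minus_mat) simp_all
    finally show ?thesis unfolding 1 2 by (simp add: sentry_def)
  qed
  show ?thesis
    unfolding schofield_def schofield_mat_def detI_def T S
  proof (intro arg_cong[where f = det] eq_matI, goal_cases)
    case (1 k l)
    obtain b p q where r: "from_nat_into (tgt_idx Q c d) k = (b, p, q)" by (metis prod_cases3)
    obtain i p' q' where s: "from_nat_into (src_idx Q c d) l = (i, p', q')" by (metis prod_cases3)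
    have "(b, p, q) \<in> tgt_idx Q c d" "(i, p', q') \<in> src_idx Q c d"
      using 1 r s from_nat_into_mem by (metis dim_row_mat(1) dim_col_mat(1))+
    from entry[OF this] show ?case using 1 by (simp add: r s)
  qed auto
qed

lemma sdet_blocks:
  assumes "finite K"
  shows "sdet (SIGMA k:K. {..<n k} \<times> {..<m k}) (\<lambda>(k, p, q) (k', p', q'). if k = k' \<and> q = q' then A k p p' else 0) =
    (\<Prod>k\<in>K. det (mat (n k) (n k) (\<lambda>(p, p'). A k p p')) ^ m k)"
proof -
  have "sdet (SIGMA k:K. {..<n k} \<times> {..<m k}) (\<lambda>(k, p, q) (k', p', q'). if k = k' \<and> q = q' then A k p p' else 0) =
      sdet (SIGMA k:K. {..<n k} \<times> {..<m k}) (\<lambda>(k, x) (k', x'). if k = k' then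
        (\<lambda>(p, q) (p', q'). if q = q' then A k p p' else 0) x x' else 0)"
    by (rule sdet_cong) auto
  also have "\<dots> = (\<Prod>k\<in>K. sdet ({..<n k} \<times> {..<m k}) (\<lambda>(p, q) (p', q'). if q = q' then A k p p' else 0))"
    using assms by (rule sdet_Sigma) auto
  also have "\<dots> = (\<Prod>k\<in>K. sdet ({..<m k} \<times> {..<n k}) (\<lambda>(q, p) (q', p'). if q = q' then A k p p' else 0))"
  proof (rule prod.cong[OF refl])
    fix k
    have "{..<n k} \<times> {..<m k} = prod.swap ` ({..<m k} \<times> {..<n k})" by auto
    then show "sdet ({..<n k} \<times> {..<m k}) (\<lambda>(p, q) (p', q'). if q = q' then A k p p' else 0) =
        sdet ({..<m k} \<times> {..<n k}) (\<lambda>(q, p) (q', p'). if q = q' then A k p p' else 0)"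
      by (simp only:, subst sdet_reindex) (auto simp: case_prod_unfold cong: if_cong)
  qed
  also have "\<dots> = (\<Prod>k\<in>K. det (mat (n k) (n k) (\<lambda>(p, p'). A k p p')) ^ m k)"
    by (rule prod.cong[OF refl], subst sdet_Sigma) (auto simp: det_sdet)
  finally show ?thesis .
qed

text \<open>If V has dimension N v at each (v, 0), this is the dimension of the direct sum of the
  spaces from which arrows enter (v, 1), called the incoming space below.\<close>

definition in_dim :: "('v, 'a) pre_digraph \<Rightarrow> ('v \<Rightarrow> nat) \<Rightarrow> 'v \<Rightarrow> nat" where
  "in_dim Q N v = (\<Sum>b | b \<in> darcs Q \<and> tgt Q b = v. N (src Q b))"

lemma darcs_group:
  assumes Q: "fin_digraph Q"
  shows "(\<Sum>b\<in>darcs Q. f (tgt Q b) * (N (src Q b) :: nat)) = (\<Sum>v\<in>verts Q. f v * in_dim Q N v)"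
proof -
  have "(\<Sum>b\<in>darcs Q. f (tgt Q b) * N (src Q b)) =
      (\<Sum>v\<in>verts Q. \<Sum>b | b \<in> darcs Q \<and> tgt Q b = v. f (tgt Q b) * N (src Q b))"
    by (rule sum.group[symmetric]) (use Q finite_darcs darcs_verts in \<open>auto simp: fin_digraph.finite_verts\<close>)
  also have "\<dots> = (\<Sum>v\<in>verts Q. f v * in_dim Q N v)"
    unfolding in_dim_def sum_distrib_left by (intro sum.cong refl) auto
  finally show ?thesis .
qed

lemma darcs_group_prod:
  assumes Q: "fin_digraph Q"
  shows "(\<Prod>b\<in>darcs Q. f (tgt Q b) ^ N (src Q b)) = (\<Prod>v\<in>verts Q. (f v :: 'k::comm_semiring_1) ^ in_dim Q N v)"
proof -
  have "(\<Prod>b\<in>darcs Q. f (tgt Q b) ^ N (src Q b)) =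
      (\<Prod>v\<in>verts Q. \<Prod>b | b \<in> darcs Q \<and> tgt Q b = v. f (tgt Q b) ^ N (src Q b))"
    by (rule prod.group[symmetric]) (use Q finite_darcs darcs_verts in \<open>auto simp: fin_digraph.finite_verts\<close>)
  also have "\<dots> = (\<Prod>v\<in>verts Q. f v ^ in_dim Q N v)"
    unfolding in_dim_def power_sum by (intro prod.cong refl) auto
  finally show ?thesis .
qed

lemma card_idx:
  assumes Q: "fin_digraph Q"
  shows "card (src_idx Q c d) = (\<Sum>v\<in>verts Q. d v * (c (v, 0) + c (v, 1)))"
    "card (tgt_idx Q c d) = (\<Sum>v\<in>verts Q. d v * in_dim Q (\<lambda>v. c (v, 0)) v)"
proof -
  interpret fin_digraph Q by fact
  have "card (src_idx Q c d) = (\<Sum>i\<in>verts Q \<times> {0, 1}. d (fst i) * c i)"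
    by (simp add: src_idx_def)
  also have "\<dots> = (\<Sum>v\<in>verts Q. d v * (c (v, 0) + c (v, 1)))"
    unfolding sum.cartesian_product' by (simp add: distrib_left)
  finally show "card (src_idx Q c d) = (\<Sum>v\<in>verts Q. d v * (c (v, 0) + c (v, 1)))" .
  have "card (tgt_idx Q c d) = (\<Sum>b\<in>darcs Q. d (tgt Q b) * c (src Q b, 0))"
    using finite_darcs[OF Q] by (simp add: tgt_idx_def)
  then show "card (tgt_idx Q c d) = (\<Sum>v\<in>verts Q. d v * in_dim Q (\<lambda>v. c (v, 0)) v)"
    using darcs_group[OF Q, of d "\<lambda>v. c (v, 0)"] by simp
qed

lemma euler_form_double:
  assumes Q: "fin_digraph Q"
  shows "euler_form (double_quiver Q) c (double_dim d) = int (card (src_idx Q c d)) - int (card (tgt_idx Q c d))"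
proof -
  interpret fin_digraph Q by fact
  have "(\<Sum>i\<in>verts Q \<times> {0, 1}. int (c i) * int (double_dim d i)) = int (card (src_idx Q c d))"
    by (simp add: src_idx_def double_dim_def case_prod_unfold mult.commute)
  moreover have "(\<Sum>b\<in>darcs Q. int (c (src Q b, 0)) * int (double_dim d (tgt Q b, 1))) = int (card (tgt_idx Q c d))"
    using finite_darcs[OF Q] by (simp add: tgt_idx_def double_dim_def mult.commute)
  ultimately show ?thesis
    by (simp add: euler_form_def verts_double_quiver arcs_double_quiver double_quiver_ends)
qed

text \<open>By \<open>tw\<close>, \<gamma> is a morphism from W to W'. Composing with \<gamma> on
  the source and on the target therefore intertwines the two Schofield maps; the claim is the
  determinant of this commuting square.\<close>

lemma detI_sentry_intertwine:
  assumes Q: "fin_digraph Q" and card: "card (tgt_idx Q c d) = card (src_idx Q c d)"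
    and tw: "\<And>b p p0. b \<in> darcs Q \<Longrightarrow> p < d (tgt Q b) \<Longrightarrow> p0 < d (src Q b) \<Longrightarrow>
      (\<Sum>p'<d (src Q b). W' b p p' * \<gamma> (src Q b) $$ (p', p0)) = (\<Sum>p'<d (tgt Q b). \<gamma> (tgt Q b) $$ (p, p') * W b p' p0)"
    and \<gamma>: "\<And>v. v \<in> verts Q \<Longrightarrow> \<gamma> v \<in> carrier_mat (d v) (d v)"
  shows "detI (tgt_idx Q c d) (src_idx Q c d) (sentry Q V W') * (\<Prod>v\<in>verts Q. det (\<gamma> v) ^ (c (v, 0) + c (v, 1))) =
    (\<Prod>v\<in>verts Q. det (\<gamma> v) ^ in_dim Q (\<lambda>v. c (v, 0)) v) *
    detI (tgt_idx Q c d) (src_idx Q c d) (sentry Q V (W :: _ \<Rightarrow> _ \<Rightarrow> _ \<Rightarrow> 'k::field))"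
proof -
  interpret fin_digraph Q by fact
  let ?S = "src_idx Q c d" and ?T = "tgt_idx Q c d"
  define Gs :: "('a \<times> nat) \<times> nat \<times> nat \<Rightarrow> ('a \<times> nat) \<times> nat \<times> nat \<Rightarrow> 'k" where
    "Gs = (\<lambda>(i, p, q) (i', p', q'). if i = i' \<and> q = q' then \<gamma> (fst i) $$ (p, p') else 0)"
  define Gt :: "('a + 'b) \<times> nat \<times> nat \<Rightarrow> ('a + 'b) \<times> nat \<times> nat \<Rightarrow> 'k" where
    "Gt = (\<lambda>(b, p, q) (b', p', q'). if b = b' \<and> q = q' then \<gamma> (tgt Q b) $$ (p, p') else 0)"
  have fS: "finite ?S" and fT: "finite ?T" using finite_idx[OF Q] by auto
  have dv: "det (mat (d v) (d v) (($$) (\<gamma> v))) = det (\<gamma> v)" if "v \<in> verts Q" for v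
    using \<gamma>[OF that] by (intro arg_cong[where f = det] eq_matI) auto
  have Gs: "detI ?S ?S Gs = (\<Prod>v\<in>verts Q. det (\<gamma> v) ^ (c (v, 0) + c (v, 1)))"
  proof -
    have "detI ?S ?S Gs = (\<Prod>i\<in>verts Q \<times> {0, 1}. det (mat (d (fst i)) (d (fst i)) (\<lambda>(p, p'). \<gamma> (fst i) $$ (p, p'))) ^ c i)"
      unfolding detI_same[OF fS] unfolding Gs_def src_idx_def
      by (rule sdet_blocks[where A = "\<lambda>i p p'. \<gamma> (fst i) $$ (p, p')" and n = "\<lambda>i. d (fst i)"]) simp
    also have "\<dots> = (\<Prod>v\<in>verts Q. det (\<gamma> v) ^ (c (v, 0) + c (v, 1)))"
      unfolding prod.cartesian_product' by (intro prod.cong refl) (simp add: dv power_add)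
    finally show ?thesis .
  qed
  have Gt: "detI ?T ?T Gt = (\<Prod>v\<in>verts Q. det (\<gamma> v) ^ in_dim Q (\<lambda>v. c (v, 0)) v)"
  proof -
    have "detI ?T ?T Gt = (\<Prod>b\<in>darcs Q. det (mat (d (tgt Q b)) (d (tgt Q b)) (\<lambda>(p, p'). \<gamma> (tgt Q b) $$ (p, p'))) ^ c (src Q b, 0))"
      unfolding detI_same[OF fT] unfolding Gt_def tgt_idx_def
      by (rule sdet_blocks[OF finite_darcs[OF Q], where A = "\<lambda>b p p'. \<gamma> (tgt Q b) $$ (p, p')" and n = "\<lambda>b. d (tgt Q b)"])
    also have "\<dots> = (\<Prod>b\<in>darcs Q. det (\<gamma> (tgt Q b)) ^ c (src Q b, 0))"
      using darcs_verts[OF Q] by (intro prod.cong refl) (simp add: dv)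
    finally show ?thesis using darcs_group_prod[OF Q, of "\<lambda>v. det (\<gamma> v)" "\<lambda>v. c (v, 0)"] by simp
  qed
  have "detI ?T ?S (\<lambda>r s. \<Sum>s'\<in>?S. sentry Q V W' r s' * Gs s' s) = detI ?T ?S (\<lambda>r s. \<Sum>r'\<in>?T. Gt r r' * sentry Q V W r' s)"
  proof (rule detI_cong)
    fix r s assume "r \<in> ?T" "s \<in> ?S"
    moreover obtain b p q where r: "r = (b, p, q)" by (metis prod_cases3)
    moreover obtain u z p0 q0 where s: "s = ((u, z), p0, q0)" by (metis prod.exhaust)
    ultimately have b: "b \<in> darcs Q" "p < d (tgt Q b)" "q < c (src Q b, 0)"
      and u: "u \<in> verts Q" "z \<in> {0, 1}" "p0 < d u" "q0 < c (u, z)" by (auto simp: tgt_idx_def src_idx_def)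
    have "(\<Sum>s'\<in>?S. sentry Q V W' r s' * Gs s' s) = (\<Sum>s'\<in>(\<lambda>p'. ((u, z), p', q0)) ` {..<d u}. sentry Q V W' r s' * Gs s' s)"
      by (rule sum.mono_neutral_right[OF fS]) (use u in \<open>auto simp: src_idx_def Gs_def s split: if_splits\<close>)
    also have "\<dots> = (\<Sum>p'<d u. sentry Q V W' r ((u, z), p', q0) * \<gamma> u $$ (p', p0))"
      by (subst sum.reindex) (auto simp: inj_on_def Gs_def s)
    also have "\<dots> = (\<Sum>p'<d u. if p' = p then (if (u, z) = (tgt Q b, 1) then V b $$ (q0, q) * \<gamma> u $$ (p, p0) else 0) else 0) -
        (\<Sum>p'<d u. if (u, z) = (src Q b, 0) \<and> q = q0 then W' b p p' * \<gamma> u $$ (p', p0) else 0)"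
      unfolding sum_subtractf[symmetric] by (intro sum.cong refl) (auto simp: sentry_def r algebra_simps)
    also have "\<dots> = (if (u, z) = (tgt Q b, 1) then V b $$ (q0, q) * \<gamma> u $$ (p, p0) else 0) -
        (if (u, z) = (src Q b, 0) \<and> q = q0 then (\<Sum>p'<d u. W' b p p' * \<gamma> u $$ (p', p0)) else 0)"
      using b by auto
    also have "\<dots> = (if (u, z) = (tgt Q b, 1) then V b $$ (q0, q) * \<gamma> u $$ (p, p0) else 0) -
        (if (u, z) = (src Q b, 0) \<and> q = q0 then (\<Sum>p'<d (tgt Q b). \<gamma> (tgt Q b) $$ (p, p') * W b p' p0) else 0)"
      using tw[OF b(1,2)] u by auto
    also have "\<dots> = (\<Sum>p'<d (tgt Q b). if p' = p0 then (if (u, z) = (tgt Q b, 1) then V b $$ (q0, q) * \<gamma> u $$ (p, p0) else 0) else 0) -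
        (\<Sum>p'<d (tgt Q b). if (u, z) = (src Q b, 0) \<and> q = q0 then \<gamma> (tgt Q b) $$ (p, p') * W b p' p0 else 0)"
      using u by auto
    also have "\<dots> = (\<Sum>p'<d (tgt Q b). \<gamma> (tgt Q b) $$ (p, p') * sentry Q V W (b, p', q) s)"
      unfolding sum_subtractf[symmetric] by (intro sum.cong refl) (auto simp: sentry_def s algebra_simps)
    also have "\<dots> = (\<Sum>r'\<in>(\<lambda>p'. (b, p', q)) ` {..<d (tgt Q b)}. Gt r r' * sentry Q V W r' s)"
      by (subst sum.reindex) (auto simp: inj_on_def Gt_def r)
    also have "\<dots> = (\<Sum>r'\<in>?T. Gt r r' * sentry Q V W r' s)"
      by (rule sum.mono_neutral_left[OF fT]) (use b in \<open>auto simp: tgt_idx_def Gt_def r split: if_splits\<close>)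
    finally show "(\<Sum>s'\<in>?S. sentry Q V W' r s' * Gs s' s) = (\<Sum>r'\<in>?T. Gt r r' * sentry Q V W r' s)" .
  qed
  then show ?thesis
    using detI_mult[OF fS card refl, of "sentry Q V W'" Gs] detI_mult[OF fT refl card[symmetric], of Gt "sentry Q V W"]
    by (simp add: Gs Gt)
qed

lemma rep_act_rep_space:
  assumes Q: "fin_digraph Q" and g: "g \<in> carrier (GL Q d)" and M: "M \<in> rep_space Q d"
  shows "rep_act Q d g M \<in> rep_space Q d"
proof -
  interpret fin_digraph Q by fact
  have "g (head Q a) * M a * (inv\<^bsub>GL Q d\<^esub> g) (tail Q a) \<in> carrier_mat (d (head Q a)) (d (tail Q a))"
    if a: "a \<in> arcs Q" for a
  proof -
    have "g (head Q a) \<in> carrier_mat (d (head Q a)) (d (head Q a))" using g a by (simp add: GL_carrier_iff)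
    moreover have "M a \<in> carrier_mat (d (head Q a)) (d (tail Q a))" using M a by (auto simp: rep_space_def)
    moreover have "(inv\<^bsub>GL Q d\<^esub> g) (tail Q a) \<in> carrier_mat (d (tail Q a)) (d (tail Q a))"
      using GL_inv(1)[OF g] a by simp
    ultimately show ?thesis by (meson mult_carrier_mat)
  qed
  then show ?thesis by (auto simp: rep_act_def rep_space_def)
qed

text \<open>The inverse of g is an isomorphism from M to the transformed representation, so
  \<open>detI_sentry_intertwine\<close> applies with it as \<gamma>. The weight at v is c(v,0) +
  c(v,1) minus the incoming dimension. It is constrained where d v > 0, since determinants of size 0
  equal 1.\<close>

lemma schofield_semi_invariant:
  fixes V :: "('v + 'a, 'k::field) qrep"
  assumes Q: "fin_digraph Q" and V: "V \<in> rep_space (double_quiver Q) c"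
    and card: "card (tgt_idx Q c d) = card (src_idx Q c d)"
    and \<theta>: "\<And>v. v \<in> verts Q \<Longrightarrow> d v > 0 \<Longrightarrow>
      int (c (v, 0) + c (v, 1)) = int (in_dim Q (\<lambda>v. c (v, 0)) v) + \<theta> v"
    and M: "M \<in> rep_space Q d" and g: "g \<in> carrier (GL Q d)"
  shows "schofield (double_quiver Q) c (double_dim d) V (double_rep Q d (rep_act Q d (inv\<^bsub>GL Q d\<^esub> g) M)) =
    weight_char Q \<theta> g * schofield (double_quiver Q) c (double_dim d) V (double_rep Q d M)"
proof -
  interpret fin_digraph Q by fact
  let ?\<gamma> = "inv\<^bsub>GL Q d\<^esub> g"
  let ?M' = "rep_act Q d ?\<gamma> M"
  let ?e = "\<lambda>v. c (v, 0) + c (v, 1)" and ?f = "in_dim Q (\<lambda>v. c (v, 0))"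
  have \<gamma>: "?\<gamma> \<in> carrier (GL Q d)" by (rule group.inv_closed[OF group_GL g])
  have M': "?M' \<in> rep_space Q d" by (rule rep_act_rep_space[OF Q \<gamma> M])
  have gc: "g v \<in> carrier_mat (d v) (d v)" if "v \<in> verts Q" for v using g that by (simp add: GL_carrier_iff)
  have \<gamma>c: "?\<gamma> v \<in> carrier_mat (d v) (d v)" if "v \<in> verts Q" for v using GL_inv(1)[OF g that] .
  have tw: "(\<Sum>p'<d (src Q b). rep_W ?M' b p p' * ?\<gamma> (src Q b) $$ (p', p0)) =
      (\<Sum>p'<d (tgt Q b). ?\<gamma> (tgt Q b) $$ (p, p') * rep_W M b p' p0)"
    if b: "b \<in> darcs Q" "p < d (tgt Q b)" "p0 < d (src Q b)" for b p p0
  proof (cases b)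
    case (Inl v)
    have "(\<Sum>p'<d v. (if p = p' then 1 else 0) * ?\<gamma> v $$ (p', p0)) = (\<Sum>p'<d v. if p' = p then ?\<gamma> v $$ (p', p0) else 0)"
      by (rule sum.cong) auto
    moreover have "(\<Sum>p'<d v. ?\<gamma> v $$ (p, p') * (if p' = p0 then 1 else 0)) = (\<Sum>p'<d v. if p' = p0 then ?\<gamma> v $$ (p, p') else 0)"
      by (rule sum.cong) auto
    ultimately show ?thesis using b Inl by (simp add: rep_W_def)
  next
    case (Inr a)
    let ?h = "head Q a" and ?t = "tail Q a"
    have a: "a \<in> arcs Q" using b Inr by (auto simp: darcs_def)
    have vs: "?h \<in> verts Q" "?t \<in> verts Q" using a by auto
    have Ma: "M a \<in> carrier_mat (d ?h) (d ?t)" and M'a: "?M' a \<in> carrier_mat (d ?h) (d ?t)"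
      using M M' a by (auto simp: rep_space_def)
    have "?M' a * ?\<gamma> ?t = ?\<gamma> ?h * M a * g ?t * ?\<gamma> ?t" by (simp add: rep_act_inv[OF g a])
    also have "\<dots> = ?\<gamma> ?h * M a * (g ?t * ?\<gamma> ?t)"
      by (rule assoc_mult_mat[OF mult_carrier_mat[OF \<gamma>c[OF vs(1)] Ma] gc[OF vs(2)] \<gamma>c[OF vs(2)]])
    also have "\<dots> = ?\<gamma> ?h * M a"
      unfolding GL_inv(2)[OF g vs(2)] by (rule right_mult_one_mat[OF mult_carrier_mat[OF \<gamma>c[OF vs(1)] Ma]])
    finally have eq: "(?M' a * ?\<gamma> ?t) $$ (p, p0) = (?\<gamma> ?h * M a) $$ (p, p0)" by simp
    have "(?M' a * ?\<gamma> ?t) $$ (p, p0) = (\<Sum>p'<d ?t. ?M' a $$ (p, p') * ?\<gamma> ?t $$ (p', p0))"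
      using carrier_matD[OF M'a] carrier_matD[OF \<gamma>c[OF vs(2)]] b Inr by (simp add: scalar_prod_def atLeast0LessThan)
    moreover have "(?\<gamma> ?h * M a) $$ (p, p0) = (\<Sum>p'<d ?h. ?\<gamma> ?h $$ (p, p') * M a $$ (p', p0))"
      using carrier_matD[OF Ma] carrier_matD[OF \<gamma>c[OF vs(1)]] b Inr by (simp add: scalar_prod_def atLeast0LessThan)
    ultimately show ?thesis using eq Inr by (simp add: rep_W_def)
  qed
  have main: "schofield (double_quiver Q) c (double_dim d) V (double_rep Q d ?M') * (\<Prod>v\<in>verts Q. det (?\<gamma> v) ^ ?e v) =
    (\<Prod>v\<in>verts Q. det (?\<gamma> v) ^ ?f v) * schofield (double_quiver Q) c (double_dim d) V (double_rep Q d M)"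
    unfolding schofield_double[OF Q V M] schofield_double[OF Q V M']
    by (rule detI_sentry_intertwine[OF Q card tw \<gamma>c])
  have inv: "det (?\<gamma> v) * det (g v) = 1" if "v \<in> verts Q" for v
    using det_mult[OF \<gamma>c[OF that] gc[OF that]] GL_inv(3)[OF g that] by simp
  have one: "(\<Prod>v\<in>verts Q. det (?\<gamma> v) ^ ?e v) * (\<Prod>v\<in>verts Q. det (g v) ^ ?e v) = 1"
    unfolding prod.distrib[symmetric] power_mult_distrib[symmetric] by (simp add: inv)
  have wt: "(\<Prod>v\<in>verts Q. det (?\<gamma> v) ^ ?f v) * (\<Prod>v\<in>verts Q. det (g v) ^ ?e v) = weight_char Q \<theta> g"
    unfolding prod.distrib[symmetric] weight_char_def
  proof (rule prod.cong[OF refl])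
    fix v assume v: "v \<in> verts Q"
    have g0: "det (g v) \<noteq> 0" using inv[OF v] by auto
    show "det (?\<gamma> v) ^ ?f v * det (g v) ^ ?e v = det (g v) powi \<theta> v"
    proof (cases "d v = 0")
      case True
      then have "det (g v) = 1" "det (?\<gamma> v) = 1" using gc[OF v] \<gamma>c[OF v] by auto
      then show ?thesis by simp
    next
      case False
      then have "det (g v) ^ ?e v = det (g v) powi (int (?f v) + \<theta> v)"
        using \<theta>[OF v] by (metis bot_nat_0.not_eq_extremum power_int_of_nat)
      also have "\<dots> = det (g v) ^ ?f v * det (g v) powi \<theta> v" using g0 by (simp add: power_int_add)
      finally have "det (?\<gamma> v) ^ ?f v * det (g v) ^ ?e v = (det (?\<gamma> v) * det (g v)) ^ ?f v * det (g v) powi \<theta> v"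
        by (simp add: power_mult_distrib)
      then show ?thesis by (simp add: inv[OF v])
    qed
  qed
  have "x * e = f * y \<Longrightarrow> e * g = 1 \<Longrightarrow> f * g = w \<Longrightarrow> x = w * y" for x y e f g w :: 'k
  proof -
    assume 1: "x * e = f * y" "e * g = 1" "f * g = w"
    have "x = (x * e) * g" using 1(2) by (simp add: mult.assoc)
    also have "\<dots> = w * y" unfolding 1(1) 1(3)[symmetric] by (simp only: mult_ac)
    finally show "x = w * y" .
  qed
  from this[OF main one wt] show ?thesis .
qed

section \<open>Degrees of the determinants in M and in V\<close>

lemma poly_le_diff: "poly_le Q d k f \<Longrightarrow> poly_le Q d k g \<Longrightarrow> poly_le Q d k (\<lambda>M. f M - g M)"
  using poly_le.add[OF _ poly_le_cmult[of Q d k g "- 1"], of f] by simp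

lemma poly_le_detI:
  assumes "\<And>r s. r \<in> R \<Longrightarrow> s \<in> S \<Longrightarrow> poly_le Q d 1 (\<lambda>M. A M r s)" "card S = card R"
  shows "poly_le Q d (card R) (\<lambda>M. detI R S (A M))"
  unfolding detI_def assms(2)
  by (rule poly_le_det) (rule assms(1); rule from_nat_into_mem; simp add: assms(2))

lemma poly_le_sentry_rep:
  assumes "card (src_idx Q c d) = card (tgt_idx Q c d)"
  shows "poly_le Q d (card (tgt_idx Q c d)) (\<lambda>M. detI (tgt_idx Q c d) (src_idx Q c d) (sentry Q V (rep_W M)))"
proof (rule poly_le_detI[OF _ assms])
  fix r s assume "r \<in> tgt_idx Q c d" "s \<in> src_idx Q c d"
  moreover obtain b p q where r: "r = (b, p, q)" by (metis prod_cases3)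
  moreover obtain i p' q' where s: "s = (i, p', q')" by (metis prod_cases3)
  ultimately have b: "b \<in> darcs Q" "p < d (tgt Q b)" and i: "p' < d (fst i)"
    by (auto simp: tgt_idx_def src_idx_def)
  have "poly_le Q d 1 (\<lambda>M. if i = (src Q b, 0) \<and> q = q' then rep_W M b p p' else 0)"
  proof (cases "i = (src Q b, 0) \<and> q = q'")
    case True
    then show ?thesis
      using b i poly_le.coord[of _ Q p d p' 0] by (cases b) (auto simp: rep_W_def darcs_def poly_le.const)
  next
    case False
    show ?thesis unfolding if_not_P[OF False] by (rule poly_le.const)
  qed
  then show "poly_le Q d 1 (\<lambda>M. sentry Q V (rep_W M) r s)"
    unfolding sentry_def r s prod.case by (intro poly_le_diff poly_le.const)
qed

lemma poly_le_sentry_V: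
  assumes "card (src_idx Q c d) = card (tgt_idx Q c d)"
  shows "poly_le (double_quiver Q) c (card (tgt_idx Q c d)) (\<lambda>V. detI (tgt_idx Q c d) (src_idx Q c d) (sentry Q V W))"
proof (rule poly_le_detI[OF _ assms])
  fix r s assume "r \<in> tgt_idx Q c d" "s \<in> src_idx Q c d"
  moreover obtain b p q where r: "r = (b, p, q)" by (metis prod_cases3)
  moreover obtain i p' q' where s: "s = (i, p', q')" by (metis prod_cases3)
  ultimately have b: "b \<in> darcs Q" "q < c (src Q b, 0)" and i: "q' < c i"
    by (auto simp: tgt_idx_def src_idx_def)
  have "poly_le (double_quiver Q) c 1 (\<lambda>V. if i = (tgt Q b, 1) \<and> p = p' then V b $$ (q', q) else 0)"
  proof (cases "i = (tgt Q b, 1) \<and> p = p'")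
    case True
    then show ?thesis
      using b i poly_le.coord[of b "double_quiver Q" q' c q 0]
      by (auto simp: arcs_double_quiver double_quiver_ends)
  next
    case False
    show ?thesis unfolding if_not_P[OF False] by (rule poly_le.const)
  qed
  then show "poly_le (double_quiver Q) c 1 (\<lambda>V. sentry Q V W r s)"
    unfolding sentry_def r s prod.case by (intro poly_le_diff poly_le.const)
qed

section \<open>Representations of an admissible quotient are nilpotent\<close>

lemma path_mat_carrier:
  assumes Q: "fin_digraph Q" and M: "M \<in> rep_space Q d"
  shows "pre_digraph.awalk Q u p v \<Longrightarrow> path_mat Q d M u p \<in> carrier_mat (d v) (d u)"
proof -
  interpret fin_digraph Q by fact
  show "awalk u p v \<Longrightarrow> path_mat Q d M u p \<in> carrier_mat (d v) (d u)"
  proof (induction p arbitrary: u)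
    case Nil
    then show ?case by (auto simp: awalk_Nil_iff)
  next
    case (Cons a p)
    then have a: "a \<in> arcs Q" "u = tail Q a" "awalk (head Q a) p v" by (auto simp: awalk_Cons_iff)
    have "M a \<in> carrier_mat (d (head Q a)) (d (tail Q a))" using M a by (auto simp: rep_space_def)
    then show ?case using Cons.IH[OF a(3)] a(2) by (simp add: mult_carrier_mat)
  qed
qed

lemma path_mat_append:
  assumes Q: "fin_digraph Q" and M: "M \<in> rep_space Q d" and q: "pre_digraph.awalk Q w q v"
  shows "pre_digraph.awalk Q u p w \<Longrightarrow> path_mat Q d M u (p @ q) = path_mat Q d M w q * path_mat Q d M u p"
proof -
  interpret fin_digraph Q by fact
  show "awalk u p w \<Longrightarrow> path_mat Q d M u (p @ q) = path_mat Q d M w q * path_mat Q d M u p"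
  proof (induction p arbitrary: u)
    case Nil
    then have "u = w" by (auto simp: awalk_Nil_iff)
    then show ?case using path_mat_carrier[OF Q M q] by simp
  next
    case (Cons a p)
    then have a: "a \<in> arcs Q" "u = tail Q a" "awalk (head Q a) p w" by (auto simp: awalk_Cons_iff)
    have "M a \<in> carrier_mat (d (head Q a)) (d (tail Q a))" using M a by (auto simp: rep_space_def)
    then show ?case
      using Cons.IH[OF a(3)] path_mat_carrier[OF Q M q] path_mat_carrier[OF Q M a(3)]
      by (simp add: assoc_mult_mat)
  qed
qed

definition rel_entry ::
    "('v, 'a) pre_digraph \<Rightarrow> ('v \<Rightarrow> nat) \<Rightarrow> ('a, 'k::field) qrep \<Rightarrow> ('v \<times> 'a list \<Rightarrow> 'k) \<Rightarrow>
     'v \<Rightarrow> 'v \<Rightarrow> nat \<Rightarrow> nat \<Rightarrow> 'k" where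
  "rel_entry Q d M r u v i j =
     (\<Sum>p | r (u, p) \<noteq> 0 \<and> pre_digraph.awalk Q u p v. r (u, p) * path_mat Q d M u p $$ (i, j))"

lemma eval_rel_zero_iff:
  "eval_rel Q d M r u v = 0\<^sub>m (d v) (d u) \<longleftrightarrow> (\<forall>i<d v. \<forall>j<d u. rel_entry Q d M r u v i j = 0)"
  unfolding eval_rel_def rel_entry_def by (auto simp: mat_eq_iff)

lemma rel_entry_superset:
  assumes "finite P" "{p. r (u, p) \<noteq> 0 \<and> pre_digraph.awalk Q u p v} \<subseteq> P" "\<And>p. p \<in> P \<Longrightarrow> pre_digraph.awalk Q u p v"
  shows "rel_entry Q d M r u v i j = (\<Sum>p\<in>P. r (u, p) * path_mat Q d M u p $$ (i, j))"
  unfolding rel_entry_def using assms by (intro sum.mono_neutral_left) auto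

lemma path_algebra_finite:
  assumes "x \<in> carrier (path_algebra Q)"
  shows "finite {p. x (u, p) \<noteq> 0 \<and> P p}"
proof -
  have "finite {w. x w \<noteq> 0}" using assms by (simp add: path_algebra_def)
  then have "finite (snd ` {w. x w \<noteq> 0})" by simp
  then show ?thesis by (rule rev_finite_subset) force
qed

lemma rel_entry_add:
  assumes x: "x \<in> carrier (path_algebra Q)" and y: "y \<in> carrier (path_algebra Q)"
  shows "rel_entry Q d M (x + y) u v i j = rel_entry Q d M x u v i j + rel_entry Q d M y u v i j"
proof -
  let ?P = "{p. x (u, p) \<noteq> 0 \<and> pre_digraph.awalk Q u p v} \<union> {p. y (u, p) \<noteq> 0 \<and> pre_digraph.awalk Q u p v}"
  have fin: "finite ?P" by (intro finite_UnI path_algebra_finite[OF x] path_algebra_finite[OF y])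
  show ?thesis
    by (subst (1 2 3) rel_entry_superset[OF fin]) (auto simp: sum.distrib[symmetric] algebra_simps)
qed

text \<open>Evaluation at M reverses products: the path of x is traversed first, so the matrix of y
  stands on the left. A pair of composable paths is a path with a cut, and the convolution regroups
  into a sum over the vertex w at the cut.\<close>

lemma rel_entry_mult:
  fixes x y :: "'v \<times> 'a list \<Rightarrow> 'k::field"
  assumes Q: "fin_digraph Q" and M: "M \<in> rep_space Q d"
    and x: "x \<in> carrier (path_algebra Q)" and y: "y \<in> carrier (path_algebra Q)"
    and i: "i < d v" and j: "j < d u"
  shows "rel_entry Q d M (x \<otimes>\<^bsub>path_algebra Q\<^esub> y) u v i j =
    (\<Sum>w\<in>verts Q. \<Sum>k<d w. rel_entry Q d M y w v i k * rel_entry Q d M x u w k j)"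
proof -
  interpret fin_digraph Q by fact
  let ?xy = "x \<otimes>\<^bsub>path_algebra Q\<^esub> y"
  let ?pm = "path_mat Q d M"
  define X where "X w = {p. x (u, p) \<noteq> 0 \<and> awalk u p w}" for w
  define Y where "Y w = {p. y (w, p) \<noteq> 0 \<and> awalk w p v}" for w
  define S where "S = (SIGMA w:verts Q. X w \<times> Y w)"
  define ap where "ap = (\<lambda>(w :: 'v, p :: 'a list, q :: 'a list). p @ q)"
  have fX: "finite (X w)" and fY: "finite (Y w)" for w
    unfolding X_def Y_def by (rule path_algebra_finite[OF x], rule path_algebra_finite[OF y])
  have fS: "finite S" unfolding S_def using fX fY by simp
  have mul: "?xy (u, p) = (\<Sum>k\<le>length p. x (u, take k p) * y (path_target Q u (take k p), drop k p))" for p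
    by (simp add: path_algebra_def)
  have aw: "awalk u (ap s) v" if "s \<in> S" for s
    using that by (auto simp: S_def X_def Y_def ap_def intro: awalk_append)
  \<comment> \<open>The triples in S with concatenation p correspond to the cut positions k of p at
    which the summand is nonzero.\<close>
  have split: "?xy (u, p) = (\<Sum>s | s \<in> S \<and> ap s = p. x (u, fst (snd s)) * y (fst s, snd (snd s)))" if p: "awalk u p v" for p
  proof -
    let ?K = "{k\<in>{..length p}. x (u, take k p) \<noteq> 0 \<and> y (path_target Q u (take k p), drop k p) \<noteq> 0}"
    have "?xy (u, p) = (\<Sum>k\<in>?K. x (u, take k p) * y (path_target Q u (take k p), drop k p))"
      unfolding mul by (rule sum.mono_neutral_right) auto
    also have "\<dots> = (\<Sum>s | s \<in> S \<and> ap s = p. x (u, fst (snd s)) * y (fst s, snd (snd s)))"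
    proof (rule sum.reindex_bij_witness[where j = "\<lambda>k. (path_target Q u (take k p), take k p, drop k p)"
          and i = "\<lambda>s. length (fst (snd s))"])
      fix k assume k: "k \<in> ?K"
      obtain w where w: "awalk u (take k p) w" "awalk w (drop k p) v"
        using awalk_append_iff[of u "take k p" "drop k p" v] p by auto
      moreover have "path_target Q u (take k p) = w" by (rule awalk_path_target[OF w(1)])
      moreover have "w \<in> verts Q" using w by auto
      ultimately show "(path_target Q u (take k p), take k p, drop k p) \<in> {s. s \<in> S \<and> ap s = p}"
        using k by (auto simp: S_def X_def Y_def ap_def)
    next
      fix s assume "s \<in> {s. s \<in> S \<and> ap s = p}"
      moreover obtain w p1 p2 where s: "s = (w, p1, p2)" by (metis prod_cases3)
      ultimately have 1: "awalk u p1 w" "p = p1 @ p2" "x (u, p1) \<noteq> 0" "y (w, p2) \<noteq> 0"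
        by (auto simp: S_def X_def Y_def ap_def)
      then have 2: "path_target Q u p1 = w" by (intro awalk_path_target)
      show "length (fst (snd s)) \<in> ?K" using 1 2 s by simp
      show "(path_target Q u (take (length (fst (snd s))) p), take (length (fst (snd s))) p, drop (length (fst (snd s))) p) = s"
        using 1 2 s by simp
    qed auto
    finally show ?thesis .
  qed
  have sub: "{p. ?xy (u, p) \<noteq> 0 \<and> awalk u p v} \<subseteq> ap ` S"
  proof clarify
    fix p assume p: "?xy (u, p) \<noteq> 0" "awalk u p v"
    show "p \<in> ap ` S"
    proof (rule ccontr)
      assume "p \<notin> ap ` S"
      then have e: "{s. s \<in> S \<and> ap s = p} = {}" by auto
      have "?xy (u, p) = 0" unfolding split[OF p(2)] e by (rule sum.empty)
      then show False using p(1) by simp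
    qed
  qed
  have "rel_entry Q d M ?xy u v i j = (\<Sum>p\<in>ap ` S. ?xy (u, p) * ?pm u p $$ (i, j))"
    by (rule rel_entry_superset) (use fS sub aw in auto)
  also have "\<dots> = (\<Sum>p\<in>ap ` S. \<Sum>s | s \<in> S \<and> ap s = p. x (u, fst (snd s)) * y (fst s, snd (snd s)) * ?pm u (ap s) $$ (i, j))"
    using aw by (intro sum.cong refl) (auto simp: split sum_distrib_right)
  also have "\<dots> = (\<Sum>s\<in>S. x (u, fst (snd s)) * y (fst s, snd (snd s)) * ?pm u (ap s) $$ (i, j))"
    by (rule sum.group) (use fS in auto)
  also have "\<dots> = (\<Sum>w\<in>verts Q. \<Sum>p\<in>X w. \<Sum>q\<in>Y w. x (u, p) * y (w, q) * ?pm u (p @ q) $$ (i, j))"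
  proof -
    have "(\<Sum>s\<in>S. f s) = (\<Sum>w\<in>verts Q. \<Sum>z\<in>X w \<times> Y w. f (w, z))" for f :: "_ \<Rightarrow> 'k"
      unfolding S_def using fX fY finite_verts by (subst sum.Sigma) (auto simp: case_prod_unfold)
    then show ?thesis by (simp add: sum.cartesian_product' ap_def)
  qed
  also have "\<dots> = (\<Sum>w\<in>verts Q. \<Sum>p\<in>X w. \<Sum>q\<in>Y w. \<Sum>k<d w. (y (w, q) * ?pm w q $$ (i, k)) * (x (u, p) * ?pm u p $$ (k, j)))"
  proof (intro sum.cong refl)
    fix w p q assume "p \<in> X w" "q \<in> Y w"
    then have p: "awalk u p w" and q: "awalk w q v" by (auto simp: X_def Y_def)
    have "?pm u (p @ q) $$ (i, j) = (?pm w q * ?pm u p) $$ (i, j)" by (simp add: path_mat_append[OF Q M q p])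
    also have "\<dots> = (\<Sum>k<d w. ?pm w q $$ (i, k) * ?pm u p $$ (k, j))"
      using carrier_matD[OF path_mat_carrier[OF Q M q]] carrier_matD[OF path_mat_carrier[OF Q M p]] i j
      by (simp add: scalar_prod_def atLeast0LessThan)
    finally show "x (u, p) * y (w, q) * ?pm u (p @ q) $$ (i, j) =
        (\<Sum>k<d w. (y (w, q) * ?pm w q $$ (i, k)) * (x (u, p) * ?pm u p $$ (k, j)))"
      by (simp add: sum_distrib_left mult_ac)
  qed
  also have "\<dots> = (\<Sum>w\<in>verts Q. \<Sum>k<d w. rel_entry Q d M y w v i k * rel_entry Q d M x u w k j)"
  proof (rule sum.cong[OF refl])
    fix w
    have "(\<Sum>p\<in>X w. \<Sum>q\<in>Y w. \<Sum>k<d w. (y (w, q) * ?pm w q $$ (i, k)) * (x (u, p) * ?pm u p $$ (k, j))) =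
        (\<Sum>k<d w. \<Sum>q\<in>Y w. \<Sum>p\<in>X w. (y (w, q) * ?pm w q $$ (i, k)) * (x (u, p) * ?pm u p $$ (k, j)))"
      by (rule trans[OF sum.swap], rule trans[OF sum.cong[OF refl sum.swap]], rule sum.swap)
    then show "(\<Sum>p\<in>X w. \<Sum>q\<in>Y w. \<Sum>k<d w. (y (w, q) * ?pm w q $$ (i, k)) * (x (u, p) * ?pm u p $$ (k, j))) =
        (\<Sum>k<d w. rel_entry Q d M y w v i k * rel_entry Q d M x u w k j)"
      unfolding rel_entry_def X_def[symmetric] Y_def[symmetric] sum_product .
  qed
  finally show ?thesis .
qed

text \<open>\<open>arrow_ideal_power\<close> multiplies by the arrow ideal on the right, so the last
  arrow is the one to split off.\<close>

lemma path_elem_arrow_ideal_power: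
  assumes Q: "fin_digraph Q"
  shows "pre_digraph.awalk Q u p v \<Longrightarrow> length p = m \<Longrightarrow>
    (path_elem (u, p) :: 'v \<times> 'a list \<Rightarrow> 'k::field) \<in> arrow_ideal_power Q m"
proof (induction m arbitrary: p v)
  case 0
  interpret fin_digraph Q by fact
  have "{w. (path_elem (u, p) :: _ \<Rightarrow> 'k) w \<noteq> 0} = {(u, p)}" by (auto simp: path_elem_def)
  then show ?case using 0 by (auto simp: arrow_ideal_power_def path_algebra_def quiver_paths_def)
next
  case (Suc m)
  interpret fin_digraph Q by fact
  let ?A = "path_algebra Q :: ('v \<times> 'a list \<Rightarrow> 'k) ring"
  from Suc.prems obtain q a where p: "p = q @ [a]" by (metis length_Suc_conv_rev)
  then obtain w where w: "awalk u q w" "awalk w [a] v" using Suc.prems by (auto simp: awalk_append_iff)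
  then have a: "a \<in> arcs Q" "w = tail Q a" by (auto simp: awalk_Cons_iff)
  have q: "(path_elem (u, q) :: _ \<Rightarrow> 'k) \<in> arrow_ideal_power Q m" using Suc.IH[OF w(1)] Suc.prems p by simp
  have "{path_elem (tail Q a, [a]) | a. a \<in> arcs Q} \<subseteq> carrier ?A"
  proof clarify
    fix a assume "a \<in> arcs Q"
    moreover have "{w. (path_elem (tail Q a, [a]) :: _ \<Rightarrow> 'k) w \<noteq> 0} = {(tail Q a, [a])}" by (auto simp: path_elem_def)
    moreover have "awalk (tail Q a) [a] (head Q a)" using \<open>a \<in> arcs Q\<close> by (simp add: arc_implies_awalk)
    ultimately show "path_elem (tail Q a, [a]) \<in> carrier ?A"
      by (auto simp: path_algebra_def quiver_paths_def)
  qed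
  then have "path_elem (tail Q a, [a]) \<in> (arrow_ideal Q :: (_ \<Rightarrow> 'k) set)"
    unfolding arrow_ideal_def using a ring.genideal_self[OF ring_path_algebra[OF Q]] by blast
  then have "path_elem (u, q) \<otimes>\<^bsub>?A\<^esub> path_elem (tail Q a, [a]) \<in> arrow_ideal_power Q (Suc m)"
    using q unfolding arrow_ideal_power_def by (simp add: ideal_prod.prod)
  moreover have "path_elem (u, q) \<otimes>\<^bsub>?A\<^esub> path_elem (tail Q a, [a]) = path_elem (u, p)"
  proof (rule ext, clarify)
    fix u' p'
    have "(path_elem (u, q) \<otimes>\<^bsub>?A\<^esub> path_elem (tail Q a, [a])) (u', p') =
        (\<Sum>k\<le>length p'. if (u', take k p') = (u, q) \<and> (path_target Q u' (take k p'), drop k p') = (tail Q a, [a]) then 1 else 0)"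
      by (simp add: path_algebra_def path_elem_def) (rule sum.cong, auto)
    also have "\<dots> = (\<Sum>k\<le>length p'. if k = length q then (if (u', p') = (u, p) then 1 else 0) else 0)"
    proof (intro sum.cong refl)
      fix k assume "k \<in> {..length p'}"
      then have "(u', take k p') = (u, q) \<and> (path_target Q u' (take k p'), drop k p') = (tail Q a, [a]) \<longleftrightarrow>
          k = length q \<and> (u', p') = (u, p)"
        using awalk_path_target[OF w(1)] a(2) p by auto (metis append_take_drop_id)
      then show "(if (u', take k p') = (u, q) \<and> (path_target Q u' (take k p'), drop k p') = (tail Q a, [a]) then 1 else 0) =
          (if k = length q then (if (u', p') = (u, p) then 1 else 0) else (0::'k))" by auto
    qed
    also have "\<dots> = path_elem (u, p) (u', p')"
      using p by (auto simp: path_elem_def)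
    finally show "(path_elem (u, q) \<otimes>\<^bsub>?A\<^esub> path_elem (tail Q a, [a])) (u', p') = path_elem (u, p) (u', p')" .
  qed
  ultimately show ?case by simp
qed

text \<open>The elements of KQ that act as zero on M form an ideal containing R, hence containing
  the ideal of relations and with it a power of the arrow ideal. The exponent m is taken from
  admissibility alone, so it serves all d and M.\<close>

lemma admissible_nilpotent:
  fixes R :: "('v \<times> 'a list \<Rightarrow> 'k::field) set"
  assumes Q: "fin_digraph Q" and R: "\<forall>r\<in>R. quiver_relation Q r"
    and adm: "admissible Q (Idl\<^bsub>path_algebra Q\<^esub> R)"
  obtains m where "\<And>d M u p v. M \<in> rep_variety Q R d \<Longrightarrow> pre_digraph.awalk Q u p v \<Longrightarrow> m \<le> length p \<Longrightarrow>
    path_mat Q d M u p = 0\<^sub>m (d v) (d u)"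
proof -
  interpret fin_digraph Q by fact
  let ?A = "path_algebra Q :: ('v \<times> 'a list \<Rightarrow> 'k) ring"
  interpret A: ring ?A by (rule ring_path_algebra[OF Q])
  obtain m where m: "arrow_ideal_power Q m \<subseteq> Idl\<^bsub>?A\<^esub> R" using adm by (auto simp: admissible_def)
  show thesis
  proof (rule that[of m])
    fix d M u p v assume M: "M \<in> rep_variety Q R d" and p: "awalk u p v" and len: "m \<le> length p"
    have Ms: "M \<in> rep_space Q d" using M by (simp add: rep_variety_def)
    define J where "J = {r \<in> carrier ?A. \<forall>u\<in>verts Q. \<forall>v\<in>verts Q. \<forall>i<d v. \<forall>j<d u. rel_entry Q d M r u v i j = 0}"
    have "ideal J ?A"
    proof (rule idealI[OF ring_path_algebra[OF Q]])
      show "subgroup J (add_monoid ?A)"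
      proof (rule A.add.subgroupI)
        show "J \<subseteq> carrier ?A" by (auto simp: J_def)
        have "\<zero>\<^bsub>?A\<^esub> \<in> J" by (auto simp: J_def path_algebra_def rel_entry_def)
        then show "J \<noteq> {}" by blast
      next
        fix r assume r: "r \<in> J"
        have rc: "r \<in> carrier ?A" using r by (simp add: J_def)
        have mc: "- r \<in> carrier ?A" using rc by (simp add: path_algebra_def)
        have "\<ominus>\<^bsub>?A\<^esub> r = - r"
          by (rule A.minus_equality) (use rc mc in \<open>auto simp: path_algebra_def\<close>)
        moreover have "rel_entry Q d M (- r) u v i j = - rel_entry Q d M r u v i j" for u v i j
          by (simp add: rel_entry_def sum_negf)
        ultimately show "\<ominus>\<^bsub>?A\<^esub> r \<in> J" using r mc by (auto simp: J_def)
      next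
        fix r s assume rs: "r \<in> J" "s \<in> J"
        then have c: "r \<in> carrier ?A" "s \<in> carrier ?A" by (auto simp: J_def)
        have "r \<oplus>\<^bsub>?A\<^esub> s = r + s" by (simp add: path_algebra_def)
        moreover have "r \<oplus>\<^bsub>?A\<^esub> s \<in> carrier ?A" using c by simp
        ultimately show "r \<oplus>\<^bsub>?A\<^esub> s \<in> J" using rs by (auto simp: J_def rel_entry_add[OF c])
      qed
    next
      fix r x assume r: "r \<in> J" and x: "x \<in> carrier ?A"
      have rc: "r \<in> carrier ?A" using r by (simp add: J_def)
      show "x \<otimes>\<^bsub>?A\<^esub> r \<in> J"
        using r x rc by (auto simp: J_def rel_entry_mult[OF Q Ms x rc] intro!: sum.neutral)
      show "r \<otimes>\<^bsub>?A\<^esub> x \<in> J"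
        using r x rc by (auto simp: J_def rel_entry_mult[OF Q Ms rc x] intro!: sum.neutral)
    qed
    moreover have "R \<subseteq> J"
      using M R by (auto simp: J_def rep_variety_def quiver_relation_def eval_rel_zero_iff)
    ultimately have IJ: "Idl\<^bsub>?A\<^esub> R \<subseteq> J" by (rule A.genideal_minimal)
    define q where "q = take m p"
    have "awalk u (q @ drop m p) v" using p by (simp add: q_def)
    then obtain w where q: "awalk u q w" and r: "awalk w (drop m p) v" by (auto simp: awalk_append_iff)
    have "length q = m" using len by (simp add: q_def)
    then have "(path_elem (u, q) :: _ \<Rightarrow> 'k) \<in> J"
      using path_elem_arrow_ideal_power[OF Q q] m IJ by blast
    moreover have "u \<in> verts Q" "w \<in> verts Q" using q by auto
    ultimately have J: "rel_entry Q d M (path_elem (u, q)) u w i j = 0" if "i < d w" "j < d u" for i j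
      using that by (auto simp: J_def)
    have "{p. (path_elem (u, q) :: _ \<Rightarrow> 'k) (u, p) \<noteq> 0 \<and> awalk u p w} = {q}"
      using q by (auto simp: path_elem_def)
    then have "path_mat Q d M u q $$ (i, j) = 0" if "i < d w" "j < d u" for i j
      using J[OF that] by (simp add: rel_entry_def path_elem_def)
    then have "path_mat Q d M u q = 0\<^sub>m (d w) (d u)"
      using carrier_matD[OF path_mat_carrier[OF Q Ms q]] by (intro eq_matI) auto
    moreover have "path_mat Q d M u p = path_mat Q d M w (drop m p) * path_mat Q d M u q"
      using path_mat_append[OF Q Ms r q] by (simp add: q_def)
    ultimately show "path_mat Q d M u p = 0\<^sub>m (d v) (d u)"
      using path_mat_carrier[OF Q Ms r] by (simp add: right_mult_zero_mat)
  qed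
qed

section \<open>Block determinants are determinantal semi-invariants\<close>

definition in_idx :: "('v, 'a) pre_digraph \<Rightarrow> ('v \<Rightarrow> nat) \<Rightarrow> 'v \<Rightarrow> (('v + 'a) \<times> nat) set" where
  "in_idx Q N v = (SIGMA b : {b \<in> darcs Q. tgt Q b = v}. {..<N (src Q b)})"

lemma in_idx: "fin_digraph Q \<Longrightarrow> finite (in_idx Q N v)" "fin_digraph Q \<Longrightarrow> card (in_idx Q N v) = in_dim Q N v"
  by (simp_all add: in_idx_def in_dim_def finite_darcs)

text \<open>The vertex (v, 1) carries the quotient of the incoming space by m v vectors: the
  coefficients x of a block determinant become a subspace that V annihilates. The subtraction is
  exact once m v \<le> \<open>in_dim Q N v\<close>.\<close>

definition cdim :: "('v, 'a) pre_digraph \<Rightarrow> ('v \<Rightarrow> nat) \<Rightarrow> ('v \<Rightarrow> nat) \<Rightarrow> 'v \<times> nat \<Rightarrow> nat" where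
  "cdim Q m N = (\<lambda>(v, z). if z = 0 then N v else in_dim Q N v - m v)"

lemma cdim_simps [simp]: "cdim Q m N (v, 0) = N v" "cdim Q m N (v, Suc 0) = in_dim Q N v - m v"
  by (simp_all add: cdim_def)

lemma sdet_uminus: "sdet S (\<lambda>i j. - A i j) = (- 1) ^ card S * sdet S A"
  unfolding sdet_def sum_distrib_left by (intro sum.cong refl) (simp add: prod_uminus mult_ac)

lemma card_cdim:
  assumes Q: "fin_digraph Q" and m: "\<And>v. v \<in> verts Q \<Longrightarrow> m v \<le> in_dim Q N v"
    and sum_eq: "(\<Sum>v\<in>verts Q. m v * d v) = (\<Sum>v\<in>verts Q. N v * d v)"
  shows "card (src_idx Q (cdim Q m N) d) = (\<Sum>v\<in>verts Q. d v * in_dim Q N v)"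
    "card (tgt_idx Q (cdim Q m N) d) = (\<Sum>v\<in>verts Q. d v * in_dim Q N v)"
proof -
  have "card (src_idx Q (cdim Q m N) d) + (\<Sum>v\<in>verts Q. m v * d v) =
      (\<Sum>v\<in>verts Q. d v * (N v + (in_dim Q N v - m v)) + m v * d v)"
    by (simp add: card_idx[OF Q] sum.distrib)
  also have "\<dots> = (\<Sum>v\<in>verts Q. d v * in_dim Q N v + N v * d v)"
  proof (rule sum.cong[OF refl])
    fix v assume "v \<in> verts Q"
    then have "in_dim Q N v = (in_dim Q N v - m v) + m v" using m by simp
    then show "d v * (N v + (in_dim Q N v - m v)) + m v * d v = d v * in_dim Q N v + N v * d v"
      by (metis add.assoc add.commute distrib_left mult.commute)
  qed
  finally show "card (src_idx Q (cdim Q m N) d) = (\<Sum>v\<in>verts Q. d v * in_dim Q N v)"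
    using sum_eq by (simp add: sum.distrib)
  show "card (tgt_idx Q (cdim Q m N) d) = (\<Sum>v\<in>verts Q. d v * in_dim Q N v)"
    by (simp add: card_idx[OF Q])
qed

text \<open>
  At each sink \<open>(v, 1)\<close>, \<open>X v\<close> is a basis of the incoming space whose last \<open>m v\<close> vectors are the
  columns of \<open>x\<close>, and \<open>V\<close> is the projection onto the other coordinates. In these coordinates
  the Schofield map is block triangular, with the identity and \<open>-x\<close> as diagonal blocks.
\<close>

lemma block_poly_invertible:
  fixes x :: "'v + 'a \<Rightarrow> nat \<Rightarrow> nat \<Rightarrow> 'k::field"
  assumes Q: "fin_digraph Q" and m: "\<And>v. v \<in> verts Q \<Longrightarrow> m v \<le> in_dim Q N v"
    and sum_eq: "(\<Sum>v\<in>verts Q. m v * d v) = (\<Sum>v\<in>verts Q. N v * d v)"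
    and pos: "\<And>v. v \<in> verts Q \<Longrightarrow> bij_betw (pos v) (in_idx Q N v) {..<in_dim Q N v}"
    and X: "\<And>v. v \<in> verts Q \<Longrightarrow> X v \<in> carrier_mat (in_dim Q N v) (in_dim Q N v)"
    and Y: "\<And>v. v \<in> verts Q \<Longrightarrow> Y v \<in> carrier_mat (in_dim Q N v) (in_dim Q N v)"
    and YX: "\<And>v. v \<in> verts Q \<Longrightarrow> Y v * X v = 1\<^sub>m (in_dim Q N v)"
    and x: "\<And>b q j. b \<in> darcs Q \<Longrightarrow> q < N (src Q b) \<Longrightarrow> j < m (tgt Q b) \<Longrightarrow>
      x b q j = X (tgt Q b) $$ (pos (tgt Q b) (b, q), in_dim Q N (tgt Q b) - m (tgt Q b) + j)"
    and V: "V = (\<lambda>b\<in>darcs Q. mat (in_dim Q N (tgt Q b) - m (tgt Q b)) (N (src Q b))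
      (\<lambda>(r, q). Y (tgt Q b) $$ (r, pos (tgt Q b) (b, q))))"
  shows "\<exists>\<kappa>. \<forall>W. block_poly Q d m N x W =
    \<kappa> * detI (tgt_idx Q (cdim Q m N) d) (src_idx Q (cdim Q m N) d) (sentry Q V W)"
proof -
  interpret fin_digraph Q by fact
  let ?n = "in_dim Q N"
  let ?c = "cdim Q m N"
  define c1 where "c1 v = ?n v - m v" for v
  let ?T = "tgt_idx Q ?c d" and ?S = "src_idx Q ?c d" and ?B = "brk Q d ?n"
  have fT: "finite ?T" and fS: "finite ?S" using finite_idx[OF Q] by auto
  have fB: "finite (brk Q d k)" for k by (rule finite_brk[OF Q])
  have cT: "card ?T = card ?B" and cS: "card ?S = card ?B"
    using card_cdim[OF Q m sum_eq] by (simp_all add: card_brk[OF Q] mult.commute)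
  \<comment> \<open>Row operations by the transpose of X on each incoming space, tensored with the
    identity of size d v; Ri is the inverse, built from Y.\<close>
  define Rm where "Rm = (\<lambda>(v, r, p :: nat) (b, p', q). if tgt Q b = v \<and> p = p' then X v $$ (pos v (b, q), r) else 0)"
  define Ri where "Ri = (\<lambda>(b, p' :: nat, q) (v, r, p). if tgt Q b = v \<and> p = p' then Y v $$ (r, pos v (b, q)) else 0)"
  have sumT: "(\<Sum>t\<in>?T. Rm (v, r, p) t * f t) = (\<Sum>s\<in>in_idx Q N v. X v $$ (pos v s, r) * f (fst s, p, snd s))"
    if "v \<in> verts Q" "p < d v" for v r p f
  proof -
    have "(\<Sum>t\<in>?T. Rm (v, r, p) t * f t) = (\<Sum>t\<in>(\<lambda>s. (fst s, p, snd s)) ` in_idx Q N v. Rm (v, r, p) t * f t)"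
    proof (rule sum.mono_neutral_right[OF fT])
      show "(\<lambda>s. (fst s, p, snd s)) ` in_idx Q N v \<subseteq> ?T" using that by (auto simp: in_idx_def tgt_idx_def)
      show "\<forall>t\<in>?T - (\<lambda>s. (fst s, p, snd s)) ` in_idx Q N v. Rm (v, r, p) t * f t = 0"
      proof clarify
        fix b p' q assume "(b, p', q) \<in> ?T" and ni: "(b, p', q) \<notin> (\<lambda>s. (fst s, p, snd s)) ` in_idx Q N v"
        then have "\<not> (tgt Q b = v \<and> p = p')"
          by (force simp: in_idx_def tgt_idx_def)
        then show "Rm (v, r, p) (b, p', q) * f (b, p', q) = 0" by (auto simp: Rm_def)
      qed
    qed
    also have "\<dots> = (\<Sum>s\<in>in_idx Q N v. X v $$ (pos v s, r) * f (fst s, p, snd s))"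
      by (subst sum.reindex) (auto simp: inj_on_def Rm_def in_idx_def intro!: sum.cong)
    finally show ?thesis .
  qed
  have sumI: "(\<Sum>s\<in>in_idx Q N v. X v $$ (pos v s, r) * Y v $$ (r', pos v s)) = (if r = r' then 1 else 0)"
    if v: "v \<in> verts Q" "r < ?n v" "r' < ?n v" for v r r'
  proof -
    have "(\<Sum>s\<in>in_idx Q N v. X v $$ (pos v s, r) * Y v $$ (r', pos v s)) = (\<Sum>k<?n v. X v $$ (k, r) * Y v $$ (r', k))"
      by (rule sum.reindex_bij_betw[OF pos[OF v(1)]])
    also have "\<dots> = (Y v * X v) $$ (r', r)"
      using carrier_matD[OF X[OF v(1)]] carrier_matD[OF Y[OF v(1)]] v
      by (simp add: scalar_prod_def atLeast0LessThan mult.commute)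
    finally show ?thesis using v by (simp add: YX)
  qed
  have Rm0: "detI ?B ?T Rm \<noteq> 0"
  proof -
    have "detI ?B ?B (\<lambda>r c. \<Sum>t\<in>?T. Rm r t * Ri t c) = detI ?B ?B (\<lambda>r c. if r = c then 1 else 0)"
    proof (rule detI_cong)
      fix r c assume "r \<in> ?B" "c \<in> ?B"
      moreover obtain v k p where r: "r = (v, k, p)" by (metis prod_cases3)
      moreover obtain v' k' p' where c: "c = (v', k', p')" by (metis prod_cases3)
      ultimately have v: "v \<in> verts Q" "k < ?n v" "p < d v" "v' \<in> verts Q" "k' < ?n v'" "p' < d v'"
        by (auto simp: brk_def)
      have "(\<Sum>t\<in>?T. Rm r t * Ri t c) = (\<Sum>s\<in>in_idx Q N v. X v $$ (pos v s, k) * Ri (fst s, p, snd s) c)"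
        unfolding r using v by (intro sumT)
      also have "\<dots> = (\<Sum>s\<in>in_idx Q N v. if v = v' \<and> p = p' then X v $$ (pos v s, k) * Y v $$ (k', pos v s) else 0)"
        by (rule sum.cong[OF refl]) (auto simp: Ri_def c in_idx_def)
      also have "\<dots> = (if r = c then 1 else 0)"
      proof (cases "v = v' \<and> p = p'")
        case True
        then show ?thesis using v sumI[of v k k'] by (simp add: r c)
      next
        case False
        show ?thesis unfolding if_not_P[OF False] using False by (auto simp: r c)
      qed
      finally show "(\<Sum>t\<in>?T. Rm r t * Ri t c) = (if r = c then 1 else 0)" .
    qed
    then have "detI ?B ?T Rm * detI ?T ?B Ri = 1"
      using detI_mult[OF fT cT[symmetric] cT[symmetric], of Rm Ri] by (simp add: detI_same[OF fB] sdet_one[OF fB])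
    then show ?thesis by auto
  qed
  \<comment> \<open>The Schofield matrix after these row operations. Since Y X = 1, V becomes a
    coordinate projection and contributes identity entries in the columns (u, 1); the columns (u, 0)
    pair X with W.\<close>
  define E where "E W = (\<lambda>(v, r, p :: nat) ((u, z :: nat), p', q'). if z = 1 then (if u = v \<and> p = p' \<and> q' = r then 1 else 0)
      else - (\<Sum>b | b \<in> darcs Q \<and> src Q b = u \<and> tgt Q b = v. X v $$ (pos v (b, q'), r) * W b p p'))"
    for W :: "'v + 'a \<Rightarrow> nat \<Rightarrow> nat \<Rightarrow> 'k"
  have ERm: "detI ?B ?S (E W) = detI ?B ?T Rm * detI ?T ?S (sentry Q V W)" for W
  proof -
    have "detI ?B ?S (\<lambda>r s. \<Sum>t\<in>?T. Rm r t * sentry Q V W t s) = detI ?B ?S (E W)"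
    proof (rule detI_cong)
      fix r s assume "r \<in> ?B" "s \<in> ?S"
      moreover obtain v k p where r: "r = (v, k, p)" by (metis prod_cases3)
      moreover obtain u z p' q' where s: "s = ((u, z), p', q')" by (metis prod.exhaust)
      ultimately have v: "v \<in> verts Q" "k < ?n v" "p < d v" and u: "u \<in> verts Q" "z = 0 \<or> z = 1" "p' < d u" "q' < ?c (u, z)"
        by (auto simp: brk_def src_idx_def)
      have "(\<Sum>t\<in>?T. Rm r t * sentry Q V W t s) =
          (\<Sum>s'\<in>in_idx Q N v. X v $$ (pos v s', k) * sentry Q V W (fst s', p, snd s') s)"
        unfolding r using v by (intro sumT)
      also have "\<dots> = E W r s"
      proof (cases "z = 1")
        case True
        have "(\<Sum>s'\<in>in_idx Q N v. X v $$ (pos v s', k) * sentry Q V W (fst s', p, snd s') s) =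
            (\<Sum>s'\<in>in_idx Q N v. if u = v \<and> p = p' then X v $$ (pos v s', k) * Y v $$ (q', pos v s') else 0)"
        proof (rule sum.cong[OF refl])
          fix s' assume "s' \<in> in_idx Q N v"
          moreover obtain b q where s': "s' = (b, q)" by (metis prod.exhaust)
          ultimately have b: "b \<in> darcs Q" "tgt Q b = v" "q < N (src Q b)" by (simp_all add: in_idx_def)
          show "X v $$ (pos v s', k) * sentry Q V W (fst s', p, snd s') s =
              (if u = v \<and> p = p' then X v $$ (pos v s', k) * Y v $$ (q', pos v s') else 0)"
          proof (cases "u = v \<and> p = p'")
            case uv: True
            then have "q' < ?n v - m v" using u True by simp
            then have "V b $$ (q', q) = Y v $$ (q', pos v (b, q))" using b unfolding V by simp
            then show ?thesis using uv True b by (simp add: sentry_def s s')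
          next
            case uv: False
            show ?thesis unfolding if_not_P[OF uv] using uv True b by (auto simp: sentry_def s s')
          qed
        qed
        also have "\<dots> = E W r s"
        proof (cases "u = v \<and> p = p'")
          case uv: True
          then have "q' < ?n v" using u True by simp
          then show ?thesis using v True uv sumI[of v k q'] by (auto simp: E_def r s)
        next
          case uv: False
          show ?thesis unfolding if_not_P[OF uv] using uv True by (auto simp: E_def r s)
        qed
        finally show ?thesis .
      next
        case False
        then have z: "z = 0" using u by simp
        have "(\<Sum>s'\<in>in_idx Q N v. X v $$ (pos v s', k) * sentry Q V W (fst s', p, snd s') s) =
            (\<Sum>s'\<in>in_idx Q N v. if src Q (fst s') = u \<and> snd s' = q' then - (X v $$ (pos v s', k) * W (fst s') p p') else 0)"
          by (intro sum.cong refl) (auto simp: sentry_def s z)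
        also have "\<dots> = (\<Sum>s'\<in>(\<lambda>b. (b, q')) ` {b. b \<in> darcs Q \<and> src Q b = u \<and> tgt Q b = v}. - (X v $$ (pos v s', k) * W (fst s') p p'))"
          using u z by (intro sum.mono_neutral_cong_right in_idx[OF Q]) (auto simp: in_idx_def)
        also have "\<dots> = E W r s"
          by (subst sum.reindex) (auto simp: inj_on_def E_def r s z sum_negf)
        finally show ?thesis .
      qed
      finally show "(\<Sum>t\<in>?T. Rm r t * sentry Q V W t s) = E W r s" .
    qed
    then show ?thesis using detI_mult[OF fT cT[symmetric], of ?S Rm "sentry Q V W"] cT cS by simp
  qed
  \<comment> \<open>Any bijection between rows and columns of the block matrix will do, as it
    affects \<open>detI\<close> by a sign independent of W.\<close>
  have "card (brk Q d m) = card (brk Q d N)" by (simp add: card_brk[OF Q] sum_eq)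
  then obtain h0 where h0: "bij_betw h0 (brk Q d m) (brk Q d N)"
    using fB by (metis finite_same_card_bij)
  define B1 where "B1 = {(v, r, p) \<in> ?B. r < c1 v}"
  define g where "g = (\<lambda>(v :: 'v, j :: nat, i :: nat). (v, c1 v + j, i))"
  define g' where "g' = (\<lambda>(v :: 'v, r :: nat, p :: nat). (v, r - c1 v, p))"
  define h where "h = (\<lambda>(v :: 'v, k :: nat, l :: nat). ((v, 0 :: nat), l, k))"
  \<comment> \<open>The first c1 v rows at v are matched with their pivot columns at (v, 1), the
    last m v rows through h0 with the columns at the vertices (u, 0).\<close>
  define f where "f = (\<lambda>(v, r, p). if r < c1 v then ((v, 1), p, r) else h (h0 (g' (v, r, p))))"
  have c1m: "c1 v + m v = ?n v" if "v \<in> verts Q" for v using m[OF that] by (simp add: c1_def)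
  have injg: "inj_on g A" for A by (auto simp: inj_on_def g_def)
  have g'g: "g' (g s) = s" for s by (cases s) (simp add: g_def g'_def)
  have Bun: "?B = g ` brk Q d m \<union> B1" "g ` brk Q d m \<inter> B1 = {}"
  proof -
    have "g ` brk Q d m \<subseteq> ?B" using c1m by (fastforce simp: g_def brk_def)
    moreover have "s \<in> g ` brk Q d m" if s: "s \<in> ?B" "s \<notin> B1" for s
    proof -
      obtain v r p where srp: "s = (v, r, p)" by (metis prod_cases3)
      then have "v \<in> verts Q" "c1 v \<le> r" "r < ?n v" "p < d v" using s by (auto simp: B1_def brk_def)
      then have "s = g (v, r - c1 v, p)" "(v, r - c1 v, p) \<in> brk Q d m"
        using c1m[of v] by (auto simp: g_def srp brk_def)
      then show ?thesis by blast
    qed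
    moreover have "B1 \<subseteq> ?B" by (auto simp: B1_def)
    ultimately show "?B = g ` brk Q d m \<union> B1" by blast
    show "g ` brk Q d m \<inter> B1 = {}" by (auto simp: g_def B1_def)
  qed
  have f1: "f (v, r, p) = ((v, 1), p, r)" if "(v, r, p) \<in> B1" for v r p
    using that by (simp add: f_def B1_def)
  have f2: "f (g s) = h (h0 s)" for s
    by (cases s) (simp add: f_def g_def g'_def)
  have bij: "bij_betw f ?B ?S"
  proof -
    have "inj_on f ?B"
    proof -
      have "inj_on f B1" by (auto simp: inj_on_def f_def B1_def)
      moreover have "inj_on f (g ` brk Q d m)"
      proof (rule inj_onI, elim imageE, simp only: f2)
        fix s t assume "s \<in> brk Q d m" "t \<in> brk Q d m" "h (h0 s) = h (h0 t)"
        moreover have "inj h" by (auto simp: inj_on_def h_def)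
        ultimately show "g s = g t" using h0 by (metis bij_betw_def injD inj_onD)
      qed
      moreover have "f ` g ` brk Q d m \<inter> f ` B1 = {}"
        by (auto simp: f2 f1 h_def split: prod.splits)
      ultimately show ?thesis unfolding Bun(1) inj_on_Un by blast
    qed
    moreover have "f ` ?B \<subseteq> ?S"
    proof -
      have "f ` B1 \<subseteq> ?S" by (auto simp: f_def B1_def brk_def src_idx_def c1_def)
      moreover have "h (h0 s) \<in> ?S" if "s \<in> brk Q d m" for s
      proof -
        have "h0 s \<in> brk Q d N" using h0 that by (auto simp: bij_betw_def)
        then show ?thesis by (auto simp: h_def brk_def src_idx_def split: prod.splits)
      qed
      ultimately show ?thesis unfolding Bun(1) by (auto simp: f2)
    qed
    ultimately show ?thesis
      using cS fS by (simp add: bij_betw_def card_image card_subset_eq)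
  qed
  obtain \<epsilon> :: 'k where \<epsilon>: "\<epsilon> * \<epsilon> = 1" "\<And>A. detI ?B ?S A = \<epsilon> * sdet ?B (\<lambda>r r'. A r (f r'))"
    using detI_bij[OF bij fB] by blast
  obtain \<epsilon>' :: 'k where \<epsilon>': "\<epsilon>' * \<epsilon>' = 1"
    "\<And>A. detI (brk Q d m) (brk Q d N) A = \<epsilon>' * sdet (brk Q d m) (\<lambda>r r'. A r (h0 r'))"
    using detI_bij[OF h0 fB] by blast
  let ?tt = "card (brk Q d m)"
  let ?P = "\<lambda>W (w, j, i) (v, k, l). \<Sum>b | b \<in> darcs Q \<and> src Q b = v \<and> tgt Q b = w. x b k j * W b i l"
  have blk: "sdet ?B (\<lambda>r r'. E W r (f r')) = (- 1) ^ ?tt * sdet (brk Q d m) (\<lambda>r r'. ?P W r (h0 r'))" for W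
  proof -
    have fB1: "finite B1" using fB[of ?n] unfolding Bun(1) by simp
    \<comment> \<open>Triangularity: the last m v rows vanish in all pivot columns, because V kills
      the last m v basis vectors.\<close>
    have "sdet ?B (\<lambda>r r'. E W r (f r')) = sdet (g ` brk Q d m) (\<lambda>r r'. E W r (f r')) * sdet B1 (\<lambda>r r'. E W r (f r'))"
      unfolding Bun(1)
    proof (rule sdet_Un[OF _ fB1 Bun(2)])
      fix r r' assume "r \<in> g ` brk Q d m" "r' \<in> B1"
      then show "E W r (f r') = 0" by (auto simp: g_def f1 E_def B1_def f_def)
    qed (simp add: fB)
    also have "sdet B1 (\<lambda>r r'. E W r (f r')) = sdet B1 (\<lambda>r r'. if r = r' then 1 else 0)"
      by (rule sdet_cong) (auto simp: f1 E_def split: if_splits)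
    also have "\<dots> = 1" by (rule sdet_one[OF fB1])
    also have "sdet (g ` brk Q d m) (\<lambda>r r'. E W r (f r')) = sdet (brk Q d m) (\<lambda>r r'. E W (g r) (h (h0 r')))"
      by (subst sdet_reindex[OF injg fB]) (simp add: f2)
    also have "\<dots> = sdet (brk Q d m) (\<lambda>r r'. - ?P W r (h0 r'))"
    proof (rule sdet_cong)
      fix r r' assume r: "r \<in> brk Q d m" and r': "r' \<in> brk Q d m"
      obtain w j i where rr: "r = (w, j, i)" by (metis prod_cases3)
      obtain v k l where h0r: "h0 r' = (v, k, l)" by (metis prod_cases3)
      have "(v, k, l) \<in> brk Q d N" using h0 r' h0r by (metis bij_betwE)
      then have "k < N v" by (simp add: brk_def)
      moreover have "j < m w" using r rr by (simp add: brk_def)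
      ultimately have "(\<Sum>b | b \<in> darcs Q \<and> src Q b = v \<and> tgt Q b = w. X w $$ (pos w (b, k), c1 w + j) * W b i l) =
          (\<Sum>b | b \<in> darcs Q \<and> src Q b = v \<and> tgt Q b = w. x b k j * W b i l)"
        by (intro sum.cong refl) (auto simp: x c1_def)
      then show "E W (g r) (h (h0 r')) = - ?P W r (h0 r')"
        by (simp add: E_def g_def h_def rr h0r)
    qed
    also have "\<dots> = (- 1) ^ ?tt * sdet (brk Q d m) (\<lambda>r r'. ?P W r (h0 r'))"
      by (rule sdet_uminus)
    finally show ?thesis by simp
  qed
  have "block_poly Q d m N x W = (\<epsilon>' * ((- 1) ^ ?tt * \<epsilon> * detI ?B ?T Rm)) * detI ?T ?S (sentry Q V W)" for W
  proof -
    let ?s = "sdet (brk Q d m) (\<lambda>r r'. ?P W r (h0 r'))"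
    have 1: "detI ?B ?T Rm * detI ?T ?S (sentry Q V W) = \<epsilon> * ((- 1) ^ ?tt * ?s)"
      unfolding ERm[symmetric] \<epsilon>(2) blk ..
    have "(\<epsilon>' * ((- 1) ^ ?tt * \<epsilon> * detI ?B ?T Rm)) * detI ?T ?S (sentry Q V W) =
        \<epsilon>' * ((- 1) ^ ?tt * \<epsilon> * (detI ?B ?T Rm * detI ?T ?S (sentry Q V W)))" by (simp only: mult.assoc)
    also have "\<dots> = \<epsilon>' * (((- 1) ^ ?tt * (- 1) ^ ?tt) * (\<epsilon> * \<epsilon>) * ?s)"
      unfolding 1 by (simp only: mult_ac)
    also have "\<dots> = \<epsilon>' * ?s" by (simp add: \<epsilon>(1) power_mult_distrib[symmetric])
    finally show ?thesis unfolding block_poly_def \<epsilon>'(2) by (rule sym)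
  qed
  then show ?thesis by blast
qed

section \<open>Degree bounds in one parameter, and removal of the invertibility assumption\<close>

definition poly_deg_le :: "nat \<Rightarrow> ('k::field \<Rightarrow> 'k) \<Rightarrow> bool" where
  "poly_deg_le n f \<longleftrightarrow> (\<exists>q. degree q \<le> n \<and> (\<forall>t. f t = poly q t))"

lemma poly_deg_le_const: "poly_deg_le n (\<lambda>t. c)"
  unfolding poly_deg_le_def by (rule exI[of _ "[:c:]"]) simp

lemma poly_deg_le_linear: "poly_deg_le (Suc 0) (\<lambda>t. a + b * t)"
  unfolding poly_deg_le_def by (rule exI[of _ "[:a, b:]"]) (simp add: mult.commute)

lemma poly_deg_le_add: "poly_deg_le n f \<Longrightarrow> poly_deg_le n g \<Longrightarrow> poly_deg_le n (\<lambda>t. f t + g t)"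
  unfolding poly_deg_le_def by (metis degree_add_le poly_add)

lemma poly_deg_le_mult: "poly_deg_le n f \<Longrightarrow> poly_deg_le k g \<Longrightarrow> poly_deg_le (n + k) (\<lambda>t. f t * g t)"
  unfolding poly_deg_le_def by (metis add_mono degree_mult_le order_trans poly_mult)

lemma poly_deg_le_sum: "(\<And>i. i \<in> I \<Longrightarrow> poly_deg_le n (f i)) \<Longrightarrow> poly_deg_le n (\<lambda>t. \<Sum>i\<in>I. f i t)"
  by (induction I rule: infinite_finite_induct) (simp_all add: poly_deg_le_const poly_deg_le_add)

lemma poly_deg_le_prod:
  "(\<And>i. i < k \<Longrightarrow> poly_deg_le 1 (f i)) \<Longrightarrow> poly_deg_le k (\<lambda>t. \<Prod>i<k. f i t)"
proof (induction k)
  case (Suc k)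
  then have "poly_deg_le (k + 1) (\<lambda>t. (\<Prod>i<k. f i t) * f k t)" by (intro poly_deg_le_mult) auto
  then show ?case by simp
qed (simp add: poly_deg_le_const)

lemma poly_deg_le_det:
  assumes "\<And>i j. i < n \<Longrightarrow> j < n \<Longrightarrow> poly_deg_le 1 (\<lambda>t. A t i j)"
  shows "poly_deg_le n (\<lambda>t. det (mat n n (\<lambda>(i, j). A t i j)))"
  unfolding det_sdet sdet_def
proof (rule poly_deg_le_sum)
  fix p assume "p \<in> {p. p permutes {..<n}}"
  then have "poly_deg_le (0 + n) (\<lambda>t. of_int (sign p) * (\<Prod>i<n. A t i (p i)))"
    by (intro poly_deg_le_mult poly_deg_le_const poly_deg_le_prod assms) (simp_all add: permutes_lessThan)
  then show "poly_deg_le n (\<lambda>t. of_int (sign p) * (\<Prod>i<n. A t i (p i)))" by simp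
qed

text \<open>For x whose columns extend to bases this is \<open>block_poly_invertible\<close>. A
  general x is perturbed along with X t, which is invertible for all but finitely many t. The value
  at t = 0 follows by interpolation, the degree in t being at most the size of the block
  matrix.\<close>

lemma block_poly_in_span:
  fixes x :: "'v + 'a \<Rightarrow> nat \<Rightarrow> nat \<Rightarrow> 'k::field_char_0"
  assumes Q: "fin_digraph Q" and m: "\<And>v. v \<in> verts Q \<Longrightarrow> m v \<le> in_dim Q N v"
    and sum_eq: "(\<Sum>v\<in>verts Q. m v * d v) = (\<Sum>v\<in>verts Q. N v * d v)"
    and Z: "Z \<subseteq> rep_space Q d"
  shows "restr Z (\<lambda>M. block_poly Q d m N x (rep_W M)) \<in>
    fun_space.span {res_schofield Q (cdim Q m N) d Z V | V. V \<in> rep_space (double_quiver Q) (cdim Q m N)}"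
    (is "_ \<in> fun_space.span ?R")
proof -
  interpret fin_digraph Q by fact
  let ?n = "in_dim Q N"
  define c1 where "c1 v = ?n v - m v" for v
  define pos where "pos v = inv_into {..<?n v} (from_nat_into (in_idx Q N v))" for v
  have bij: "bij_betw (from_nat_into (in_idx Q N v)) {..<?n v} (in_idx Q N v)" for v
    using bij_betw_from_nat_into_finite[OF in_idx(1)[OF Q], of N v] by (simp add: in_idx(2)[OF Q])
  have pos: "bij_betw (pos v) (in_idx Q N v) {..<?n v}" for v
    unfolding pos_def by (rule bij_betw_inv_into[OF bij])
  \<comment> \<open>The last m v columns are prescribed by x and the others are zero: independence
    of the columns is left to the perturbation X t.\<close>
  define X0 where "X0 v = mat (?n v) (?n v) (\<lambda>(k, l). if l < c1 v then 0 else
      case from_nat_into (in_idx Q N v) k of (b, q) \<Rightarrow> x b q (l - c1 v))" for v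
  define X where "X t v = mat (?n v) (?n v) (\<lambda>(k, l). X0 v $$ (k, l) + (if k = l then t else 0))" for t v
  define y where "y t b q j = X t (tgt Q b) $$ (pos (tgt Q b) (b, q), c1 (tgt Q b) + j)" for t b q j
  define f where "f t = restr Z (\<lambda>M. block_poly Q d m N (y t) (rep_W M))" for t
  define Bad where "Bad = (\<Union>v\<in>verts Q. {t. det (X t v) = 0})"
  have X0c: "X0 v \<in> carrier_mat (?n v) (?n v)" and Xc: "X t v \<in> carrier_mat (?n v) (?n v)" for v t
    by (simp_all add: X0_def X_def)
  have pos_less: "pos (tgt Q b) (b, q) < ?n (tgt Q b)" and from_pos: "from_nat_into (in_idx Q N (tgt Q b)) (pos (tgt Q b) (b, q)) = (b, q)"
    if "b \<in> darcs Q" "q < N (src Q b)" for b q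
  proof -
    have mem: "(b, q) \<in> in_idx Q N (tgt Q b)" using that by (simp add: in_idx_def)
    then show "pos (tgt Q b) (b, q) < ?n (tgt Q b)" using pos[of "tgt Q b"] by (auto simp: bij_betw_def)
    show "from_nat_into (in_idx Q N (tgt Q b)) (pos (tgt Q b) (b, q)) = (b, q)"
      unfolding pos_def using mem bij[of "tgt Q b"] by (simp add: bij_betw_def f_inv_into_f)
  qed
  have c1m: "c1 v + j < ?n v" if "v \<in> verts Q" "j < m v" for v j using m[OF that(1)] that by (simp add: c1_def)
  have y: "y t b q j = x b q j + (if pos (tgt Q b) (b, q) = c1 (tgt Q b) + j then 1 else 0) * t"
    if "b \<in> darcs Q" "q < N (src Q b)" "j < m (tgt Q b)" for t b q j
    using that pos_less[OF that(1,2)] from_pos[OF that(1,2)] c1m[of "tgt Q b" j] darcs_verts[OF Q that(1)]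
    by (simp add: y_def X_def X0_def)
  have "finite Bad"
    unfolding Bad_def X_def by (intro finite_UN_I finite_verts finite_det_shift_zeros X0c)
  moreover have "\<exists>q. degree q \<le> card (brk Q d m) \<and> (\<forall>t. f t M = poly q t)" for M
  proof -
    have "card (brk Q d N) = card (brk Q d m)" by (simp add: card_brk[OF Q] sum_eq)
    moreover have "poly_deg_le 1 (\<lambda>t. (case from_nat_into (brk Q d m) i of (w, j, i) \<Rightarrow> \<lambda>(v, k, l).
        \<Sum>b | b \<in> darcs Q \<and> src Q b = v \<and> tgt Q b = w. y t b k j * rep_W M b i l) (from_nat_into (brk Q d N) j))"
      if "i < card (brk Q d m)" "j < card (brk Q d N)" for i j
    proof -
      obtain w j' i' where r: "from_nat_into (brk Q d m) i = (w, j', i')" by (metis prod_cases3)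
      obtain v k l where s: "from_nat_into (brk Q d N) j = (v, k, l)" by (metis prod_cases3)
      have jm: "j' < m w" and kN: "k < N v"
        using from_nat_into_mem[OF that(1)] from_nat_into_mem[OF that(2)] r s by (auto simp: brk_def)
      have "poly_deg_le (Suc 0 + 0) (\<lambda>t. y t b k j' * rep_W M b i' l)" if "b \<in> darcs Q \<and> src Q b = v \<and> tgt Q b = w" for b
      proof (rule poly_deg_le_mult[OF _ poly_deg_le_const])
        show "poly_deg_le (Suc 0) (\<lambda>t. y t b k j')"
        proof -
          have b: "b \<in> darcs Q" "k < N (src Q b)" "j' < m (tgt Q b)" using that jm kN by auto
          show ?thesis unfolding y[OF b] by (rule poly_deg_le_linear)
        qed
      qed
      then show ?thesis unfolding r s prod.case by (intro poly_deg_le_sum) simp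
    qed
    ultimately have "poly_deg_le (card (brk Q d m)) (\<lambda>t. block_poly Q d m N (y t) (rep_W M))"
      unfolding block_poly_def detI_def by (simp only:) (rule poly_deg_le_det)
    then have "poly_deg_le (card (brk Q d m)) (\<lambda>t. f t M)"
      unfolding f_def restr_def by (cases "M \<in> Z") (simp_all add: poly_deg_le_const)
    then show ?thesis by (simp add: poly_deg_le_def)
  qed
  ultimately have "f 0 \<in> fun_space.span {f t | t. t \<notin> Bad}"
    by (intro interpolation_in_span)
  moreover have "{f t | t. t \<notin> Bad} \<subseteq> fun_space.span ?R"
  proof clarify
    fix t assume t: "t \<notin> Bad"
    have "\<exists>Y. Y \<in> carrier_mat (?n v) (?n v) \<and> Y * X t v = 1\<^sub>m (?n v)" if "v \<in> verts Q" for v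
    proof -
      have "det (X t v) \<noteq> 0" using t that by (auto simp: Bad_def)
      from det_non_zero_imp_unit[OF Xc this, of "()"] show ?thesis
        by (auto simp: Units_def ring_mat_simps)
    qed
    then obtain Y where Y: "\<And>v. v \<in> verts Q \<Longrightarrow> Y v \<in> carrier_mat (?n v) (?n v)"
      "\<And>v. v \<in> verts Q \<Longrightarrow> Y v * X t v = 1\<^sub>m (?n v)" by metis
    define V where "V = (\<lambda>b\<in>darcs Q. mat (?n (tgt Q b) - m (tgt Q b)) (N (src Q b))
      (\<lambda>(r, q). Y (tgt Q b) $$ (r, pos (tgt Q b) (b, q))))"
    have V: "V \<in> rep_space (double_quiver Q) (cdim Q m N)"
      unfolding rep_space_def by (auto simp: V_def arcs_double_quiver double_quiver_ends)
    have "\<exists>\<kappa>. \<forall>W. block_poly Q d m N (y t) W =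
        \<kappa> * detI (tgt_idx Q (cdim Q m N) d) (src_idx Q (cdim Q m N) d) (sentry Q V W)"
      by (rule block_poly_invertible[OF Q m sum_eq pos Xc Y _ V_def]) (simp_all add: y_def c1_def)
    then obtain \<kappa> where \<kappa>: "\<And>W. block_poly Q d m N (y t) W =
        \<kappa> * detI (tgt_idx Q (cdim Q m N) d) (src_idx Q (cdim Q m N) d) (sentry Q V W)" by blast
    have "f t = (\<lambda>M. \<kappa> * res_schofield Q (cdim Q m N) d Z V M)"
      using Z by (auto simp: fun_eq_iff f_def restr_def res_schofield_def \<kappa> schofield_double[OF Q V])
    then show "f t \<in> fun_space.span ?R"
      using V by (simp only:) (intro span_scale fun_space.span_base, blast)
  qed
  ultimately have "f 0 \<in> fun_space.span ?R"
    using fun_space.span_minimal[OF _ fun_space.subspace_span] by blast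
  moreover have "block_poly Q d m N (y 0) W = block_poly Q d m N x W" for W
    unfolding block_poly_def
  proof (rule detI_cong)
    fix r s assume "r \<in> brk Q d m" "s \<in> brk Q d N"
    moreover obtain w j i where r: "r = (w, j, i)" by (metis prod_cases3)
    moreover obtain v k l where s: "s = (v, k, l)" by (metis prod_cases3)
    ultimately have "j < m w" "k < N v" by (auto simp: brk_def)
    then show "(case r of (w, j, i) \<Rightarrow> \<lambda>(v, k, l). \<Sum>b | b \<in> darcs Q \<and> src Q b = v \<and> tgt Q b = w. y 0 b k j * W b i l) s =
      (case r of (w, j, i) \<Rightarrow> \<lambda>(v, k, l). \<Sum>b | b \<in> darcs Q \<and> src Q b = v \<and> tgt Q b = w. x b k j * W b i l) s"
      unfolding r s prod.case by (intro sum.cong refl) (simp add: y)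
  qed
  ultimately show ?thesis by (simp add: f_def)
qed

section \<open>Semi-invariants at nilpotent representations\<close>

text \<open>K^n modelled by functions on the naturals, so that the theory of
  \<open>fun_space\<close> is available for all n on one type.\<close>

definition fin_vecs :: "nat \<Rightarrow> (nat \<Rightarrow> 'k::field) set" where
  "fin_vecs n = {f. \<forall>i\<ge>n. f i = 0}"

lemma subspace_fin_vecs: "fun_space.subspace (fin_vecs n :: (nat \<Rightarrow> 'k::field) set)"
  by (auto simp: fun_space.subspace_def fin_vecs_def)

definition unit_fun :: "nat \<Rightarrow> nat \<Rightarrow> 'k::field" where
  "unit_fun j i = (if i = j then 1 else 0)"

lemma independent_unit_funs: "\<not> fun_space.dependent (unit_fun ` {..<n} :: (nat \<Rightarrow> 'k::field) set)"
proof (induction n)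
  case (Suc n)
  let ?e = "unit_fun :: nat \<Rightarrow> nat \<Rightarrow> 'k"
  have "?e ` {..<n} \<subseteq> fin_vecs n" by (auto simp: fin_vecs_def unit_fun_def)
  then have "fun_space.span (?e ` {..<n}) \<subseteq> fin_vecs n"
    by (rule fun_space.span_minimal[OF _ subspace_fin_vecs])
  moreover have "?e n \<notin> fin_vecs n" by (auto simp: fin_vecs_def unit_fun_def)
  ultimately have "?e n \<notin> fun_space.span (?e ` {..<n})" by blast
  then show ?case using Suc by (simp add: lessThan_Suc fun_space.independent_insert)
qed (simp add: fun_space.independent_empty)

lemma card_unit_funs: "card (unit_fun ` {..<n} :: (nat \<Rightarrow> 'k::field) set) = n"
proof -
  have "inj_on (unit_fun :: nat \<Rightarrow> nat \<Rightarrow> 'k) {..<n}"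
    by (rule inj_onI) (metis unit_fun_def zero_neq_one)
  then show ?thesis by (simp add: card_image)
qed

lemma span_unit_funs: "fin_vecs n \<subseteq> fun_space.span (unit_fun ` {..<n} :: (nat \<Rightarrow> 'k::field) set)"
proof
  fix f :: "nat \<Rightarrow> 'k" assume f: "f \<in> fin_vecs n"
  have "f = (\<lambda>i. \<Sum>j<n. f j * unit_fun j i)"
  proof
    fix i
    have "(\<Sum>j<n. f j * unit_fun j i) = (\<Sum>j<n. if j = i then f j else 0)"
      by (rule sum.cong) (auto simp: unit_fun_def)
    then show "f i = (\<Sum>j<n. f j * unit_fun j i)" using f by (auto simp: fin_vecs_def)
  qed
  moreover have "(\<lambda>i. \<Sum>j<n. f j * unit_fun j i) \<in> fun_space.span (unit_fun ` {..<n})"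
    by (intro span_sum span_scale fun_space.span_base) auto
  ultimately show "f \<in> fun_space.span (unit_fun ` {..<n})" by simp
qed

text \<open>A basis of each U j is extended to one of U (Suc j), and \<omega> k is the first step at
  which b k occurs. Members of U j then involve basis vectors with \<omega> \<le> j. U 0 = {0} gives
  \<omega> > 0, so that \<omega> - 1 is a true predecessor in the later shift argument.\<close>

lemma flag_adapted_basis:
  fixes U :: "nat \<Rightarrow> (nat \<Rightarrow> 'k::field) set"
  assumes sub: "\<And>j. fun_space.subspace (U j)" and mono: "\<And>j. U j \<subseteq> U (Suc j)"
    and U0: "U 0 = {0}" and Um: "U m = fin_vecs n"
  shows "\<exists>b \<omega>. (\<forall>k<n. 0 < \<omega> k \<and> \<omega> k \<le> m \<and> b k \<in> U (\<omega> k)) \<and>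
    (\<forall>j\<le>m. \<forall>x\<in>U j. \<exists>y. (\<forall>i. x i = (\<Sum>k<n. y k * b k i)) \<and> (\<forall>k<n. y k \<noteq> 0 \<longrightarrow> \<omega> k \<le> j))"
proof -
  define P where "P j B \<longleftrightarrow> B \<subseteq> U j \<and> \<not> fun_space.dependent B \<and> U j \<subseteq> fun_space.span B" for j and B :: "(nat \<Rightarrow> 'k) set"
  have "\<exists>B. \<forall>j. P j (B j) \<and> B j \<subseteq> B (Suc j)"
  proof (rule dependent_nat_choice)
    show "\<exists>B. P 0 B"
      by (rule exI[of _ "{}"]) (auto simp: P_def U0 fun_space.independent_empty fun_space.span_zero)
  next
    fix B j assume "P j B"
    then have "B \<subseteq> U (Suc j)" "\<not> fun_space.dependent B" using mono[of j] by (auto simp: P_def)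
    then obtain B' where "B \<subseteq> B'" "B' \<subseteq> U (Suc j)" "\<not> fun_space.dependent B'" "U (Suc j) \<subseteq> fun_space.span B'"
      by (rule fun_space.maximal_independent_subset_extend)
    then show "\<exists>B'. P (Suc j) B' \<and> B \<subseteq> B'" by (auto simp: P_def)
  qed
  then obtain B where B: "\<And>j. P j (B j)" and Bs: "\<And>j. B j \<subseteq> B (Suc j)" by blast
  have Bmono: "B i \<subseteq> B j" if "i \<le> j" for i j
    using lift_Suc_mono_le[of B, OF Bs that] .
  have B0: "B 0 = {}"
    using B[of 0] fun_space.dependent_zero by (auto simp: P_def U0)
  have Bsub: "B m \<subseteq> fin_vecs n" and Bind: "\<not> fun_space.dependent (B m)" and Bspan: "fin_vecs n \<subseteq> fun_space.span (B m)"
    using B[of m] by (auto simp: P_def Um)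
  have le: "finite (B m) \<and> card (B m) \<le> n"
    using fun_space.independent_span_bound[OF _ Bind, of "unit_fun ` {..<n}"] Bsub span_unit_funs[of n]
    by (simp add: card_unit_funs) blast
  have "unit_fun ` {..<n} \<subseteq> (fin_vecs n :: (nat \<Rightarrow> 'k) set)" by (auto simp: fin_vecs_def unit_fun_def)
  then have "n \<le> card (B m)"
    using fun_space.independent_span_bound[OF _ independent_unit_funs[of n], of "B m"] Bspan le
    by (auto simp: card_unit_funs)
  then have fin: "finite (B m)" and card: "card (B m) = n" using le by auto
  obtain b where b: "bij_betw b {..<n} (B m)"
    using ex_bij_betw_nat_finite[OF fin] by (auto simp: card atLeast0LessThan)
  define \<omega> where "\<omega> k = (LEAST j. b k \<in> B j)" for k
  have bB: "b k \<in> B (\<omega> k)" "\<omega> k \<le> m" if "k < n" for k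
  proof -
    have "b k \<in> B m" using b that by (auto simp: bij_betw_def)
    then show "b k \<in> B (\<omega> k)" "\<omega> k \<le> m" unfolding \<omega>_def by (rule LeastI, rule Least_le)
  qed
  have pos: "0 < \<omega> k" if "k < n" for k
    using bB(1)[OF that] B0 by (cases "\<omega> k") auto
  have "\<exists>y. (\<forall>i. x i = (\<Sum>k<n. y k * b k i)) \<and> (\<forall>k<n. y k \<noteq> 0 \<longrightarrow> \<omega> k \<le> j)" if j: "j \<le> m" and x: "x \<in> U j" for j x
  proof -
    have finj: "finite (B j)" using Bmono[OF j] fin by (rule finite_subset)
    have "x \<in> fun_space.span (B j)" using x B[of j] by (auto simp: P_def)
    then obtain u where u: "x = (\<Sum>v\<in>B j. (\<lambda>i. u v * v i))"
      unfolding fun_space.span_finite[OF finj] by blast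
    have app: "(\<Sum>v\<in>A. f v) i = (\<Sum>v\<in>A. f v i)" for A and f :: "(nat \<Rightarrow> 'k) \<Rightarrow> nat \<Rightarrow> 'k" and i
      by (induction A rule: infinite_finite_induct) auto
    define y where "y k = (if b k \<in> B j then u (b k) else 0)" for k
    have "x i = (\<Sum>k<n. y k * b k i)" for i
    proof -
      have "x i = (\<Sum>v\<in>B m. (if v \<in> B j then u v else 0) * v i)"
        unfolding u app using Bmono[OF j] fin by (intro sum.mono_neutral_cong_left) auto
      also have "\<dots> = (\<Sum>k<n. y k * b k i)"
        unfolding y_def by (rule sum.reindex_bij_betw[OF b, symmetric])
      finally show ?thesis .
    qed
    moreover have "\<omega> k \<le> j" if "y k \<noteq> 0" for k
      using that unfolding \<omega>_def y_def by (auto intro: Least_le split: if_splits)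
    ultimately show ?thesis by blast
  qed
  moreover have "b k \<in> U (\<omega> k)" if "k < n" for k
    using bB(1)[OF that] B[of "\<omega> k"] unfolding P_def by blast
  ultimately show ?thesis
    using bB(2) pos by (intro exI[of _ b] exI[of _ \<omega>]) simp
qed

text \<open>As t tends to infinity, the right-hand side grows at most like t^e.\<close>

lemma degree_from_inverse:
  fixes p q :: "'k::field_char_0 poly"
  assumes eq: "\<And>t. t \<noteq> 0 \<Longrightarrow> poly p t = \<kappa> * t powi e * poly q (inverse t)"
  shows "int (degree p) \<le> max 0 e"
proof (cases "p = 0")
  case False
  let ?n1 = "nat (- e)" and ?n2 = "nat e" and ?D = "degree q"
  \<comment> \<open>The powers D and n1 clear the negative exponents. The additional factor t makes
    both sides vanish at t = 0, where \<open>eq\<close> gives nothing.\<close>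
  have "monom 1 (?D + ?n1 + 1) * p = smult \<kappa> (monom 1 (?n2 + 1) * reflect_poly q)"
  proof (rule poly_eq_poly_eq_iff[THEN iffD1], rule ext)
    fix t
    show "poly (monom 1 (?D + ?n1 + 1) * p) t = poly (smult \<kappa> (monom 1 (?n2 + 1) * reflect_poly q)) t"
    proof (cases "t = 0")
      case t: False
      have "t powi e * t ^ ?n1 = t ^ ?n2"
        by (cases "e \<ge> 0") (use t in \<open>auto simp: power_int_def power_inverse\<close>)
      then have 1: "(\<kappa> * t powi e * poly q (inverse t)) * t ^ ?n1 = \<kappa> * t ^ ?n2 * poly q (inverse t)"
        by (metis mult.assoc mult.commute)
      have "poly (monom 1 (?D + ?n1 + 1) * p) t = t ^ ?D * t * (poly p t * t ^ ?n1)"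
        by (simp add: poly_monom power_add mult_ac)
      also have "\<dots> = \<kappa> * t ^ ?n2 * t * (t ^ ?D * poly q (inverse t))"
        unfolding eq[OF t] 1 by (simp only: mult_ac)
      also have "\<dots> = poly (smult \<kappa> (monom 1 (?n2 + 1) * reflect_poly q)) t"
        by (simp add: poly_monom poly_reflect_poly_nz[OF t] mult_ac)
      finally show ?thesis .
    qed (simp add: poly_monom)
  qed
  then have "degree (monom 1 (?D + ?n1 + 1) * p) \<le> degree (monom (1::'k) (?n2 + 1) * reflect_poly q)"
    by (simp add: degree_smult_le)
  also have "\<dots> \<le> (?n2 + 1) + ?D"
    using degree_mult_le[of "monom (1::'k) (?n2 + 1)" "reflect_poly q"] degree_reflect_poly_le[of q]
    by (simp add: degree_monom_eq)
  also have "degree (monom 1 (?D + ?n1 + 1) * p) = (?D + ?n1 + 1) + degree p"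
    using False by (subst degree_mult_eq) (auto simp: degree_monom_eq)
  finally show ?thesis by linarith
qed simp

lemma det_diagonal: "det (mat n n (\<lambda>(i, j). if i = j then f i else 0)) = (\<Prod>i<n. f i :: 'k::comm_ring_1)"
proof -
  have S: "Sigma {..<n} (\<lambda>_. {()}) = (\<lambda>i. (i, ())) ` {..<n}" by auto
  have "sdet (Sigma {..<n} (\<lambda>_. {()})) (\<lambda>(k, i) (k', i'). if k = k' then f k else 0) = (\<Prod>i<n. sdet {()} (\<lambda>_ _. f i))"
    by (rule sdet_Sigma) auto
  also have "sdet (Sigma {..<n} (\<lambda>_. {()})) (\<lambda>(k, i) (k', i'). if k = k' then f k else 0) =
      det (mat n n (\<lambda>(i, j). if i = j then f i else 0))"
    unfolding S det_sdet by (subst sdet_reindex) (auto simp: inj_on_def)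
  finally have "det (mat n n (\<lambda>(i, j). if i = j then f i else 0)) = (\<Prod>i<n. sdet {()} (\<lambda>_ _. f i))" .
  then show ?thesis by (simp add: sdet_def)
qed

text \<open>
  A flag of subspaces shifted by all arrows yields a one-parameter subgroup \<open>h t\<close> such that
  \<open>t M = h(t)\<^sup>-\<^sup>1 C(1/t)\<close> for a curve \<open>C\<close> that is polynomial in \<open>1/t\<close>.
\<close>

lemma nilpotent_degree_bound:
  fixes F :: "('a, 'k::field_char_0) qrep \<Rightarrow> 'k" and Q :: "('v, 'a) pre_digraph"
  assumes Q: "fin_digraph Q" and M: "M \<in> rep_space Q d"
    and nil: "\<And>u p v. pre_digraph.awalk Q u p v \<Longrightarrow> m \<le> length p \<Longrightarrow> path_mat Q d M u p = 0\<^sub>m (d v) (d u)"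
    and F: "poly_le Q d k F"
    and inv: "\<And>g M. g \<in> carrier (GL Q d) \<Longrightarrow> M \<in> rep_space Q d \<Longrightarrow>
      F (rep_act Q d (inv\<^bsub>GL Q d\<^esub> g) M) = weight_char Q \<theta> g * F M"
    and p: "\<And>t. F (scale_rep Q t M) = poly p t"
  shows "degree p \<le> (\<Sum>v\<in>verts Q. nat \<bar>\<theta> v\<bar> * (m * d v))"
proof -
  interpret fin_digraph Q by fact
  define ap where "ap A n x i = (\<Sum>l<n. A $$ (i, l) * x l)" for A :: "'k mat" and n and x :: "nat \<Rightarrow> 'k" and i
  \<comment> \<open>The vectors at v annihilated by all paths of length at least j. The trivial path
    forces U v 0 = 0, nilpotency makes U v m everything, and an arrow out of v maps U v (Suc j) into
    the step j at its head.\<close>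
  define U where "U v j = {x \<in> fin_vecs (d v). \<forall>p w. awalk v p w \<longrightarrow> j \<le> length p \<longrightarrow>
    (\<forall>i<d w. ap (path_mat Q d M v p) (d v) x i = 0)}" for v j
  have ap_lin: "ap A n (x + y) i = ap A n x i + ap A n y i" "ap A n (\<lambda>l. c * x l) i = c * ap A n x i"
    for A n x y c i by (simp_all add: ap_def algebra_simps sum.distrib sum_distrib_left)
  have "\<exists>b \<omega>. (\<forall>k<d v. 0 < \<omega> k \<and> \<omega> k \<le> m \<and> b k \<in> U v (\<omega> k)) \<and>
    (\<forall>j\<le>m. \<forall>x\<in>U v j. \<exists>y. (\<forall>i. x i = (\<Sum>k<d v. y k * b k i)) \<and> (\<forall>k<d v. y k \<noteq> 0 \<longrightarrow> \<omega> k \<le> j))"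
    if v: "v \<in> verts Q" for v
  proof (rule flag_adapted_basis)
    show "fun_space.subspace (U v j)" for j
      using subspace_fin_vecs[of "d v"] unfolding fun_space.subspace_def U_def
      by (auto simp: ap_lin) (simp_all add: ap_def)
    show "U v j \<subseteq> U v (Suc j)" for j by (auto simp: U_def)
    show "U v m = fin_vecs (d v)"
      by (auto simp: U_def nil ap_def)
    show "U v 0 = {0}"
    proof (intro equalityI subsetI)
      fix x assume x: "x \<in> U v 0"
      have "awalk v [] v" using v by (simp add: awalk_Nil_iff)
      moreover have "\<forall>p w. awalk v p w \<longrightarrow> 0 \<le> length p \<longrightarrow> (\<forall>i<d w. ap (path_mat Q d M v p) (d v) x i = 0)"
        using x unfolding U_def by (elim CollectE conjE)
      ultimately have "\<forall>i<d v. ap (path_mat Q d M v []) (d v) x i = 0"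
        by (metis le0)
      then have "ap (1\<^sub>m (d v)) (d v) x i = 0" if "i < d v" for i
        using that by simp
      moreover have "ap (1\<^sub>m (d v)) (d v) x i = x i" if "i < d v" for i
      proof -
        have "ap (1\<^sub>m (d v)) (d v) x i = (\<Sum>l<d v. if l = i then x l else 0)"
          unfolding ap_def using that by (intro sum.cong) auto
        then show ?thesis using that by simp
      qed
      ultimately have "x i = 0" for i using x by (cases "i < d v") (auto simp: U_def fin_vecs_def)
      then show "x \<in> {0}" by (auto simp: fun_eq_iff)
    qed (auto simp: U_def fin_vecs_def ap_def)
  qed
  note basis = this
  define R where "R v b \<omega> \<longleftrightarrow> (\<forall>k<d v. 0 < \<omega> k \<and> \<omega> k \<le> m \<and> b k \<in> U v (\<omega> k)) \<and>
    (\<forall>j\<le>m. \<forall>x\<in>U v j. \<exists>y. (\<forall>i. x i = (\<Sum>k<d v. y k * b k i)) \<and> (\<forall>k<d v. y k \<noteq> 0 \<longrightarrow> \<omega> k \<le> j))"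
    for v and b :: "nat \<Rightarrow> nat \<Rightarrow> 'k" and \<omega> :: "nat \<Rightarrow> nat"
  have "\<forall>v\<in>verts Q. \<exists>x. R v (fst x) (snd x)"
  proof
    fix v assume "v \<in> verts Q"
    from basis[OF this] have "\<exists>b \<omega>. R v b \<omega>" unfolding R_def .
    then obtain b \<omega> where "R v b \<omega>" by (elim exE)
    then show "\<exists>x. R v (fst x) (snd x)" by (intro exI[of _ "(b, \<omega>)"]) simp
  qed
  from bchoice[OF this] obtain f where f: "\<forall>v\<in>verts Q. R v (fst (f v)) (snd (f v))" by (elim exE)
  define b where "b v = fst (f v)" for v
  define \<omega> where "\<omega> v = snd (f v)" for v
  have R: "R v (b v) (\<omega> v)" if "v \<in> verts Q" for v unfolding b_def \<omega>_def using f that by (rule bspec)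
  have \<omega>: "0 < \<omega> v k \<and> \<omega> v k \<le> m \<and> b v k \<in> U v (\<omega> v k)" if "v \<in> verts Q" "k < d v" for v k
    using R[OF that(1), unfolded R_def, THEN conjunct1, rule_format, OF that(2)] .
  have coords: "\<exists>y. (\<forall>i. x i = (\<Sum>k<d v. y k * b v k i)) \<and> (\<forall>k<d v. y k \<noteq> 0 \<longrightarrow> \<omega> v k \<le> j)"
    if "v \<in> verts Q" "j \<le> m" "x \<in> U v j" for v j x
    using R[OF that(1), unfolded R_def, THEN conjunct2, rule_format, OF that(2,3)] .
  define g where "g v = mat (d v) (d v) (\<lambda>(i, k). b v k i)" for v
  have gc: "g v \<in> carrier_mat (d v) (d v)" for v by (simp add: g_def)
  have "\<exists>G. G \<in> carrier_mat (d v) (d v) \<and> g v * G = 1\<^sub>m (d v)" if v: "v \<in> verts Q" for v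
  proof -
    have "unit_fun j \<in> U v m" if "j < d v" for j
      using that by (auto simp: U_def nil ap_def fin_vecs_def unit_fun_def)
    then have "\<exists>y. \<forall>i. unit_fun j i = (\<Sum>k<d v. y k * b v k i)" if "j < d v" for j
      using coords[OF v order_refl] that by blast
    then obtain Y where Y: "\<And>j i. j < d v \<Longrightarrow> unit_fun j i = (\<Sum>k<d v. Y j k * b v k i)" by metis
    have "g v * mat (d v) (d v) (\<lambda>(k, j). Y j k) = 1\<^sub>m (d v)"
    proof (rule eq_matI)
      fix i j assume "i < dim_row (1\<^sub>m (d v))" "j < dim_col (1\<^sub>m (d v))"
      then have ij: "i < d v" "j < d v" by auto
      have "(g v * mat (d v) (d v) (\<lambda>(k, j). Y j k)) $$ (i, j) = (\<Sum>k<d v. b v k i * Y j k)"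
        using ij by (simp add: g_def scalar_prod_def atLeast0LessThan)
      also have "\<dots> = unit_fun j i" unfolding Y[OF ij(2)] by (rule sum.cong[OF refl], rule mult.commute)
      finally show "(g v * mat (d v) (d v) (\<lambda>(k, j). Y j k)) $$ (i, j) = 1\<^sub>m (d v) $$ (i, j)"
        using ij by (simp add: unit_fun_def)
    qed (simp_all add: g_def)
    then show ?thesis by (intro exI[of _ "mat (d v) (d v) (\<lambda>(k, j). Y j k)"]) simp
  qed
  then obtain Gi where Gic: "\<And>v. v \<in> verts Q \<Longrightarrow> Gi v \<in> carrier_mat (d v) (d v)"
    and gGi: "\<And>v. v \<in> verts Q \<Longrightarrow> g v * Gi v = 1\<^sub>m (d v)" by metis
  have Gig: "Gi v * g v = 1\<^sub>m (d v)" if "v \<in> verts Q" for v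
    by (rule mat_mult_left_right_inverse[OF gc Gic[OF that] gGi[OF that]])
  have detGi: "det (Gi v) \<noteq> 0" if "v \<in> verts Q" for v
    using det_mult[OF gc Gic[OF that]] gGi[OF that] by auto
  have Mc: "M a \<in> carrier_mat (d (head Q a)) (d (tail Q a))" if "a \<in> arcs Q" for a
    using M that by (auto simp: rep_space_def)
  \<comment> \<open>L a is the matrix of M a in the adapted bases. An arrow lowers the step of the
    flag, so \<omega> strictly drops along nonzero entries.\<close>
  have "\<exists>L. L \<in> carrier_mat (d (head Q a)) (d (tail Q a)) \<and> M a * g (tail Q a) = g (head Q a) * L \<and>
    (\<forall>i<d (head Q a). \<forall>j<d (tail Q a). L $$ (i, j) \<noteq> 0 \<longrightarrow> \<omega> (head Q a) i < \<omega> (tail Q a) j)"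
    if a: "a \<in> arcs Q" for a
  proof -
    let ?h = "head Q a" and ?t = "tail Q a"
    have vs: "?h \<in> verts Q" "?t \<in> verts Q" using a by auto
    define x where "x j i = (if i < d ?h then ap (M a) (d ?t) (b ?t j) i else 0)" for j i
    have "x j \<in> U ?h (\<omega> ?t j - 1)" if j: "j < d ?t" for j
      unfolding U_def mem_Collect_eq
    proof (intro conjI allI impI)
      show "x j \<in> fin_vecs (d ?h)" by (simp add: x_def fin_vecs_def)
      fix p w i assume p: "awalk ?h p w" and len: "\<omega> ?t j - 1 \<le> length p" and i: "i < d w"
      have "awalk ?t (a # p) w" using a p by (simp add: awalk_Cons_iff)
      moreover have "\<omega> ?t j \<le> length (a # p)" using len \<omega>[OF vs(2) j] by simp
      ultimately have 0: "ap (path_mat Q d M ?t (a # p)) (d ?t) (b ?t j) i = 0"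
        using \<omega>[OF vs(2) j] i unfolding U_def by blast
      let ?A = "path_mat Q d M ?h p"
      have A: "?A \<in> carrier_mat (d w) (d ?h)" by (rule path_mat_carrier[OF Q M p])
      have "ap ?A (d ?h) (x j) i = (\<Sum>r<d ?h. \<Sum>l<d ?t. ?A $$ (i, r) * M a $$ (r, l) * b ?t j l)"
        unfolding ap_def[of ?A] by (intro sum.cong refl) (simp add: x_def ap_def sum_distrib_left mult.assoc)
      also have "\<dots> = (\<Sum>l<d ?t. (\<Sum>r<d ?h. ?A $$ (i, r) * M a $$ (r, l)) * b ?t j l)"
        unfolding sum_distrib_right by (rule sum.swap)
      also have "\<dots> = ap (?A * M a) (d ?t) (b ?t j) i"
        unfolding ap_def using carrier_matD[OF A] carrier_matD[OF Mc[OF a]] i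
        by (intro sum.cong refl) (simp add: scalar_prod_def atLeast0LessThan)
      finally show "ap ?A (d ?h) (x j) i = 0" using 0 by simp
    qed
    then have "\<exists>y. (\<forall>i. x j i = (\<Sum>k<d ?h. y k * b ?h k i)) \<and> (\<forall>k<d ?h. y k \<noteq> 0 \<longrightarrow> \<omega> ?h k \<le> \<omega> ?t j - 1)"
      if "j < d ?t" for j
      using that \<omega>[OF vs(2) that] by (intro coords[OF vs(1)]) auto
    then obtain y where y: "\<And>j i. j < d ?t \<Longrightarrow> x j i = (\<Sum>k<d ?h. y j k * b ?h k i)"
      and yw: "\<And>j k. j < d ?t \<Longrightarrow> k < d ?h \<Longrightarrow> y j k \<noteq> 0 \<Longrightarrow> \<omega> ?h k \<le> \<omega> ?t j - 1" by metis
    let ?L = "mat (d ?h) (d ?t) (\<lambda>(k, j). y j k)"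
    have "M a * g ?t = g ?h * ?L"
    proof (rule eq_matI)
      fix i j assume "i < dim_row (g ?h * ?L)" "j < dim_col (g ?h * ?L)"
      then have ij: "i < d ?h" "j < d ?t" by (auto simp: g_def)
      have "(M a * g ?t) $$ (i, j) = x j i"
        using ij carrier_matD[OF Mc[OF a]] by (simp add: x_def ap_def g_def scalar_prod_def atLeast0LessThan)
      also have "\<dots> = (g ?h * ?L) $$ (i, j)"
        using ij by (simp add: y g_def scalar_prod_def atLeast0LessThan mult.commute)
      finally show "(M a * g ?t) $$ (i, j) = (g ?h * ?L) $$ (i, j)" .
    qed (use carrier_matD[OF Mc[OF a]] in \<open>auto simp: g_def\<close>)
    moreover have "\<omega> ?h i < \<omega> ?t j" if "i < d ?h" "j < d ?t" "?L $$ (i, j) \<noteq> 0" for i j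
      using yw[of j i] that \<omega>[OF vs(2) that(2)] by simp linarith
    ultimately show ?thesis by (intro exI[of _ ?L]) auto
  qed
  then obtain L where Lc: "\<And>a. a \<in> arcs Q \<Longrightarrow> L a \<in> carrier_mat (d (head Q a)) (d (tail Q a))"
    and MgL: "\<And>a. a \<in> arcs Q \<Longrightarrow> M a * g (tail Q a) = g (head Q a) * L a"
    and Lw: "\<And>a i j. a \<in> arcs Q \<Longrightarrow> i < d (head Q a) \<Longrightarrow> j < d (tail Q a) \<Longrightarrow> L a $$ (i, j) \<noteq> 0 \<Longrightarrow>
      \<omega> (head Q a) i < \<omega> (tail Q a) j" by metis
  have GiM: "Gi (head Q a) * M a = L a * Gi (tail Q a)" if a: "a \<in> arcs Q" for a
  proof -
    let ?h = "head Q a" and ?t = "tail Q a"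
    have vs: "?h \<in> verts Q" "?t \<in> verts Q" using a by auto
    note [simp] = gc Gic[OF vs(1)] Gic[OF vs(2)] Mc[OF a] Lc[OF a]
    have "Gi ?h * M a = Gi ?h * (M a * (g ?t * Gi ?t))"
      by (simp add: gGi[OF vs(2)] right_mult_one_mat[OF Mc[OF a]])
    also have "M a * (g ?t * Gi ?t) = M a * g ?t * Gi ?t"
      by (rule assoc_mult_mat[symmetric, OF Mc[OF a] gc Gic[OF vs(2)]])
    also have "\<dots> = g ?h * (L a * Gi ?t)"
      unfolding MgL[OF a] by (rule assoc_mult_mat[OF gc Lc[OF a] Gic[OF vs(2)]])
    also have "Gi ?h * \<dots> = Gi ?h * g ?h * (L a * Gi ?t)"
      by (rule assoc_mult_mat[symmetric, OF Gic[OF vs(1)] gc mult_carrier_mat[OF Lc[OF a] Gic[OF vs(2)]]])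
    also have "\<dots> = L a * Gi ?t"
      unfolding Gig[OF vs(1)] by (rule left_mult_one_mat[OF mult_carrier_mat[OF Lc[OF a] Gic[OF vs(2)]]])
    finally show ?thesis .
  qed
  \<comment> \<open>Conjugating t M by the diagonal matrices t^\<omega> multiplies the entry (i, j)
    of L by t to the power \<omega>(head) i + 1 - \<omega>(tail) j, which is never positive where L
    is nonzero. The offset 1 comes from the scaling of M. C s may violate the relations, hence
    \<open>inv\<close> on all of \<open>rep_space\<close>.\<close>
  define C where "C s = (\<lambda>a\<in>arcs Q. mat (d (head Q a)) (d (tail Q a))
    (\<lambda>(i, j). s ^ (\<omega> (tail Q a) j - \<omega> (head Q a) i - 1) * L a $$ (i, j)))" for s
  have Cs: "C s \<in> rep_space Q d" for s by (auto simp: C_def rep_space_def)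
  define D where "D t v = mat (d v) (d v) (\<lambda>(i, j). if i = j then t ^ \<omega> v i else 0)" for t :: 'k and v
  have Dc: "D t v \<in> carrier_mat (d v) (d v)" for t v by (simp add: D_def)
  define e where "e v = (\<Sum>i<d v. \<omega> v i)" for v
  have detD: "det (D t v) = t ^ e v" for t v by (simp add: D_def det_diagonal e_def power_sum)
  define \<kappa> where "\<kappa> = (\<Prod>v\<in>verts Q. det (Gi v) powi \<theta> v)"
  \<comment> \<open>Up to the constant \<kappa>, t^E is the character of the one-parameter subgroup.
    Its bound comes from \<omega> \<le> m, so the degree k of F does not enter.\<close>
  define E where "E = (\<Sum>v\<in>verts Q. int (e v) * \<theta> v)"
  have key: "F (scale_rep Q t M) = \<kappa> * t powi E * F (C (inverse t))" if t: "t \<noteq> 0" for t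
  proof -
    define h where "h = (\<lambda>v\<in>verts Q. D t v * Gi v)"
    have h: "h \<in> carrier (GL Q d)"
      unfolding GL_carrier_iff h_def using t detGi by (auto simp: det_mult[OF Dc Gic] detD intro!: mult_carrier_mat[OF Dc Gic])
    have "scale_rep Q t M = rep_act Q d (inv\<^bsub>GL Q d\<^esub> h) (C (inverse t))"
    proof
      fix a
      show "scale_rep Q t M a = rep_act Q d (inv\<^bsub>GL Q d\<^esub> h) (C (inverse t)) a"
      proof (cases "a \<in> arcs Q")
        case a: True
        let ?h = "head Q a" and ?t = "tail Q a"
        let ?i = "(inv\<^bsub>GL Q d\<^esub> h) ?h" and ?C = "C (inverse t) a"
        have vs: "?h \<in> verts Q" "?t \<in> verts Q" using a by auto
        have Cc: "?C \<in> carrier_mat (d ?h) (d ?t)" using a by (simp add: C_def)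
        have DL: "D t ?h * (t \<cdot>\<^sub>m L a) = ?C * D t ?t"
        proof (rule eq_matI)
          fix i j assume "i < dim_row (?C * D t ?t)" "j < dim_col (?C * D t ?t)"
          then have ij: "i < d ?h" "j < d ?t" using carrier_matD[OF Cc] by (auto simp: D_def)
          have "(D t ?h * (t \<cdot>\<^sub>m L a)) $$ (i, j) = (\<Sum>r<d ?h. (if i = r then t ^ \<omega> ?h i else 0) * (t * L a $$ (r, j)))"
            using ij carrier_matD[OF Lc[OF a]] by (simp add: D_def scalar_prod_def atLeast0LessThan)
          also have "\<dots> = (\<Sum>r<d ?h. if r = i then t ^ \<omega> ?h i * (t * L a $$ (r, j)) else 0)"
            by (rule sum.cong) auto
          also have "\<dots> = t ^ Suc (\<omega> ?h i) * L a $$ (i, j)" using ij by (simp add: mult_ac)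
          also have "\<dots> = inverse t ^ (\<omega> ?t j - \<omega> ?h i - 1) * L a $$ (i, j) * t ^ \<omega> ?t j"
          proof (cases "L a $$ (i, j) = 0")
            case False
            then have "\<omega> ?t j = Suc (\<omega> ?h i) + (\<omega> ?t j - \<omega> ?h i - 1)" using Lw[OF a ij] by simp
            then have "t ^ \<omega> ?t j = t ^ Suc (\<omega> ?h i) * t ^ (\<omega> ?t j - \<omega> ?h i - 1)" by (metis power_add)
            then show ?thesis using t by (simp add: power_inverse)
          qed simp
          also have "\<dots> = (\<Sum>r<d ?t. if r = j then ?C $$ (i, r) * t ^ \<omega> ?t r else 0)"
            using ij a by (simp add: C_def)
          also have "\<dots> = (\<Sum>r<d ?t. ?C $$ (i, r) * (if r = j then t ^ \<omega> ?t r else 0))"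
            by (rule sum.cong) auto
          also have "\<dots> = (?C * D t ?t) $$ (i, j)"
            using ij carrier_matD[OF Cc] by (simp add: D_def scalar_prod_def atLeast0LessThan)
          finally show "(D t ?h * (t \<cdot>\<^sub>m L a)) $$ (i, j) = (?C * D t ?t) $$ (i, j)" .
        qed (use carrier_matD[OF Cc] carrier_matD[OF Lc[OF a]] in \<open>auto simp: D_def\<close>)
        have tM: "t \<cdot>\<^sub>m M a \<in> carrier_mat (d ?h) (d ?t)" using Mc[OF a] by simp
        have ic: "?i \<in> carrier_mat (d ?h) (d ?h)" by (rule GL_inv(1)[OF h vs(1)])
        have hc: "h ?h \<in> carrier_mat (d ?h) (d ?h)" using h vs by (simp add: GL_carrier_iff)
        have "h ?h * (t \<cdot>\<^sub>m M a) = D t ?h * (Gi ?h * (t \<cdot>\<^sub>m M a))"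
          using vs by (simp add: h_def assoc_mult_mat[OF Dc Gic[OF vs(1)] tM])
        also have "Gi ?h * (t \<cdot>\<^sub>m M a) = (t \<cdot>\<^sub>m L a) * Gi ?t"
          using mult_smult_distrib[OF Gic[OF vs(1)] Mc[OF a]] mult_smult_assoc_mat[OF Lc[OF a] Gic[OF vs(2)]] GiM[OF a]
          by metis
        also have "D t ?h * \<dots> = D t ?h * (t \<cdot>\<^sub>m L a) * Gi ?t"
          by (rule assoc_mult_mat[symmetric, OF Dc _ Gic[OF vs(2)]]) (use Lc[OF a] in simp)
        also have "\<dots> = ?C * h ?t"
          unfolding DL using vs by (simp add: h_def assoc_mult_mat[OF Cc Dc Gic[OF vs(2)]])
        finally have eq: "?C * h ?t = h ?h * (t \<cdot>\<^sub>m M a)" ..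
        have htc: "h ?t \<in> carrier_mat (d ?t) (d ?t)" using h vs by (simp add: GL_carrier_iff)
        have "rep_act Q d (inv\<^bsub>GL Q d\<^esub> h) (C (inverse t)) a = ?i * (?C * h ?t)"
          unfolding rep_act_inv[OF h a] by (rule assoc_mult_mat[OF ic Cc htc])
        also have "\<dots> = ?i * h ?h * (t \<cdot>\<^sub>m M a)"
          unfolding eq by (rule assoc_mult_mat[symmetric, OF ic hc tM])
        also have "\<dots> = t \<cdot>\<^sub>m M a"
          unfolding GL_inv(3)[OF h vs(1)] by (rule left_mult_one_mat[OF tM])
        finally show ?thesis using a by (simp add: scale_rep_def)
      qed (simp add: scale_rep_def rep_act_def)
    qed
    then have "F (scale_rep Q t M) = weight_char Q \<theta> h * F (C (inverse t))"
      using inv[OF h Cs] by simp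
    also have "weight_char Q \<theta> h = (\<Prod>v\<in>verts Q. det (Gi v) powi \<theta> v * t powi (int (e v) * \<theta> v))"
      unfolding weight_char_def
    proof (rule prod.cong[OF refl])
      fix v assume v: "v \<in> verts Q"
      have "det (h v) = t ^ e v * det (Gi v)"
        using v by (simp add: h_def det_mult[OF Dc Gic[OF v]] detD)
      then have "det (h v) powi \<theta> v = (t ^ e v) powi \<theta> v * det (Gi v) powi \<theta> v"
        by (simp add: power_int_mult_distrib)
      also have "(t ^ e v) powi \<theta> v = t powi (int (e v) * \<theta> v)"
        by (simp add: power_int_mult flip: power_int_of_nat)
      finally show "det (h v) powi \<theta> v = det (Gi v) powi \<theta> v * t powi (int (e v) * \<theta> v)" by (simp add: mult.commute)
    qed
    also have "\<dots> = \<kappa> * t powi E"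
    proof -
      have "(\<Prod>v\<in>A. t powi f v) = t powi (\<Sum>v\<in>A. f v)" if "finite A" for A and f :: "'v \<Rightarrow> int"
        using that by (induction A rule: finite_induct) (simp_all add: power_int_add t)
      then show ?thesis by (simp add: prod.distrib \<kappa>_def E_def)
    qed
    finally show ?thesis .
  qed
  have "\<exists>q. degree q \<le> k * m \<and> (\<forall>s. F (C s) = poly q s)"
  proof (rule poly_le_curve[OF F])
    fix a i j assume a: "a \<in> arcs Q" "i < d (head Q a)" "j < d (tail Q a)"
    let ?x = "\<omega> (tail Q a) j - \<omega> (head Q a) i - 1"
    have "?x \<le> m" using \<omega>[of "tail Q a" j] a by simp linarith?
    then show "\<exists>p. degree p \<le> m \<and> (\<forall>s. C s a $$ (i, j) = poly p s)"
      using a by (intro exI[of _ "monom (L a $$ (i, j)) ?x"])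
        (auto simp: C_def poly_monom mult.commute intro: order_trans[OF degree_monom_le])
  qed
  then obtain q where q: "\<And>s. F (C s) = poly q s" by blast
  have "int (degree p) \<le> max 0 E"
    by (rule degree_from_inverse[of p \<kappa> E q]) (use key p q in simp)
  also have "\<dots> \<le> int (\<Sum>v\<in>verts Q. nat \<bar>\<theta> v\<bar> * (m * d v))"
  proof -
    have "E \<le> (\<Sum>v\<in>verts Q. \<bar>\<theta> v\<bar> * int (m * d v))"
      unfolding E_def
    proof (rule sum_mono)
      fix v assume v: "v \<in> verts Q"
      have "e v \<le> (\<Sum>i<d v. m)" unfolding e_def by (rule sum_mono) (use \<omega>[OF v] in auto)
      then have "e v \<le> m * d v" by (simp add: mult.commute)
      then have "int (e v) \<le> int (m * d v)" by (rule of_nat_mono)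
      then have "int (e v) * \<bar>\<theta> v\<bar> \<le> int (m * d v) * \<bar>\<theta> v\<bar>" by (rule mult_right_mono) simp
      moreover have "int (e v) * \<theta> v \<le> int (e v) * \<bar>\<theta> v\<bar>" by (rule mult_left_mono) auto
      ultimately show "int (e v) * \<theta> v \<le> \<bar>\<theta> v\<bar> * int (m * d v)" by (simp add: mult.commute)
    qed
    also have "\<dots> = int (\<Sum>v\<in>verts Q. nat \<bar>\<theta> v\<bar> * (m * d v))" by simp
    finally show ?thesis by (rule max.boundedI[OF of_nat_0_le_iff])
  qed
  finally show ?thesis by (simp only: of_nat_le_iff)
qed

text \<open>The scalar t at v and 1 elsewhere multiplies the arrows leaving v by t and fixes the
  others, since no arrow enters v. A polynomial in t then equals t^(d v * \<theta> v) times a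
  nonzero value, so the exponent cannot be negative.\<close>

lemma source_weight_nonneg:
  fixes Z :: "('a, 'k::field_char_0) qrep set"
  assumes Q: "fin_digraph Q" and v: "v \<in> verts Q" "d v > 0" and source: "\<And>a. a \<in> arcs Q \<Longrightarrow> head Q a \<noteq> v"
    and Z: "Z \<subseteq> rep_space Q d" and SI: "SI Q d \<theta> Z \<noteq> {0}"
  shows "\<theta> v \<ge> 0"
proof (rule ccontr)
  interpret fin_digraph Q by fact
  assume neg: "\<not> \<theta> v \<ge> 0"
  have "restr Z (\<lambda>M. 0 :: 'k) = 0" by (auto simp: restr_def fun_eq_iff)
  then have "0 \<in> coord_ring Q d Z" unfolding coord_ring_def using poly_funs.const[of 0 Q d] by force
  then have "0 \<in> SI Q d \<theta> Z" by (simp add: SI_def)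
  then obtain f where f: "f \<in> SI Q d \<theta> Z" "f \<noteq> 0" using SI by blast
  then obtain F k where F: "f = restr Z F" "poly_le Q d k F"
    by (auto simp: SI_def coord_ring_def dest: poly_funs_imp_poly_le)
  obtain M where fM: "f M \<noteq> 0" using f(2) by (auto simp: fun_eq_iff)
  then have M: "M \<in> Z" by (auto simp: F restr_def split: if_splits)
  have Ms: "M \<in> rep_space Q d" using M Z by blast
  define C where "C t = (\<lambda>a\<in>arcs Q. (if tail Q a = v then t else 1) \<cdot>\<^sub>m M a)" for t
  have "\<exists>q. degree q \<le> k * 1 \<and> (\<forall>t. F (C t) = poly q t)"
  proof (rule poly_le_curve[OF F(2)])
    fix a i j assume a: "a \<in> arcs Q" "i < d (head Q a)" "j < d (tail Q a)"
    have "M a \<in> carrier_mat (d (head Q a)) (d (tail Q a))" using Ms a by (auto simp: rep_space_def)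
    then have "C t a $$ (i, j) = poly (if tail Q a = v then [:0, M a $$ (i, j):] else [:M a $$ (i, j):]) t" for t
      using a by (auto simp: C_def)
    then show "\<exists>p. degree p \<le> 1 \<and> (\<forall>t. C t a $$ (i, j) = poly p t)"
      by (intro exI[of _ "if tail Q a = v then [:0, M a $$ (i, j):] else [:M a $$ (i, j):]"]) auto
  qed
  then obtain q where q: "\<And>t. F (C t) = poly q t" by blast
  define n where "n = d v * nat (- \<theta> v)"
  have n: "n > 0" using v neg by (simp add: n_def)
  have key: "poly q t * t ^ n = f M" if t: "t \<noteq> 0" for t
  proof -
    define g where "g = (\<lambda>x\<in>verts Q. (if x = v then t else 1) \<cdot>\<^sub>m 1\<^sub>m (d x))"
    have g: "g \<in> carrier (GL Q d)" unfolding GL_carrier_iff g_def using t by auto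
    have w: "weight_char Q \<theta> g = t powi (int (d v) * \<theta> v)"
    proof -
      have "weight_char Q \<theta> g = (\<Prod>x\<in>verts Q. if x = v then t powi (int (d v) * \<theta> v) else 1)"
        unfolding weight_char_def
        by (rule prod.cong) (auto simp: g_def power_int_mult simp flip: power_int_of_nat)
      then show ?thesis using v by simp
    qed
    have act: "rep_act Q d (inv\<^bsub>GL Q d\<^esub> g) M = C t"
    proof
      fix a
      show "rep_act Q d (inv\<^bsub>GL Q d\<^esub> g) M a = C t a"
      proof (cases "a \<in> arcs Q")
        case a: True
        let ?h = "head Q a" and ?t = "tail Q a"
        have vs: "?h \<in> verts Q" "?t \<in> verts Q" using a by auto
        have Ma: "M a \<in> carrier_mat (d ?h) (d ?t)" using Ms a by (auto simp: rep_space_def)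
        have "g ?h = 1\<^sub>m (d ?h)" using source[OF a] vs by (auto simp: g_def)
        then have "(inv\<^bsub>GL Q d\<^esub> g) ?h = 1\<^sub>m (d ?h)"
          using GL_inv(1,2)[OF g vs(1)] by (metis left_mult_one_mat)
        then have "rep_act Q d (inv\<^bsub>GL Q d\<^esub> g) M a = M a * g ?t"
          unfolding rep_act_inv[OF g a] using Ma by simp
        also have "\<dots> = (if ?t = v then t else 1) \<cdot>\<^sub>m M a"
          using vs Ma mult_smult_distrib[OF Ma one_carrier_mat, of "if ?t = v then t else 1"] by (simp add: g_def)
        finally show ?thesis using a by (simp add: C_def)
      qed (simp add: rep_act_def C_def)
    qed
    have "f (rep_act Q d (inv\<^bsub>GL Q d\<^esub> g) M) = weight_char Q \<theta> g * f M"
      using f(1) g M by (auto simp: SI_def)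
    then have "f (C t) = t powi (int (d v) * \<theta> v) * f M" unfolding act w .
    moreover from this have "f (C t) \<noteq> 0" using fM t by simp
    \<comment> \<open>f is zero outside Z, so its nonzero value places C t in Z, where f agrees with
      F.\<close>
    then have "f (C t) = poly q t" by (auto simp: F restr_def q split: if_splits)
    ultimately have "poly q t * t ^ n = t powi (int (d v) * \<theta> v) * t ^ n * f M" by simp
    also have "t powi (int (d v) * \<theta> v) * t ^ n = t powi (int (d v) * \<theta> v + int n)"
      using t by (simp add: power_int_add)
    also have "int (d v) * \<theta> v + int n = 0" using neg by (simp add: n_def algebra_simps)
    finally show ?thesis by simp
  qed
  have "poly q 0 * 0 ^ n - f M = 0"
  proof (rule is_poly_zero[where f = "\<lambda>t. poly q t * t ^ n - f M" and B = "{0}"])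
    have "is_poly (\<lambda>t. poly q t)" by (auto simp: is_poly_def)
    then show "is_poly (\<lambda>t. poly q t * t ^ n - f M)"
      by (intro is_poly_diff is_poly_mult is_poly_power is_poly_id is_poly_const)
  qed (use key in auto)
  then show False using fM zero_power[OF n, where 'a = 'k] by simp
qed

section \<open>Spaces of semi-invariants\<close>

lemma subspace_coord_ring: "fun_space.subspace (coord_ring Q d Z :: (('a, 'k::field) qrep \<Rightarrow> 'k) set)"
  unfolding fun_space.subspace_def
proof (intro conjI ballI allI)
  have "0 = restr Z (\<lambda>M. 0 :: 'k)" by (auto simp: restr_def fun_eq_iff)
  then show "(0 :: ('a, 'k) qrep \<Rightarrow> 'k) \<in> coord_ring Q d Z"
    unfolding coord_ring_def using poly_funs.const by (rule image_eqI)
next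
  fix f g :: "('a, 'k) qrep \<Rightarrow> 'k" assume "f \<in> coord_ring Q d Z" "g \<in> coord_ring Q d Z"
  then obtain F G where "f = restr Z F" "F \<in> poly_funs Q d" "g = restr Z G" "G \<in> poly_funs Q d"
    by (auto simp: coord_ring_def)
  moreover have "restr Z F + restr Z G = restr Z (F + G)" by (auto simp: restr_def fun_eq_iff)
  ultimately show "f + g \<in> coord_ring Q d Z" by (auto simp: coord_ring_def intro: image_eqI poly_funs.add)
next
  fix c :: 'k and f :: "('a, 'k) qrep \<Rightarrow> 'k" assume "f \<in> coord_ring Q d Z"
  then obtain F where "f = restr Z F" "F \<in> poly_funs Q d" by (auto simp: coord_ring_def)
  moreover have "(\<lambda>x. c * restr Z F x) = restr Z ((\<lambda>M. c) * F)" by (auto simp: restr_def fun_eq_iff)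
  ultimately show "(\<lambda>x. c * f x) \<in> coord_ring Q d Z"
    by (auto simp: coord_ring_def intro: image_eqI poly_funs.mult poly_funs.const)
qed

lemma subspace_SI: "fun_space.subspace (SI Q d \<theta> Z)"
proof -
  have "SI Q d \<theta> Z \<subseteq> coord_ring Q d Z" by (auto simp: SI_def)
  then show ?thesis
    using subspace_coord_ring[of Q d Z] unfolding fun_space.subspace_def
    by (auto simp: SI_def algebra_simps)
qed

section \<open>Weights off the support; restriction and extension of semi-invariants\<close>

lemma weight_char_cong:
  assumes g: "g \<in> carrier (GL Q d)" and eq: "\<And>v. v \<in> verts Q \<Longrightarrow> d v > 0 \<Longrightarrow> \<theta> v = \<theta>' v"
  shows "weight_char Q \<theta> g = weight_char Q \<theta>' g"
  unfolding weight_char_def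
proof (rule prod.cong[OF refl])
  fix v assume v: "v \<in> verts Q"
  show "det (g v) powi \<theta> v = det (g v) powi \<theta>' v"
  proof (cases "d v = 0")
    case True
    then have "det (g v) = 1" using g v by (auto simp: GL_carrier_iff)
    then show ?thesis by simp
  qed (use eq v in simp)
qed

lemma SI_cong:
  assumes "\<And>v. v \<in> verts Q \<Longrightarrow> d v > 0 \<Longrightarrow> \<theta> v = \<theta>' v"
  shows "SI Q d \<theta> Z = (SI Q d \<theta>' Z :: (('a, 'k::field) qrep \<Rightarrow> 'k) set)"
proof -
  have "weight_char Q \<theta> g = weight_char Q \<theta>' g" if "g \<in> carrier (GL Q d)" for g :: "_ \<Rightarrow> 'k mat"
    using weight_char_cong[OF that assms] .
  then show ?thesis unfolding SI_def by auto
qed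

lemma GL_invariant_inv:
  assumes "GL_invariant Q d Z" "g \<in> carrier (GL Q d)" "M \<in> Z"
  shows "rep_act Q d (inv\<^bsub>GL Q d\<^esub> g) M \<in> Z"
  using assms group.inv_closed[OF group_GL assms(2)] by (auto simp: GL_invariant_def)

lemma SI_restr:
  assumes f: "f \<in> SI Q d \<theta> Y" and Z: "Z \<subseteq> Y" "GL_invariant Q d Z"
  shows "restr Z f \<in> SI Q d \<theta> Z"
proof -
  obtain F where F: "f = restr Y F" "F \<in> poly_funs Q d" using f by (auto simp: SI_def coord_ring_def)
  have "restr Z f = restr Z F" using Z(1) by (auto simp: F restr_def fun_eq_iff)
  then have "restr Z f \<in> coord_ring Q d Z" using F(2) by (auto simp: coord_ring_def)
  moreover have "restr Z f (rep_act Q d (inv\<^bsub>GL Q d\<^esub> g) M) = weight_char Q \<theta> g * restr Z f M"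
    if "g \<in> carrier (GL Q d)" "M \<in> Z" for g M
    using GL_invariant_inv[OF Z(2) that] that f Z(1) by (auto simp: SI_def restr_def)
  ultimately show ?thesis by (simp add: SI_def)
qed

lemma SI_poly_le:
  assumes "f \<in> SI Q d \<theta> Z"
  obtains k F where "poly_le Q d k F" "f = restr Z F"
proof -
  obtain F where "f = restr Z F" "F \<in> poly_funs Q d" using assms by (auto simp: SI_def coord_ring_def)
  then show thesis using that poly_funs_imp_poly_le by blast
qed

lemma res_schofield_restr:
  assumes "Z \<subseteq> Y" shows "res_schofield Q c d Z V = restr Z (res_schofield Q c d Y V)"
  using assms by (auto simp: res_schofield_def restr_def fun_eq_iff)

text \<open>A combination of restricted determinants extends from Z to Y with the same coefficients.
  This is how semi-invariants are extended to a larger set.\<close>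

lemma span_lift:
  assumes f: "f \<in> fun_space.span {res_schofield Q c d Z V | V. V \<in> A}" and Z: "Z \<subseteq> Y"
  shows "\<exists>F\<in>fun_space.span {res_schofield Q c d Y V | V. V \<in> A}. f = restr Z F"
  using f
proof (induction f rule: fun_space.span_induct_alt)
  case base
  show ?case by (intro bexI[OF _ fun_space.span_zero]) (auto simp: restr_def fun_eq_iff)
next
  case (step a f g)
  then obtain V F where V: "V \<in> A" "f = res_schofield Q c d Z V"
    and F: "F \<in> fun_space.span {res_schofield Q c d Y V | V. V \<in> A}" "g = restr Z F" by blast
  have "res_schofield Q c d Y V \<in> fun_space.span {res_schofield Q c d Y V | V. V \<in> A}"
    using V(1) by (intro fun_space.span_base) blast
  then have "(\<lambda>x. a * res_schofield Q c d Y V x) + F \<in> fun_space.span {res_schofield Q c d Y V | V. V \<in> A}"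
    using F(1) by (intro fun_space.span_add fun_space.span_scale)
  moreover have "(\<lambda>x. a * f x) + g = restr Z ((\<lambda>x. a * res_schofield Q c d Y V x) + F)"
    unfolding V(2) F(2) res_schofield_restr[OF Z] by (auto simp: restr_def fun_eq_iff)
  ultimately show ?case by blast
qed

lemma span_restr:
  assumes f: "f \<in> fun_space.span {res_schofield Q c d Y V | V. V \<in> A}" and Z: "Z \<subseteq> Y"
  shows "restr Z f \<in> fun_space.span {res_schofield Q c d Z V | V. V \<in> A}"
proof -
  have "restr Z (\<lambda>x. f ((\<lambda>x. x) x)) \<in> fun_space.span {res_schofield Q c d Z V | V. V \<in> A}"
  proof (rule span_image_comp[OF f])
    fix b assume "b \<in> {res_schofield Q c d Y V | V. V \<in> A}"
    then show "restr Z (\<lambda>x. b ((\<lambda>x. x) x)) \<in> fun_space.span {res_schofield Q c d Z V | V. V \<in> A}"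
      using res_schofield_restr[OF Z, of Q c d] by (intro fun_space.span_base) auto
  qed
  then show ?thesis by simp
qed

text \<open>The conditions on m and N have separate sources: k \<le> m v clears denominators, N v =
  m v + \<theta> v is the exponent of det(h v) after using semi-invariance, and m v \<le>
  \<open>in_dim Q N v\<close> makes the dimension at (v, 1) meaningful.\<close>

lemma SI_in_span:
  fixes F :: "('a, 'k::field_char_0) qrep \<Rightarrow> 'k"
  assumes Q: "fin_digraph Q" and Z: "Z \<subseteq> rep_space Q d" "GL_invariant Q d Z"
    and f: "restr Z F \<in> SI Q d \<theta> Z" and F: "poly_le Q d k F"
    and m: "\<And>v. v \<in> verts Q \<Longrightarrow> k \<le> m v" and mN: "\<And>v. v \<in> verts Q \<Longrightarrow> m v \<le> in_dim Q N v"
    and N: "\<And>v. v \<in> verts Q \<Longrightarrow> int (N v) = int (m v) + \<theta> v"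
    and sum_eq: "(\<Sum>v\<in>verts Q. m v * d v) = (\<Sum>v\<in>verts Q. N v * d v)"
  shows "restr Z F \<in> fun_space.span {res_schofield Q (cdim Q m N) d Z V | V.
    V \<in> rep_space (double_quiver Q) (cdim Q m N)}" (is "_ \<in> fun_space.span ?R")
proof -
  have "F (rep_act Q d (inv\<^bsub>GL Q d\<^esub> g) M) = weight_char Q \<theta> g * F M"
    if "g \<in> carrier (GL Q d)" "M \<in> Z" for g M
  proof -
    have "restr Z F (rep_act Q d (inv\<^bsub>GL Q d\<^esub> g) M) = weight_char Q \<theta> g * restr Z F M"
      using f that by (auto simp: SI_def)
    then show ?thesis by (simp add: restr_def GL_invariant_inv[OF Z(2) that] that)
  qed
  then have "restr Z F \<in> fun_space.span (range (\<lambda>x. restr Z (\<lambda>M. block_poly Q d m N x (rep_W M))))"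
    by (intro averaging[OF Q Z F _ m N sum_eq])
  moreover have "range (\<lambda>x. restr Z (\<lambda>M. block_poly Q d m N x (rep_W M))) \<subseteq> fun_space.span ?R"
    using block_poly_in_span[OF Q mN sum_eq Z(1)] by auto
  ultimately show ?thesis
    using fun_space.span_minimal[OF _ fun_space.subspace_span] by blast
qed

lemma res_schofield_SI:
  fixes V :: "('v + 'a, 'k::field) qrep"
  assumes Q: "fin_digraph Q" and Z: "Z \<subseteq> rep_space Q d" "GL_invariant Q d Z"
    and mN: "\<And>v. v \<in> verts Q \<Longrightarrow> m v \<le> in_dim Q N v"
    and N: "\<And>v. v \<in> verts Q \<Longrightarrow> int (N v) = int (m v) + \<theta> v"
    and sum_eq: "(\<Sum>v\<in>verts Q. m v * d v) = (\<Sum>v\<in>verts Q. N v * d v)"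
    and V: "V \<in> rep_space (double_quiver Q) (cdim Q m N)"
  shows "res_schofield Q (cdim Q m N) d Z V \<in> SI Q d \<theta> Z"
proof -
  let ?c = "cdim Q m N"
  have card: "card (tgt_idx Q ?c d) = card (src_idx Q ?c d)"
    using card_cdim[OF Q mN sum_eq] by simp
  have eq: "schofield (double_quiver Q) ?c (double_dim d) V (double_rep Q d (rep_act Q d (inv\<^bsub>GL Q d\<^esub> g) M)) =
      weight_char Q \<theta> g * schofield (double_quiver Q) ?c (double_dim d) V (double_rep Q d M)"
    if g: "g \<in> carrier (GL Q d)" and M: "M \<in> Z" for g M
  proof (rule schofield_semi_invariant[OF Q V card _ _ g])
    show "M \<in> rep_space Q d" using M Z(1) by blast
    show "int (?c (v, 0) + ?c (v, 1)) = int (in_dim Q (\<lambda>v. ?c (v, 0)) v) + \<theta> v" if "v \<in> verts Q" for v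
      using mN[OF that] N[OF that] by simp
  qed
  have "res_schofield Q ?c d Z V = restr Z (\<lambda>M. detI (tgt_idx Q ?c d) (src_idx Q ?c d) (sentry Q V (rep_W M)))"
    using Z(1) by (auto simp: res_schofield_def restr_def fun_eq_iff schofield_double[OF Q V])
  moreover have "(\<lambda>M. detI (tgt_idx Q ?c d) (src_idx Q ?c d) (sentry Q V (rep_W M))) \<in> poly_funs Q d"
    by (rule poly_le_imp_poly_funs[OF poly_le_sentry_rep]) (simp add: card)
  ultimately have "res_schofield Q ?c d Z V \<in> coord_ring Q d Z" by (simp add: coord_ring_def)
  then show ?thesis
    unfolding SI_def using eq GL_invariant_inv[OF Z(2)] by (auto simp: res_schofield_def restr_def)
qed

text \<open>All m v are k + 2K with K the sum of the |\<theta> v|, so every N v is at least K. Where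
  \<theta> v \<ge> 0, the arrow c_v alone brings N v \<ge> m v. Elsewhere some arrow of Q enters v,
  and the N \<ge> K at its tail makes up for \<theta> v. The choice does not involve d.\<close>

lemma weight_parameters:
  assumes Q: "fin_digraph Q"
    and source: "\<forall>v\<in>verts Q. v \<notin> head Q ` arcs Q \<longrightarrow> \<theta> v \<ge> 0"
  shows "\<exists>m N. \<forall>v\<in>verts Q. k \<le> m v \<and> m v \<le> in_dim Q N v \<and> int (N v) = int (m v) + \<theta> v"
proof -
  interpret fin_digraph Q by fact
  define K where "K = (\<Sum>v\<in>verts Q. nat \<bar>\<theta> v\<bar>)"
  define m where "m v = k + 2 * K" for v :: 'a
  define N where "N v = nat (int (m v) + \<theta> v)" for v
  have K: "\<bar>\<theta> v\<bar> \<le> int K" if "v \<in> verts Q" for v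
  proof -
    have "nat \<bar>\<theta> v\<bar> \<le> K" unfolding K_def using that by (intro member_le_sum) auto
    then show ?thesis by linarith
  qed
  have N: "int (N v) = int (m v) + \<theta> v" if "v \<in> verts Q" for v
    using K[OF that] by (simp add: N_def m_def)
  have mN: "m v \<le> in_dim Q N v" if v: "v \<in> verts Q" for v
  proof -
    have fin: "finite {b \<in> darcs Q. tgt Q b = v}" using finite_darcs[OF Q] by simp
    have "Inl v \<in> {b \<in> darcs Q. tgt Q b = v}" using v by (auto simp: darcs_def)
    show ?thesis
    proof (cases "\<theta> v \<ge> 0")
      case True
      have "N (src Q (Inl v)) \<le> in_dim Q N v"
        unfolding in_dim_def
        by (rule member_le_sum[of "Inl v" _ "\<lambda>b. N (src Q b)"]) (use fin v in \<open>auto simp: darcs_def\<close>)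
      moreover have "m v \<le> N v" using N[OF v] True by simp
      ultimately show ?thesis by simp
    next
      case False
      then have "v \<in> head Q ` arcs Q" using source v by auto
      then obtain a where a: "a \<in> arcs Q" "head Q a = v" by auto
      have "(\<Sum>b\<in>{Inl v, Inr a}. N (src Q b)) \<le> in_dim Q N v"
        unfolding in_dim_def by (rule sum_mono2[OF fin]) (use v a in \<open>auto simp: darcs_def\<close>)
      then have "N v + N (tail Q a) \<le> in_dim Q N v" by simp
      moreover have "int (N (tail Q a)) \<ge> int K" using N[of "tail Q a"] K[of "tail Q a"] a by (simp add: m_def)
      ultimately show ?thesis using N[OF v] K[OF v] by linarith
    qed
  qed
  have "k \<le> m v" for v by (simp add: m_def)
  then have "\<forall>v\<in>verts Q. k \<le> m v \<and> m v \<le> in_dim Q N v \<and> int (N v) = int (m v) + \<theta> v"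
    by (intro ballI conjI mN N)
  then show ?thesis by (intro exI)
qed

lemma weight_parameters_sum:
  assumes "weight_eval Q \<theta> d = 0" and N: "\<And>v. v \<in> verts Q \<Longrightarrow> int (N v) = int (m v) + \<theta> v"
  shows "(\<Sum>v\<in>verts Q. m v * d v) = (\<Sum>v\<in>verts Q. N v * d v)"
proof -
  have "int (\<Sum>v\<in>verts Q. N v * d v) = (\<Sum>v\<in>verts Q. (int (m v) + \<theta> v) * int (d v))"
    unfolding of_nat_sum of_nat_mult by (rule sum.cong[OF refl]) (simp add: N)
  also have "\<dots> = int (\<Sum>v\<in>verts Q. m v * d v) + weight_eval Q \<theta> d"
    by (simp add: weight_eval_def distrib_right sum.distrib)
  finally show ?thesis using assms(1) by linarith
qed

lemma GL_invariant_rep_space: "fin_digraph Q \<Longrightarrow> GL_invariant Q d (rep_space Q d)"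
  unfolding GL_invariant_def using rep_act_rep_space by blast

section \<open>Invariance of the variety under base change, and the degree bound on it\<close>

lemma path_mat_rep_act:
  assumes Q: "fin_digraph Q" and g: "g \<in> carrier (GL Q d)" and M: "M \<in> rep_space Q d"
  shows "pre_digraph.awalk Q u p v \<Longrightarrow>
    path_mat Q d (rep_act Q d g M) u p = g v * path_mat Q d M u p * (inv\<^bsub>GL Q d\<^esub> g) u"
proof -
  interpret fin_digraph Q by fact
  let ?i = "inv\<^bsub>GL Q d\<^esub> g"
  have gc: "g v \<in> carrier_mat (d v) (d v)" if "v \<in> verts Q" for v using g that by (simp add: GL_carrier_iff)
  note ic = GL_inv(1)[OF g]
  show "awalk u p v \<Longrightarrow> path_mat Q d (rep_act Q d g M) u p = g v * path_mat Q d M u p * ?i u"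
  proof (induction p arbitrary: u)
    case Nil
    then have "u = v" "v \<in> verts Q" by (auto simp: awalk_Nil_iff)
    then show ?case using gc[of v] GL_inv(2)[OF g, of v] by simp
  next
    case (Cons a p)
    let ?h = "head Q a"
    from Cons.prems have a: "a \<in> arcs Q" "u = tail Q a" "awalk ?h p v" by (auto simp: awalk_Cons_iff)
    have vs: "u \<in> verts Q" "?h \<in> verts Q" "v \<in> verts Q" using a by auto
    have Ma: "M a \<in> carrier_mat (d ?h) (d u)" using M a by (auto simp: rep_space_def)
    have P: "path_mat Q d M ?h p \<in> carrier_mat (d v) (d ?h)" by (rule path_mat_carrier[OF Q M a(3)])
    let ?P = "path_mat Q d M ?h p"
    have gP: "g v * ?P \<in> carrier_mat (d v) (d ?h)" by (rule mult_carrier_mat[OF gc[OF vs(3)] P])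
    have Mi: "M a * ?i u \<in> carrier_mat (d ?h) (d u)" by (rule mult_carrier_mat[OF Ma ic[OF vs(1)]])
    have "rep_act Q d g M a = g ?h * M a * ?i u" using a by (simp add: rep_act_def)
    also have "\<dots> = g ?h * (M a * ?i u)" by (rule assoc_mult_mat[OF gc[OF vs(2)] Ma ic[OF vs(1)]])
    finally have act: "rep_act Q d g M a = g ?h * (M a * ?i u)" .
    have "path_mat Q d (rep_act Q d g M) u (a # p) = g v * ?P * ?i ?h * (g ?h * (M a * ?i u))"
      using Cons.IH[OF a(3)] act by simp
    also have "\<dots> = g v * ?P * (?i ?h * (g ?h * (M a * ?i u)))"
      by (rule assoc_mult_mat[OF gP ic[OF vs(2)] mult_carrier_mat[OF gc[OF vs(2)] Mi]])
    also have "?i ?h * (g ?h * (M a * ?i u)) = ?i ?h * g ?h * (M a * ?i u)"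
      by (rule assoc_mult_mat[symmetric, OF ic[OF vs(2)] gc[OF vs(2)] Mi])
    also have "\<dots> = M a * ?i u" unfolding GL_inv(3)[OF g vs(2)] by (rule left_mult_one_mat[OF Mi])
    also have "g v * ?P * (M a * ?i u) = g v * ?P * M a * ?i u"
      by (rule assoc_mult_mat[symmetric, OF gP Ma ic[OF vs(1)]])
    also have "g v * ?P * M a = g v * (?P * M a)" by (rule assoc_mult_mat[OF gc[OF vs(3)] P Ma])
    finally show ?case by simp
  qed
qed

lemma GL_invariant_rep_variety:
  fixes R :: "('v \<times> 'a list \<Rightarrow> 'k::field) set"
  assumes Q: "fin_digraph Q"
  shows "GL_invariant Q d (rep_variety Q R d)"
  unfolding GL_invariant_def
proof (intro ballI)
  fix g :: "'v \<Rightarrow> 'k mat" and M :: "('a, 'k) qrep"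
  assume g: "g \<in> carrier (GL Q d)" and M: "M \<in> rep_variety Q R d"
  interpret fin_digraph Q by fact
  let ?i = "inv\<^bsub>GL Q d\<^esub> g"
  have Ms: "M \<in> rep_space Q d" using M by (simp add: rep_variety_def)
  have "rel_entry Q d (rep_act Q d g M) r u v i j = 0"
    if r: "r \<in> R" and u: "u \<in> verts Q" and v: "v \<in> verts Q" and ij: "i < d v" "j < d u" for r u v i j
  proof -
    let ?S = "{p. r (u, p) \<noteq> 0 \<and> awalk u p v}"
    have z: "rel_entry Q d M r u v x y = 0" if "x < d v" "y < d u" for x y
      using M r u v that by (auto simp: rep_variety_def eval_rel_zero_iff)
    have "path_mat Q d (rep_act Q d g M) u p $$ (i, j) =
        (\<Sum>y<d u. \<Sum>x<d v. g v $$ (i, x) * path_mat Q d M u p $$ (x, y) * ?i u $$ (y, j))" if p: "p \<in> ?S" for p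
    proof -
      have aw: "awalk u p v" using p by simp
      have P: "path_mat Q d M u p \<in> carrier_mat (d v) (d u)" by (rule path_mat_carrier[OF Q Ms aw])
      have gc: "g v \<in> carrier_mat (d v) (d v)" using g v by (simp add: GL_carrier_iff)
      have ic: "?i u \<in> carrier_mat (d u) (d u)" by (rule GL_inv(1)[OF g u])
      show ?thesis
        unfolding path_mat_rep_act[OF Q g Ms aw]
        using ij carrier_matD[OF P] carrier_matD[OF gc] carrier_matD[OF ic]
        by (simp add: scalar_prod_def atLeast0LessThan sum_distrib_right)
    qed
    then have "rel_entry Q d (rep_act Q d g M) r u v i j =
        (\<Sum>p\<in>?S. \<Sum>y<d u. \<Sum>x<d v. g v $$ (i, x) * ?i u $$ (y, j) * (r (u, p) * path_mat Q d M u p $$ (x, y)))"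
      unfolding rel_entry_def by (intro sum.cong refl) (simp add: sum_distrib_left mult_ac)
    also have "\<dots> = (\<Sum>y<d u. \<Sum>x<d v. \<Sum>p\<in>?S. g v $$ (i, x) * ?i u $$ (y, j) * (r (u, p) * path_mat Q d M u p $$ (x, y)))"
      by (rule trans[OF sum.swap], rule sum.cong[OF refl], rule sum.swap)
    also have "\<dots> = (\<Sum>y<d u. \<Sum>x<d v. g v $$ (i, x) * ?i u $$ (y, j) * rel_entry Q d M r u v x y)"
      unfolding rel_entry_def sum_distrib_left ..
    also have "\<dots> = 0" by (intro sum.neutral ballI) (simp add: z)
    finally show ?thesis .
  qed
  then show "rep_act Q d g M \<in> rep_variety Q R d"
    using rep_act_rep_space[OF Q g Ms] by (auto simp: rep_variety_def eval_rel_zero_iff)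
qed

text \<open>
  Extend a semi-invariant of the variety to one of the representation space and discard the
  homogeneous parts of high degree, which vanish at nilpotent representations.
\<close>

lemma SI_degree_bound:
  fixes f :: "('a, 'k::field_char_0) qrep \<Rightarrow> 'k"
  assumes Q: "fin_digraph Q"
    and source: "\<forall>v\<in>verts Q. v \<notin> head Q ` arcs Q \<longrightarrow> \<theta> v \<ge> 0"
    and weight: "weight_eval Q \<theta> d = 0"
    and nil: "\<And>M u p v. M \<in> rep_variety Q R d \<Longrightarrow> pre_digraph.awalk Q u p v \<Longrightarrow> m \<le> length p \<Longrightarrow>
      path_mat Q d M u p = 0\<^sub>m (d v) (d u)"
    and f: "f \<in> SI Q d \<theta> (rep_variety Q R d)"
    and B: "(\<Sum>v\<in>verts Q. nat \<bar>\<theta> v\<bar> * (m * d v)) \<le> B"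
  shows "\<exists>F. poly_le Q d B F \<and> f = restr (rep_variety Q R d) F"
proof -
  let ?Z = "rep_variety Q R d" and ?Y = "rep_space Q d"
  have ZY: "?Z \<subseteq> ?Y" by (auto simp: rep_variety_def)
  obtain k F where F: "poly_le Q d k F" "f = restr ?Z F" using SI_poly_le[OF f] .
  obtain m0 N where "\<forall>v\<in>verts Q. k \<le> m0 v \<and> m0 v \<le> in_dim Q N v \<and> int (N v) = int (m0 v) + \<theta> v"
    using weight_parameters[OF Q source, of k] by (elim exE)
  then have m0: "\<And>v. v \<in> verts Q \<Longrightarrow> k \<le> m0 v" and mN: "\<And>v. v \<in> verts Q \<Longrightarrow> m0 v \<le> in_dim Q N v"
    and N: "\<And>v. v \<in> verts Q \<Longrightarrow> int (N v) = int (m0 v) + \<theta> v" by simp_all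
  note sum_eq = weight_parameters_sum[OF weight N]
  \<comment> \<open>The degree estimate uses semi-invariance at points outside the variety. Here m0
    is adapted to the degree k of this particular F, and the resulting determinants are
    semi-invariant everywhere.\<close>
  have "f \<in> fun_space.span {res_schofield Q (cdim Q m0 N) d ?Z V | V. V \<in> rep_space (double_quiver Q) (cdim Q m0 N)}"
    using SI_in_span[OF Q ZY GL_invariant_rep_variety[OF Q] _ F(1) m0 mN N sum_eq] f F(2) by simp
  then obtain F' where F': "F' \<in> fun_space.span {res_schofield Q (cdim Q m0 N) d ?Y V | V. V \<in> rep_space (double_quiver Q) (cdim Q m0 N)}"
    and fF': "f = restr ?Z F'" using span_lift[OF _ ZY] by blast
  have "{res_schofield Q (cdim Q m0 N) d ?Y V | V. V \<in> rep_space (double_quiver Q) (cdim Q m0 N)} \<subseteq> SI Q d \<theta> ?Y"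
    using res_schofield_SI[OF Q subset_refl GL_invariant_rep_space[OF Q] mN N sum_eq] by auto
  then have SI: "F' \<in> SI Q d \<theta> ?Y"
    using fun_space.span_minimal[OF _ subspace_SI] F' by blast
  then obtain k1 F1 where F1: "poly_le Q d k1 F1" "F' = restr ?Y F1" by (rule SI_poly_le)
  have inv: "F1 (rep_act Q d (inv\<^bsub>GL Q d\<^esub> g) M) = weight_char Q \<theta> g * F1 M"
    if "g \<in> carrier (GL Q d)" "M \<in> ?Y" for g M
  proof -
    have "F' (rep_act Q d (inv\<^bsub>GL Q d\<^esub> g) M) = weight_char Q \<theta> g * F' M"
      using SI that by (auto simp: SI_def)
    then show ?thesis
      by (simp add: F1(2) restr_def GL_invariant_inv[OF GL_invariant_rep_space[OF Q] that] that)
  qed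
  obtain p where p: "\<And>k. poly_le Q d k (\<lambda>M. coeff (p M) k)"
    and Fp: "\<And>M t. M \<in> ?Y \<Longrightarrow> F1 (scale_rep Q t M) = poly (p M) t"
    using poly_le_homogeneous_parts[OF F1(1)] by (elim exE conjE) (rule that; simp)
  define F2 where "F2 M = (\<Sum>k\<le>B. coeff (p M) k)" for M
  have "poly_le Q d B F2"
    unfolding F2_def by (rule poly_le_sum) (rule poly_le_mono[OF p], simp)
  moreover have "f = restr ?Z F2"
  proof -
    have "F1 M = F2 M" if M: "M \<in> ?Z" for M
    proof -
      have MY: "M \<in> ?Y" using M ZY by blast
      have "degree (p M) \<le> (\<Sum>v\<in>verts Q. nat \<bar>\<theta> v\<bar> * (m * d v))"
        by (rule nilpotent_degree_bound[OF Q MY nil[OF M] F1(1) inv Fp[OF MY]])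
      then have deg: "degree (p M) \<le> B" using B by simp
      have "scale_rep Q 1 M = M"
      proof
        fix a show "scale_rep Q 1 M a = M a"
          using MY by (cases "a \<in> arcs Q") (auto simp: scale_rep_def rep_space_def PiE_iff extensional_def intro!: eq_matI)
      qed
      then have "F1 M = poly (p M) 1" using Fp[OF MY, of 1] by simp
      also have "\<dots> = (\<Sum>k\<le>degree (p M). coeff (p M) k)" by (simp add: poly_altdef)
      also have "\<dots> = F2 M"
        unfolding F2_def using deg by (intro sum.mono_neutral_left) (auto intro: coeff_eq_0)
      finally show ?thesis .
    qed
    then show ?thesis using ZY by (auto simp: fF' F1(2) restr_def fun_eq_iff)
  qed
  ultimately show ?thesis by blast
qed

section \<open>Generic weights\<close>

definition line_rep ::
    "('v, 'a) pre_digraph \<Rightarrow> ('v \<Rightarrow> nat) \<Rightarrow> ('a, 'k::field) qrep \<Rightarrow> ('a, 'k) qrep \<Rightarrow> 'k \<Rightarrow> ('a, 'k) qrep" where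
  "line_rep Q d V V' t = (\<lambda>a\<in>arcs Q. mat (d (head Q a)) (d (tail Q a))
     (\<lambda>(i, j). V a $$ (i, j) + t * (V' a $$ (i, j) - V a $$ (i, j))))"

lemma line_rep_space: "line_rep Q d V V' t \<in> rep_space Q d"
  by (auto simp: line_rep_def rep_space_def)

lemma line_rep_ends:
  assumes "V \<in> rep_space Q d" "V' \<in> rep_space Q d"
  shows "line_rep Q d V V' 0 = V" "line_rep Q d V V' 1 = V'"
proof -
  have *: "line_rep Q d V V' t = X" if X: "X \<in> rep_space Q d"
    and eq: "\<And>a i j. V a $$ (i, j) + t * (V' a $$ (i, j) - V a $$ (i, j)) = X a $$ (i, j)" for t X
  proof
    fix a show "line_rep Q d V V' t a = X a"
    proof (cases "a \<in> arcs Q")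
      case True
      then have "X a \<in> carrier_mat (d (head Q a)) (d (tail Q a))" using X by (auto simp: rep_space_def)
      then show ?thesis using True carrier_matD[of "X a"] by (intro eq_matI) (simp_all add: line_rep_def eq)
    qed (use X in \<open>auto simp: line_rep_def rep_space_def PiE_iff extensional_def\<close>)
  qed
  show "line_rep Q d V V' 0 = V" by (rule *[OF assms(1)]) simp
  show "line_rep Q d V V' 1 = V'" by (rule *[OF assms(2)]) simp
qed

lemma poly_le_line:
  assumes "poly_le Q d k f"
  shows "\<exists>q. degree q \<le> k \<and> (\<forall>t. f (line_rep Q d V V' t) = poly q t)"
proof -
  have "\<exists>q. degree q \<le> k * 1 \<and> (\<forall>t. f (line_rep Q d V V' t) = poly q t)"
  proof (rule poly_le_curve[OF assms])
    fix a i j assume "a \<in> arcs Q" "i < d (head Q a)" "j < d (tail Q a)"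
    then show "\<exists>p. degree p \<le> 1 \<and> (\<forall>t. line_rep Q d V V' t a $$ (i, j) = poly p t)"
      by (intro exI[of _ "[:V a $$ (i, j), V' a $$ (i, j) - V a $$ (i, j):]"]) (simp add: line_rep_def)
  qed
  then show ?thesis by simp
qed

lemma finite_line_zeros:
  assumes "poly_le Q d k f" "V \<in> rep_space Q d" "V' \<in> rep_space Q d" "f V \<noteq> 0 \<or> f V' \<noteq> 0"
  shows "finite {t. f (line_rep Q d V V' t) = 0}"
proof -
  obtain q where q: "\<And>t. f (line_rep Q d V V' t) = poly q t" using poly_le_line[OF assms(1)] by blast
  have "poly q 0 = f V" "poly q 1 = f V'" using q line_rep_ends[OF assms(2,3)] by metis+
  then have "q \<noteq> 0" using assms(4) by auto
  then show ?thesis using q poly_roots_finite[of q] by simp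
qed

text \<open>An elementary form of the irreducibility of affine space: on the line joining a point
  good for I to a point good for i, each of the functions has finitely many zeros.\<close>

lemma common_nonzero:
  fixes f :: "'i \<Rightarrow> ('a, 'k::field_char_0) qrep \<Rightarrow> 'k"
  assumes "finite I" "\<And>i. i \<in> I \<Longrightarrow> poly_le Q d (k i) (f i)"
    "\<And>i. i \<in> I \<Longrightarrow> \<exists>V\<in>rep_space Q d. f i V \<noteq> 0"
  shows "\<exists>V\<in>rep_space Q d. \<forall>i\<in>I. f i V \<noteq> 0"
  using assms
proof (induction I rule: finite_induct)
  case empty
  have "(\<lambda>a\<in>arcs Q. 0\<^sub>m (d (head Q a)) (d (tail Q a))) \<in> rep_space Q d" by (auto simp: rep_space_def)
  then show ?case by blast
next
  case (insert i I)
  then obtain V where V: "V \<in> rep_space Q d" "\<And>j. j \<in> I \<Longrightarrow> f j V \<noteq> 0" by (metis insertCI)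
  obtain V' where V': "V' \<in> rep_space Q d" "f i V' \<noteq> 0" using insert.prems(2) by blast
  let ?B = "\<Union>j\<in>insert i I. {t. f j (line_rep Q d V V' t) = 0}"
  have "finite ?B"
    using insert.hyps V V' by (intro finite_UN_I finite_line_zeros[OF insert.prems(1)]) auto
  then obtain t where "t \<notin> ?B" using ex_new_if_finite[OF infinite_UNIV_char_0] by blast
  then show ?case by (intro bexI[of _ "line_rep Q d V V' t"] line_rep_space) auto
qed

lemma poly_funs_prod:
  "finite I \<Longrightarrow> (\<And>i. i \<in> I \<Longrightarrow> f i \<in> poly_funs Q d) \<Longrightarrow> (\<lambda>V. \<Prod>i\<in>I. f i V) \<in> poly_funs Q d"
proof (induction I rule: finite_induct)
  case (insert i I)
  then have "f i * (\<lambda>V. \<Prod>i\<in>I. f i V) \<in> poly_funs Q d" by (intro poly_funs.mult) auto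
  then show ?case using insert by (simp add: times_fun_def)
qed (simp add: poly_funs.const)

text \<open>U consists of the V for which no restricted determinant vanishes identically on its C i.
  Since each S i is nonzero, \<open>common_nonzero\<close> finds a point of U. A line from that
  point to an arbitrary V meets the complement of U finitely often, and interpolation along it
  recovers the determinant of V.\<close>

lemma generic_span:
  fixes C :: "'i \<Rightarrow> ('a, 'k::field_char_0) qrep set"
  assumes Q: "fin_digraph Q" and I: "finite I"
    and C: "\<And>i. i \<in> I \<Longrightarrow> C i \<subseteq> rep_space Q (d i)"
    and euler: "\<And>i. i \<in> I \<Longrightarrow> euler_form (double_quiver Q) c (double_dim (d i)) = 0"
    and span: "\<And>i. i \<in> I \<Longrightarrow> fun_space.span {res_schofield Q c (d i) (C i) V | V.
      V \<in> rep_space (double_quiver Q) c} = S i"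
    and S: "\<And>i. i \<in> I \<Longrightarrow> S i \<noteq> {0}"
  shows "\<exists>U. U \<noteq> {} \<and> zariski_open (double_quiver Q) c U \<and>
    (\<forall>i\<in>I. fun_space.span {res_schofield Q c (d i) (C i) V | V. V \<in> U} = S i) \<and>
    (\<forall>V\<in>U. \<forall>i\<in>I. res_schofield Q c (d i) (C i) V \<noteq> 0)"
proof -
  let ?D = "double_quiver Q"
  let ?W = "rep_space ?D c"
  define P where "P i M V = detI (tgt_idx Q c (d i)) (src_idx Q c (d i)) (sentry Q V (rep_W M))"
    for i and M :: "('a, 'k) qrep" and V
  define k where "k i = card (tgt_idx Q c (d i))" for i
  have P: "poly_le ?D c (k i) (P i M)" if "i \<in> I" for i M
    unfolding P_def k_def using euler[OF that] unfolding euler_form_double[OF Q]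
    by (intro poly_le_sentry_V) simp
  have res: "res_schofield Q c (d i) (C i) V M = (if M \<in> C i then P i M V else 0)"
    if "i \<in> I" "V \<in> ?W" for i V M
    using C[OF that(1)] schofield_double[OF Q that(2)] by (auto simp: res_schofield_def restr_def P_def)
  define U where "U = {V \<in> ?W. \<forall>i\<in>I. \<exists>M\<in>C i. P i M V \<noteq> 0}"
  have nz: "res_schofield Q c (d i) (C i) V \<noteq> 0 \<longleftrightarrow> (\<exists>M\<in>C i. P i M V \<noteq> 0)" if "i \<in> I" "V \<in> ?W" for i V
    using res[OF that] by (auto simp: fun_eq_iff)
  have ex: "\<exists>M\<in>C i. \<exists>V\<in>?W. P i M V \<noteq> 0" if i: "i \<in> I" for i
  proof (rule ccontr)
    assume "\<not> ?thesis"
    then have "{res_schofield Q c (d i) (C i) V | V. V \<in> ?W} \<subseteq> {0}" using nz[OF i] by blast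
    then have "fun_space.span {res_schofield Q c (d i) (C i) V | V. V \<in> ?W} \<subseteq> {0}"
      by (rule fun_space.span_minimal) (simp add: fun_space.subspace_def fun_eq_iff)
    moreover have "0 \<in> fun_space.span {res_schofield Q c (d i) (C i) V | V. V \<in> ?W}" by (rule fun_space.span_zero)
    ultimately show False using span[OF i] S[OF i] by blast
  qed
  then have "\<forall>i\<in>I. \<exists>M. M \<in> C i \<and> (\<exists>V\<in>?W. P i M V \<noteq> 0)" by blast
  from bchoice[OF this] obtain M0 where "\<forall>i\<in>I. M0 i \<in> C i \<and> (\<exists>V\<in>?W. P i (M0 i) V \<noteq> 0)"
    by (elim exE)
  then have M0: "\<And>i. i \<in> I \<Longrightarrow> M0 i \<in> C i" "\<And>i. i \<in> I \<Longrightarrow> \<exists>V\<in>?W. P i (M0 i) V \<noteq> 0"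
    by simp_all
  obtain V0 where V0: "V0 \<in> ?W" "\<And>i. i \<in> I \<Longrightarrow> P i (M0 i) V0 \<noteq> 0"
    using common_nonzero[OF I, of ?D c k "\<lambda>i. P i (M0 i)", OF P M0(2)] by blast
  have V0U: "V0 \<in> U" using V0 M0(1) by (auto simp: U_def)
  \<comment> \<open>V lies outside U when for some i all P i M V with M in C i vanish. Products over
    all choices of one point in each C i express this disjunction by equations.\<close>
  let ?S = "{\<lambda>V. \<Prod>i\<in>I. P i (\<mu> i) V | \<mu>. \<forall>i\<in>I. \<mu> i \<in> C i}"
  have "zariski_closed ?D c (?W - U)"
    unfolding zariski_closed_def
  proof (intro exI[of _ "?S"] conjI)
    show "?S \<subseteq> poly_funs ?D c"
      using poly_le_imp_poly_funs[OF P] by (auto intro: poly_funs_prod[OF I])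
    show "?W - U = {V \<in> ?W. \<forall>f\<in>?S. f V = 0}"
    proof (intro equalityI subsetI)
      fix V assume "V \<in> ?W - U"
      then obtain i where i: "i \<in> I" "\<And>M. M \<in> C i \<Longrightarrow> P i M V = 0" and V: "V \<in> ?W" by (auto simp: U_def)
      have "(\<Prod>i\<in>I. P i (\<mu> i) V) = 0" if "\<forall>i\<in>I. \<mu> i \<in> C i" for \<mu>
        using i that I by (intro prod_zero) auto
      then show "V \<in> {V \<in> ?W. \<forall>f\<in>?S. f V = 0}" using V by blast
    next
      fix V assume V: "V \<in> {V \<in> ?W. \<forall>f\<in>?S. f V = 0}"
      show "V \<in> ?W - U"
      proof
        show "V \<in> ?W" using V by blast
        show "V \<notin> U"
        proof
          assume "V \<in> U"
          then have "\<forall>i\<in>I. \<exists>M. M \<in> C i \<and> P i M V \<noteq> 0" by (auto simp: U_def)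
          from bchoice[OF this] obtain \<mu> where \<mu>: "\<forall>i\<in>I. \<mu> i \<in> C i \<and> P i (\<mu> i) V \<noteq> 0" by (elim exE)
          then have "(\<Prod>i\<in>I. P i (\<mu> i) V) \<noteq> 0" using I by simp
          moreover have "(\<lambda>V. \<Prod>i\<in>I. P i (\<mu> i) V) \<in> ?S"
            by (rule CollectI, rule exI[of _ \<mu>]) (use \<mu> in simp)
          from bspec[OF CollectD[OF V, THEN conjunct2] this] have "(\<Prod>i\<in>I. P i (\<mu> i) V) = 0" .
          ultimately show False ..
        qed
      qed
    qed
  qed
  then have "zariski_open ?D c U" unfolding zariski_open_def by (auto simp: U_def)
  moreover have "fun_space.span {res_schofield Q c (d i) (C i) V | V. V \<in> U} = S i" if i: "i \<in> I" for i
  proof -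
    let ?R = "\<lambda>A. {res_schofield Q c (d i) (C i) V | V. V \<in> A}"
    have "res_schofield Q c (d i) (C i) V \<in> fun_space.span (?R U)" if V: "V \<in> ?W" for V
    proof -
      let ?l = "line_rep ?D c V0 V"
      \<comment> \<open>The t at which the fixed witnesses M0 fail to show that the point of the
        line lies in U. They are finitely many because none fails at V0, where t = 0.\<close>
      let ?B = "\<Union>j\<in>I. {t. P j (M0 j) (?l t) = 0}"
      have "finite ?B"
        by (rule finite_UN_I[OF I], rule finite_line_zeros[OF P]) (use V0 V in auto)
      moreover have "\<exists>q. degree q \<le> k i \<and> (\<forall>t. res_schofield Q c (d i) (C i) (?l t) M = poly q t)" for M
      proof (cases "M \<in> C i")
        case True
        then show ?thesis using poly_le_line[OF P[OF i]] by (simp add: res[OF i line_rep_space])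
      next
        case False
        then show ?thesis by (intro exI[of _ 0]) (simp add: res[OF i line_rep_space])
      qed
      ultimately have in_span: "res_schofield Q c (d i) (C i) (?l 1) \<in>
          fun_space.span {res_schofield Q c (d i) (C i) (?l t) | t. t \<notin> ?B}"
        by (intro interpolation_in_span[where f = "\<lambda>t. res_schofield Q c (d i) (C i) (?l t)"])
      have "?l t \<in> U" if "t \<notin> ?B" for t
        using that M0(1) line_rep_space[of ?D c V0 V t] by (auto simp: U_def)
      then have "{res_schofield Q c (d i) (C i) (?l t) | t. t \<notin> ?B} \<subseteq> ?R U" by blast
      from fun_space.span_mono[OF this] in_span have "res_schofield Q c (d i) (C i) (?l 1) \<in> fun_space.span (?R U)"
        by (rule subsetD)
      then show ?thesis unfolding line_rep_ends(2)[OF V0(1) V] .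
    qed
    then have "fun_space.span (?R ?W) \<subseteq> fun_space.span (?R U)"
      by (intro fun_space.span_minimal) auto
    moreover have "fun_space.span (?R U) \<subseteq> fun_space.span (?R ?W)"
      by (rule fun_space.span_mono) (auto simp: U_def)
    ultimately show ?thesis using span[OF i] by blast
  qed
  moreover have "res_schofield Q c (d i) (C i) V \<noteq> 0" if "V \<in> U" "i \<in> I" for V i
    using that nz[of i V] by (auto simp: U_def)
  ultimately show ?thesis using V0U by blast
qed

theorem proposition4:
  fixes Q :: "('v, 'a) pre_digraph"
    and R :: "('v \<times> 'a list \<Rightarrow> 'k::{alg_closed_field, field_char_0}) set"
    and \<theta> :: "'v \<Rightarrow> int"
    and n :: nat
    and d :: "nat \<Rightarrow> 'v \<Rightarrow> nat"
  assumes "fin_digraph Q"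
    and "finite R"
    and "\<forall>r\<in>R. quiver_relation Q r"
    and "admissible Q (Idl\<^bsub>path_algebra Q\<^esub> R)"
    and "\<forall>i\<in>{1..n}. weight_eval Q \<theta> (d i) = 0"
    and "\<forall>i\<in>{1..n}. SI Q (d i) \<theta> (rep_variety Q R (d i)) \<noteq> {0}"
  shows
    "(\<exists>c :: 'v \<times> nat \<Rightarrow> nat.
        (\<forall>i\<in>{1..n}. euler_form (double_quiver Q) c (double_dim (d i)) = 0) \<and>
        (\<forall>i\<in>{1..n}.
           fun_space.span {res_schofield Q c (d i) (rep_variety Q R (d i)) V | V.
             V \<in> rep_space (double_quiver Q) c} = SI Q (d i) \<theta> (rep_variety Q R (d i))))
     \<and>
     (\<forall>(C :: nat \<Rightarrow> ('a, 'k) qrep set) (c :: 'v \<times> nat \<Rightarrow> nat).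
        (\<forall>i\<in>{1..n}. C i \<subseteq> rep_variety Q R (d i) \<and> irreducible_closed Q (d i) (C i) \<and>
           GL_invariant Q (d i) (C i) \<and> SI Q (d i) \<theta> (C i) \<noteq> {0}) \<and>
        (\<forall>i\<in>{1..n}. euler_form (double_quiver Q) c (double_dim (d i)) = 0) \<and>
        (\<forall>i\<in>{1..n}.
           fun_space.span {res_schofield Q c (d i) (rep_variety Q R (d i)) V | V.
             V \<in> rep_space (double_quiver Q) c} = SI Q (d i) \<theta> (rep_variety Q R (d i)))
        \<longrightarrow>
        (\<exists>U. U \<noteq> {} \<and> zariski_open (double_quiver Q) c U \<and>
           (\<forall>i\<in>{1..n}.
              fun_space.span {res_schofield Q c (d i) (C i) V | V. V \<in> U} = SI Q (d i) \<theta> (C i)) \<and>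
           (\<forall>V\<in>U. \<forall>i\<in>{1..n}. res_schofield Q c (d i) (C i) V \<noteq> 0)))"
proof -
  note Q = assms(1)
  let ?I = "{1..n}"
  let ?Z = "\<lambda>i. rep_variety Q R (d i)"
  have ZY: "?Z i \<subseteq> rep_space Q (d i)" for i by (auto simp: rep_variety_def)
  note GZ = GL_invariant_rep_variety[OF Q]
  \<comment> \<open>Vertices outside the supports of all \<open>d i\<close> carry no condition; their weights are reset to \<open>0\<close>.\<close>
  define \<eta> where "\<eta> v = (if \<exists>i\<in>?I. d i v > 0 then \<theta> v else 0)" for v
  have SI: "SI Q (d i) \<theta> X = SI Q (d i) \<eta> X" if "i \<in> ?I" for i and X :: "('a, 'k) qrep set"
    using that by (intro SI_cong) (auto simp: \<eta>_def)
  have weight: "weight_eval Q \<eta> (d i) = 0" if i: "i \<in> ?I" for i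
  proof -
    have "weight_eval Q \<eta> (d i) = weight_eval Q \<theta> (d i)"
      unfolding weight_eval_def using i by (intro sum.cong) (auto simp: \<eta>_def)
    then show ?thesis using assms(5) i by simp
  qed
  have source: "\<forall>v\<in>verts Q. v \<notin> head Q ` arcs Q \<longrightarrow> \<eta> v \<ge> 0"
  proof (intro ballI impI)
    fix v assume v: "v \<in> verts Q" "v \<notin> head Q ` arcs Q"
    show "\<eta> v \<ge> 0"
    proof (cases "\<exists>i\<in>?I. d i v > 0")
      case True
      then obtain i where i: "i \<in> ?I" "d i v > 0" by blast
      have "\<theta> v \<ge> 0"
        by (rule source_weight_nonneg[OF Q v(1) i(2) _ ZY[of i]]) (use assms(6) i v(2) in auto)
      then show ?thesis by (simp add: \<eta>_def)
    qed (simp add: \<eta>_def)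
  qed
  obtain l where nil: "\<And>d M u p v. M \<in> rep_variety Q R d \<Longrightarrow> pre_digraph.awalk Q u p v \<Longrightarrow> l \<le> length p \<Longrightarrow>
      path_mat Q d M u p = 0\<^sub>m (d v) (d u)"
    using admissible_nilpotent[OF Q assms(3,4)] by blast
  have a: "\<exists>c. (\<forall>i\<in>?I. euler_form (double_quiver Q) c (double_dim (d i)) = 0) \<and>
      (\<forall>i\<in>?I. fun_space.span {res_schofield Q c (d i) (?Z i) V | V. V \<in> rep_space (double_quiver Q) c} =
        SI Q (d i) \<theta> (?Z i))"
  proof -
    \<comment> \<open>The sum majorizes the degree bounds of all d i at once, so one choice of m and
      N serves every i.\<close>
    define B where "B = (\<Sum>i\<in>?I. \<Sum>v\<in>verts Q. nat \<bar>\<eta> v\<bar> * (l * d i v))"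
    obtain m N where "\<forall>v\<in>verts Q. B \<le> m v \<and> m v \<le> in_dim Q N v \<and> int (N v) = int (m v) + \<eta> v"
      using weight_parameters[OF Q source, of B] by (elim exE)
    then have m: "\<And>v. v \<in> verts Q \<Longrightarrow> B \<le> m v" and mN: "\<And>v. v \<in> verts Q \<Longrightarrow> m v \<le> in_dim Q N v"
      and N: "\<And>v. v \<in> verts Q \<Longrightarrow> int (N v) = int (m v) + \<eta> v" by simp_all
    let ?c = "cdim Q m N"
    have "euler_form (double_quiver Q) ?c (double_dim (d i)) = 0" if "i \<in> ?I" for i
      using card_cdim[OF Q mN weight_parameters_sum[OF weight[OF that] N]] by (simp add: euler_form_double[OF Q])
    moreover have "fun_space.span {res_schofield Q ?c (d i) (?Z i) V | V. V \<in> rep_space (double_quiver Q) ?c} =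
        SI Q (d i) \<theta> (?Z i)" if i: "i \<in> ?I" for i
    proof
      note sum_eq = weight_parameters_sum[OF weight[OF i] N]
      show "fun_space.span {res_schofield Q ?c (d i) (?Z i) V | V. V \<in> rep_space (double_quiver Q) ?c} \<subseteq> SI Q (d i) \<theta> (?Z i)"
        unfolding SI[OF i]
        using res_schofield_SI[OF Q ZY GZ mN N sum_eq] by (intro fun_space.span_minimal subspace_SI) auto
      show "SI Q (d i) \<theta> (?Z i) \<subseteq> fun_space.span {res_schofield Q ?c (d i) (?Z i) V | V. V \<in> rep_space (double_quiver Q) ?c}"
        unfolding SI[OF i]
      proof
        fix f assume f: "f \<in> SI Q (d i) \<eta> (?Z i)"
        have "(\<Sum>v\<in>verts Q. nat \<bar>\<eta> v\<bar> * (l * d i v)) \<le> B"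
          unfolding B_def using i by (intro member_le_sum[of i ?I "\<lambda>i. \<Sum>v\<in>verts Q. nat \<bar>\<eta> v\<bar> * (l * d i v)"]) auto
        from SI_degree_bound[OF Q source weight[OF i] nil f this]
        obtain F where F: "poly_le Q (d i) B F" "f = restr (?Z i) F" by blast
        show "f \<in> fun_space.span {res_schofield Q ?c (d i) (?Z i) V | V. V \<in> rep_space (double_quiver Q) ?c}"
          using SI_in_span[OF Q ZY GZ _ F(1) m mN N sum_eq] f F(2) by simp
      qed
    qed
    ultimately show ?thesis by blast
  qed
  have b: "\<exists>U. U \<noteq> {} \<and> zariski_open (double_quiver Q) c U \<and>
      (\<forall>i\<in>?I. fun_space.span {res_schofield Q c (d i) (C i) V | V. V \<in> U} = SI Q (d i) \<theta> (C i)) \<and>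
      (\<forall>V\<in>U. \<forall>i\<in>?I. res_schofield Q c (d i) (C i) V \<noteq> 0)"
    if C: "\<And>i. i \<in> ?I \<Longrightarrow> C i \<subseteq> ?Z i \<and> irreducible_closed Q (d i) (C i) \<and>
        GL_invariant Q (d i) (C i) \<and> SI Q (d i) \<theta> (C i) \<noteq> {0}"
      and euler: "\<And>i. i \<in> ?I \<Longrightarrow> euler_form (double_quiver Q) c (double_dim (d i)) = 0"
      and span: "\<And>i. i \<in> ?I \<Longrightarrow> fun_space.span {res_schofield Q c (d i) (?Z i) V | V.
        V \<in> rep_space (double_quiver Q) c} = SI Q (d i) \<theta> (?Z i)"
    for C :: "nat \<Rightarrow> ('a, 'k) qrep set" and c
  proof (rule generic_span[OF Q finite_atLeastAtMost])
    show "C i \<subseteq> rep_space Q (d i)" if "i \<in> ?I" for i using C[OF that] ZY by blast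
    show "fun_space.span {res_schofield Q c (d i) (C i) V | V. V \<in> rep_space (double_quiver Q) c} =
        SI Q (d i) \<theta> (C i)" if i: "i \<in> ?I" for i
    proof
      have CZ: "C i \<subseteq> ?Z i" and GC: "GL_invariant Q (d i) (C i)" using C[OF i] by auto
      have CY: "C i \<subseteq> rep_space Q (d i)" using CZ ZY by blast
      have "res_schofield Q c (d i) (C i) V \<in> SI Q (d i) \<theta> (C i)" if "V \<in> rep_space (double_quiver Q) c" for V
      proof -
        have "res_schofield Q c (d i) (?Z i) V \<in> SI Q (d i) \<theta> (?Z i)"
          unfolding span[OF i, symmetric] using that by (intro fun_space.span_base) blast
        then show ?thesis unfolding res_schofield_restr[OF CZ] by (rule SI_restr[OF _ CZ GC])
      qed
      then show "fun_space.span {res_schofield Q c (d i) (C i) V | V. V \<in> rep_space (double_quiver Q) c} \<subseteq>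
          SI Q (d i) \<theta> (C i)" by (intro fun_space.span_minimal subspace_SI) auto
      show "SI Q (d i) \<theta> (C i) \<subseteq>
          fun_space.span {res_schofield Q c (d i) (C i) V | V. V \<in> rep_space (double_quiver Q) c}"
      proof
        fix f assume "f \<in> SI Q (d i) \<theta> (C i)"
        then have f: "f \<in> SI Q (d i) \<eta> (C i)" by (simp add: SI[OF i])
        obtain k F where F: "poly_le Q (d i) k F" "f = restr (C i) F" using SI_poly_le[OF f] .
        \<comment> \<open>The degree k depends on f, so an auxiliary dimension vector is used,
          unrelated to the given c. Its determinants extend f to a semi-invariant of the whole
          variety, which lies in the span for c by assumption; restricting back to C i ends the
          argument.\<close>
        obtain m N where "\<forall>v\<in>verts Q. k \<le> m v \<and> m v \<le> in_dim Q N v \<and> int (N v) = int (m v) + \<eta> v"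
          using weight_parameters[OF Q source, of k] by (elim exE)
        then have m: "\<And>v. v \<in> verts Q \<Longrightarrow> k \<le> m v" and mN: "\<And>v. v \<in> verts Q \<Longrightarrow> m v \<le> in_dim Q N v"
          and N: "\<And>v. v \<in> verts Q \<Longrightarrow> int (N v) = int (m v) + \<eta> v" by simp_all
        note sum_eq = weight_parameters_sum[OF weight[OF i] N]
        let ?c = "cdim Q m N"
        have "f \<in> fun_space.span {res_schofield Q ?c (d i) (C i) V | V. V \<in> rep_space (double_quiver Q) ?c}"
          using SI_in_span[OF Q CY GC _ F(1) m mN N sum_eq] f F(2) by simp
        then obtain F' where F': "F' \<in> fun_space.span {res_schofield Q ?c (d i) (?Z i) V | V.
            V \<in> rep_space (double_quiver Q) ?c}" and fF': "f = restr (C i) F'"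
          using span_lift[OF _ CZ] by blast
        have "{res_schofield Q ?c (d i) (?Z i) V | V. V \<in> rep_space (double_quiver Q) ?c} \<subseteq> SI Q (d i) \<eta> (?Z i)"
          using res_schofield_SI[OF Q ZY GZ mN N sum_eq] by auto
        then have "F' \<in> SI Q (d i) \<eta> (?Z i)"
          using fun_space.span_minimal[OF _ subspace_SI] F' by blast
        then have "F' \<in> fun_space.span {res_schofield Q c (d i) (?Z i) V | V. V \<in> rep_space (double_quiver Q) c}"
          unfolding span[OF i] SI[OF i] .
        then show "f \<in> fun_space.span {res_schofield Q c (d i) (C i) V | V. V \<in> rep_space (double_quiver Q) c}"
          unfolding fF' by (rule span_restr[OF _ CZ])
      qed
    qed
    show "SI Q (d i) \<theta> (C i) \<noteq> {0}" if "i \<in> ?I" for i using C[OF that] by blast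
  qed (rule euler)
  show ?thesis
    by (rule conjI[OF a], intro allI impI, elim conjE, rule b) (erule (1) bspec)+
qed

end
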